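(* Let $P$ be a Baxter poset on $[n]$ drawn in the plane with a natural embedding. There is a unique Baxter permutation in $S_n$ that is a linear extension of $P$; there is also a unique linear extension of $P$ that respects the arrows of the embedding, and these two permutations coincide.
   Context: **Posets.** For a poset $P$ on $[n]=\{1,\dots,n\}$, $<_P$ is its strict order and $<$ the usual numerical order. $x\lessdot_P y$ means $x<_P y$ and there is no $z$ with $x<_P z<_P y$ (a cover relation). $P$ is bounded if it has a least and a greatest element. $(x,y)=\{z: x<_P z<_P y\}$ is the open interval; it is disconnected if it has at least two connected components (as a poset, i.e. its comparability graph is disconnected). A linear extension of $P$ is a permutation $\sigma=\sigma_1\cdots\sigma_n$ of $[n]$ (one-line notation) such that $x<_P y$ implies that $x$ precedes $y$ in $\sigma$. **Chains.** For numbers $a<b<c<d$ in $[n]$: a 2-14-3 chain is $b<_P a\lessdot_P d<_P c$; a 3-14-2 chain is $c<_P a\lessdot_P d<_P b$; a 2-41-3 chain is $b<_P d\lessdot_P a<_P c$; a 3-41-2 chain is $c<_P d\lessdot_P a<_P b$. **Planar embeddings.** A Hasse diagram for $P$ is a drawing in $\mathbb{R}^2$ of the graph of cover relations in which, whenever $x\lessdot_P y$, the point $y$ is above the point $x$ and they are joined by a straight line segment. A planar embedding is a Hasse diagram in which no two edges intersect (except at common endpoints). A finite bounded poset with a planar embedding is a lattice. In a planar embedding of a lattice, let $S(x)$ be the union of all (drawn, maximal) chains containing $x$ and all horizontal line segments whose endpoints lie on these chains. Then $x$ is left of $y$ if $y\notin S(x)$ and the left-pointing horizontal ray starting at $y$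 meets $S(x)$. **Baxter posets.** A poset $P$ on $[n]$ is a Baxter poset if: 1. $P$ is bounded. 2. Every $x\in P$ is covered by at most two elements and covers at most two elements. 3. $P$ contains no 2-14-3, no 3-14-2, no 2-41-3 and no 3-41-2 chains. 4. If $[x,y]$ is an interval of $P$ such that $(x,y)$ is disconnected, then $|x-y|=1$. 5. There exists a planar embedding of $P$ such that for every interval $[x,y]$ of $P$ with $(x,y)$ disconnected, if $w,z$ lie in different connected components of $(x,y)$ and $w$ is left of $z$, then $w<x<z$ in numerical order. An embedding as in Condition 5 is called a natural embedding. **Regions and arrows.** The edges of the embedding separate the plane into maximal connected components; the closure of a bounded component is a region. The boundary of a region $R$ consists of two chains of $P$ from the minimal element of $R$ to the maximal element of $R$; the elements of the left chain (resp. right chain) other than the minimal and maximal elements of $R$ form the left side (resp. right side) of $R$. The region $R$ is assigned a right-pointing arrow if its maximal element is numerically greater than its minimal element, and a left-pointing arrow otherwise. A linear extension $\sigma$ respects the arrow of a region with a right-pointing arrow if in $\sigma$ all elements of the left side precede all elements of the right side; it respects the arrow of a region with a left-pointing arrow if all elements of the right side precede all elements of the left side. $\sigma$ respects the arrows of $P$ (of the embedding) if it respects the arrow of every region. **Baxter permutations.** $\sigma\in S_n$ is a Baxter permutation if it avoids 2-41-3 and 3-14-2, i.e. there are no $i<j<j+1<k$ with $\sigma_{j+1}<\sigma_i<\sigma_k<\sigma_j$ or $\sigma_j<\sigma_k<\sigma_i<\sigma_{j+1}$. *)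

theory Defs
  imports "HOL-Analysis.Analysis" "HOL-Combinatorics.Permutations"
begin

text \<open>
  A poset on \<open>[n]\<close> is a reflexive relation \<open>P\<close> with \<open>partial_order_on {1..n} P\<close>, where \<open>(x, y) \<in> P\<close>
  means \<open>x \<le>\<^sub>P y\<close>. The symbols \<open><\<close> and \<open>\<le>\<close> always denote the numerical order.
\<close>

definition less_in :: "nat rel \<Rightarrow> nat \<Rightarrow> nat \<Rightarrow> bool" where
  "less_in P x y \<longleftrightarrow> (x, y) \<in> P \<and> x \<noteq> y"

definition covered_by :: "nat rel \<Rightarrow> nat \<Rightarrow> nat \<Rightarrow> bool" where
  "covered_by P x y \<longleftrightarrow> less_in P x y \<and> (\<nexists>z. less_in P x z \<and> less_in P z y)"

definition closed_interval :: "nat rel \<Rightarrow> nat \<Rightarrow> nat \<Rightarrow> nat set" where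
  "closed_interval P x y = {z. (x, z) \<in> P \<and> (z, y) \<in> P}"

definition open_interval :: "nat rel \<Rightarrow> nat \<Rightarrow> nat \<Rightarrow> nat set" where
  "open_interval P x y = {z. less_in P x z \<and> less_in P z y}"

definition bounded_poset :: "nat \<Rightarrow> nat rel \<Rightarrow> bool" where
  "bounded_poset n P \<longleftrightarrow>
     (\<exists>b\<in>{1..n}. \<forall>x\<in>{1..n}. (b, x) \<in> P) \<and> (\<exists>t\<in>{1..n}. \<forall>x\<in>{1..n}. (x, t) \<in> P)"

definition comparability :: "nat rel \<Rightarrow> nat set \<Rightarrow> nat rel" where
  "comparability P I = {(u, v) \<in> I \<times> I. (u, v) \<in> P \<or> (v, u) \<in> P}"

definition poset_components :: "nat rel \<Rightarrow> nat set \<Rightarrow> nat set set" where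
  "poset_components P I = I // ((comparability P I)\<^sup>*  \<inter> I \<times> I)"

definition disconnected :: "nat rel \<Rightarrow> nat set \<Rightarrow> bool" where
  "disconnected P I \<longleftrightarrow> (\<exists>C\<in>poset_components P I. \<exists>D\<in>poset_components P I. C \<noteq> D)"


definition has_2_14_3_chain :: "nat \<Rightarrow> nat rel \<Rightarrow> bool" where
  "has_2_14_3_chain n P \<longleftrightarrow> (\<exists>a\<in>{1..n}. \<exists>b\<in>{1..n}. \<exists>c\<in>{1..n}. \<exists>d\<in>{1..n}.
     a < b \<and> b < c \<and> c < d \<and> less_in P b a \<and> covered_by P a d \<and> less_in P d c)"

definition has_3_14_2_chain :: "nat \<Rightarrow> nat rel \<Rightarrow> bool" where
  "has_3_14_2_chain n P \<longleftrightarrow> (\<exists>a\<in>{1..n}. \<exists>b\<in>{1..n}. \<exists>c\<in>{1..n}. \<exists>d\<in>{1..n}.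
     a < b \<and> b < c \<and> c < d \<and> less_in P c a \<and> covered_by P a d \<and> less_in P d b)"

definition has_2_41_3_chain :: "nat \<Rightarrow> nat rel \<Rightarrow> bool" where
  "has_2_41_3_chain n P \<longleftrightarrow> (\<exists>a\<in>{1..n}. \<exists>b\<in>{1..n}. \<exists>c\<in>{1..n}. \<exists>d\<in>{1..n}.
     a < b \<and> b < c \<and> c < d \<and> less_in P b d \<and> covered_by P d a \<and> less_in P a c)"

definition has_3_41_2_chain :: "nat \<Rightarrow> nat rel \<Rightarrow> bool" where
  "has_3_41_2_chain n P \<longleftrightarrow> (\<exists>a\<in>{1..n}. \<exists>b\<in>{1..n}. \<exists>c\<in>{1..n}. \<exists>d\<in>{1..n}.
     a < b \<and> b < c \<and> c < d \<and> less_in P c d \<and> covered_by P d a \<and> less_in P a b)"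


definition maximal_chains_in :: "nat rel \<Rightarrow> nat set \<Rightarrow> nat set set" where
  "maximal_chains_in P A =
     {C \<in> Chains P. C \<subseteq> A \<and> (\<forall>D\<in>Chains P. C \<subseteq> D \<and> D \<subseteq> A \<longrightarrow> D = C)}"

text \<open>
  Drawings are given by the positions \<open>pos x\<close> of the elements; \<open>snd\<close> is the height. The vertices in
  \<open>drawn\<close> only add something to the edges if \<open>A\<close> has an element on no edge within \<open>A\<close>, as for the
  maximal chain of the one-element poset.
\<close>

definition drawn :: "nat rel \<Rightarrow> (nat \<Rightarrow> real \<times> real) \<Rightarrow> nat set \<Rightarrow> (real \<times> real) set" where
  "drawn P pos A =
     pos ` A \<union> \<Union> {closed_segment (pos x) (pos y) | x y. x \<in> A \<and> y \<in> A \<and> covered_by P x y}"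

definition hasse_diagram :: "nat \<Rightarrow> nat rel \<Rightarrow> (nat \<Rightarrow> real \<times> real) \<Rightarrow> bool" where
  "hasse_diagram n P pos \<longleftrightarrow>
     inj_on pos {1..n} \<and> (\<forall>x y. covered_by P x y \<longrightarrow> snd (pos x) < snd (pos y))"

definition planar_embedding :: "nat \<Rightarrow> nat rel \<Rightarrow> (nat \<Rightarrow> real \<times> real) \<Rightarrow> bool" where
  "planar_embedding n P pos \<longleftrightarrow> hasse_diagram n P pos \<and>
     (\<forall>a b c d. covered_by P a b \<and> covered_by P c d \<and> (a, b) \<noteq> (c, d) \<longrightarrow>
        closed_segment (pos a) (pos b) \<inter> closed_segment (pos c) (pos d) \<subseteq> pos ` ({a, b} \<inter> {c, d}))"

definition chains_through :: "nat \<Rightarrow> nat rel \<Rightarrow> (nat \<Rightarrow> real \<times> real) \<Rightarrow> nat \<Rightarrow> (real \<times> real) set" where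
  "chains_through n P pos x = \<Union> {drawn P pos C | C. C \<in> maximal_chains_in P {1..n} \<and> x \<in> C}"

definition span_region :: "nat \<Rightarrow> nat rel \<Rightarrow> (nat \<Rightarrow> real \<times> real) \<Rightarrow> nat \<Rightarrow> (real \<times> real) set" where
  "span_region n P pos x = chains_through n P pos x \<union>
     \<Union> {closed_segment p q | p q.
          p \<in> chains_through n P pos x \<and> q \<in> chains_through n P pos x \<and> snd p = snd q}"

definition left_of :: "nat \<Rightarrow> nat rel \<Rightarrow> (nat \<Rightarrow> real \<times> real) \<Rightarrow> nat \<Rightarrow> nat \<Rightarrow> bool" where
  "left_of n P pos x y \<longleftrightarrow> pos y \<notin> span_region n P pos x \<and>
     {(t, snd (pos y)) | t. t \<le> fst (pos y)} \<inter> span_region n P pos x \<noteq> {}"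


definition natural_embedding :: "nat \<Rightarrow> nat rel \<Rightarrow> (nat \<Rightarrow> real \<times> real) \<Rightarrow> bool" where
  "natural_embedding n P pos \<longleftrightarrow> planar_embedding n P pos \<and>
     (\<forall>x y. (x, y) \<in> P \<and> disconnected P (open_interval P x y) \<longrightarrow>
        (\<forall>C\<in>poset_components P (open_interval P x y).
         \<forall>D\<in>poset_components P (open_interval P x y). C \<noteq> D \<longrightarrow>
           (\<forall>w\<in>C. \<forall>z\<in>D. left_of n P pos w z \<longrightarrow> w < x \<and> x < z)))"

definition baxter_poset :: "nat \<Rightarrow> nat rel \<Rightarrow> bool" where
  "baxter_poset n P \<longleftrightarrow>
     partial_order_on {1..n} P \<and>
     bounded_poset n P \<and>
     (\<forall>x\<in>{1..n}. card {y. covered_by P x y} \<le> 2 \<and> card {y. covered_by P y x} \<le> 2) \<and>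
     \<not> has_2_14_3_chain n P \<and> \<not> has_3_14_2_chain n P \<and>
     \<not> has_2_41_3_chain n P \<and> \<not> has_3_41_2_chain n P \<and>
     (\<forall>x y. (x, y) \<in> P \<and> disconnected P (open_interval P x y) \<longrightarrow> \<bar>int x - int y\<bar> = 1) \<and>
     (\<exists>pos. natural_embedding n P pos)"


definition regions :: "nat \<Rightarrow> nat rel \<Rightarrow> (nat \<Rightarrow> real \<times> real) \<Rightarrow> (real \<times> real) set set" where
  "regions n P pos = closure ` {C \<in> components (- drawn P pos {1..n}). bounded C}"

text \<open>
  \<open>region_boundary P pos R m M L Q\<close>: the region \<open>R\<close> has minimal element \<open>m\<close> and maximal element \<open>M\<close>,
  and its boundary consists of the left chain \<open>L\<close> and the right chain \<open>Q\<close>, both including \<open>m\<close>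
  and \<open>M\<close>. Drawn chains meet every horizontal line in at most one point, so comparing points
  of equal height decides which chain is the left one.
\<close>

definition region_boundary ::
  "nat rel \<Rightarrow> (nat \<Rightarrow> real \<times> real) \<Rightarrow> (real \<times> real) set \<Rightarrow> nat \<Rightarrow> nat \<Rightarrow> nat set \<Rightarrow> nat set \<Rightarrow> bool" where
  "region_boundary P pos R m M L Q \<longleftrightarrow>
     less_in P m M \<and>
     L \<in> maximal_chains_in P (closed_interval P m M) \<and>
     Q \<in> maximal_chains_in P (closed_interval P m M) \<and>
     frontier R = drawn P pos L \<union> drawn P pos Q \<and>
     (\<forall>p\<in>drawn P pos L. \<forall>q\<in>drawn P pos Q. snd p = snd q \<longrightarrow> fst p \<le> fst q)"

text \<open>
  Elements of \<open>S\<^sub>n\<close> are the functions \<open>\<sigma>\<close> with \<open>\<sigma> permutes {1..n}\<close>; the one-line notation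
  is \<open>\<sigma> 1, \<dots>, \<sigma> n\<close>, so \<open>inv \<sigma> x\<close> is the place of the number \<open>x\<close>.
\<close>

definition precedes :: "(nat \<Rightarrow> nat) \<Rightarrow> nat \<Rightarrow> nat \<Rightarrow> bool" where
  "precedes \<sigma> x y \<longleftrightarrow> inv \<sigma> x < inv \<sigma> y"

definition linear_extension :: "nat \<Rightarrow> nat rel \<Rightarrow> (nat \<Rightarrow> nat) \<Rightarrow> bool" where
  "linear_extension n P \<sigma> \<longleftrightarrow>
     \<sigma> permutes {1..n} \<and> (\<forall>x y. less_in P x y \<longrightarrow> precedes \<sigma> x y)"

definition baxter_permutation :: "nat \<Rightarrow> (nat \<Rightarrow> nat) \<Rightarrow> bool" where
  "baxter_permutation n \<sigma> \<longleftrightarrow> \<sigma> permutes {1..n} \<and>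
     \<not> (\<exists>i j k. 1 \<le> i \<and> i < j \<and> j + 1 < k \<and> k \<le> n \<and>
          (\<sigma> (j + 1) < \<sigma> i \<and> \<sigma> i < \<sigma> k \<and> \<sigma> k < \<sigma> j \<or>
           \<sigma> j < \<sigma> k \<and> \<sigma> k < \<sigma> i \<and> \<sigma> i < \<sigma> (j + 1)))"

text \<open>The arrow of a region points right if \<open>m < M\<close> and left otherwise.\<close>

definition respects_arrows ::
  "nat \<Rightarrow> nat rel \<Rightarrow> (nat \<Rightarrow> real \<times> real) \<Rightarrow> (nat \<Rightarrow> nat) \<Rightarrow> bool" where
  "respects_arrows n P pos \<sigma> \<longleftrightarrow>
     (\<forall>R\<in>regions n P pos. \<forall>m M L Q. region_boundary P pos R m M L Q \<longrightarrow>
        (\<forall>l\<in>L - {m, M}. \<forall>q\<in>Q - {m, M}.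
           if m < M then precedes \<sigma> l q else precedes \<sigma> q l))"

end

theory Submission
  imports Defs
begin

text \<open>
  \<^emph>\<open>Combinatorics.\<close> In a natural embedding an incomparable pair \<open>x\<close>, \<open>y\<close> with \<open>x\<close> left of \<open>y\<close>
  satisfies \<open>x < y\<close>, and its meet and join lie numerically strictly between \<open>x\<close> and \<open>y\<close>. Hence
  \<open>n - 1\<close> and \<open>n\<close> are comparable, and \<open>n\<close> covers at most one element \<open>p\<close> and dually. Deleting \<open>n\<close> gives a
  poset of the same kind, whose Baxter extension is known by induction. If \<open>n - 1\<close> precedes \<open>n\<close>, then
  every entry after \<open>p\<close> is smaller than \<open>p\<close>, since otherwise there is a 3-14-2 chain or a larger join; so
  inserting \<open>n\<close> right after \<open>p\<close> gives a Baxter permutation. If another arrow-respecting extension had some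
  \<open>s\<close> between \<open>p\<close> and \<open>n\<close>, then either \<open>s\<close> covers \<open>p\<close>, so that the arrow of the cell above \<open>p\<close> is violated,
  or exchanging \<open>p\<close> and \<open>s\<close> in the unique smaller extension shows that they lie on opposite sides of a
  common cell, which yields a violated arrow or a 2-41-3 chain. The case
  where \<open>n\<close> precedes \<open>n - 1\<close> is dual. A Baxter extension respects the arrows because between the
  consecutive values \<open>m\<close>, \<open>M\<close> it can switch only once between small and large entries.

  \<^emph>\<open>Geometry.\<close> A maximal chain is drawn as the graph of a continuous function of the height, and two such
  graphs meet only in common vertices or edges. By the intermediate value theorem this makes ``left of''
  a transitive orientation of the incomparability relation, gives meets and joins, and identifies
  the regions with the bands between two chains from \<open>m\<close> to \<open>M\<close> on the inner boundaries of the two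
  components of the open interval.
\<close>

section \<open>Words\<close>

text \<open>Deleting \<open>n\<close> can create a cover relation that had \<open>n\<close> between
  its ends, and the straight segment for it need not fit into the old drawing. So the induction
  cannot run on drawn posets. It runs on abstract orders in which size replaces horizontal position:
  of two incomparable elements the smaller one counts as the left one. This is justified by
  extending the natural condition, which only constrains elements in different components of an open
  interval, to all incomparable pairs. The class has to be closed under deletion of \<open>n\<close>
  and under reversal, which shapes its axioms: joins and meets of incomparable pairs take the place
  of bounds and embedding, and a region becomes an open interval cut into a smaller and a larger
  part. Being the largest number, \<open>n\<close> can only enter the larger, right part of such a
  cut. Hence each arrow of the smaller order follows from an arrow of the larger one, the induction
  hypothesis fixes the order of all other entries, and only the place of \<open>n\<close> remains to
  be found.\<close>

fun before :: "'a list \<Rightarrow> 'a \<Rightarrow> 'a \<Rightarrow> bool" where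
  "before [] x y = False"
| "before (z # zs) x y = (x = z \<and> y \<in> set zs \<or> before zs x y)"

lemma before_set: "before xs x y \<Longrightarrow> x \<in> set xs \<and> y \<in> set xs"
  by (induction xs) auto

lemma before_append [simp]:
  "before (us @ vs) x y \<longleftrightarrow> before us x y \<or> before vs x y \<or> x \<in> set us \<and> y \<in> set vs"
  by (induction us) auto

lemma before_rev [simp]: "before (rev xs) x y \<longleftrightarrow> before xs y x"
  by (induction xs) auto

lemma before_removeAll: "before (removeAll z xs) x y \<longleftrightarrow> before xs x y \<and> x \<noteq> z \<and> y \<noteq> z"
  by (induction xs) (auto dest: before_set)

lemma before_total: "x \<in> set xs \<Longrightarrow> y \<in> set xs \<Longrightarrow> x \<noteq> y \<Longrightarrow> before xs x y \<or> before xs y x"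
  by (induction xs) auto

lemma before_asym: "distinct xs \<Longrightarrow> before xs x y \<Longrightarrow> \<not> before xs y x"
  by (induction xs) (auto dest: before_set)

lemma before_irrefl: "distinct xs \<Longrightarrow> \<not> before xs x x"
  by (induction xs) (auto dest: before_set)

lemma before_decomp: "before xs x y \<Longrightarrow> \<exists>us vs ws. xs = us @ x # vs @ y # ws"
proof (induction xs)
  case (Cons z zs)
  then consider "x = z" "y \<in> set zs" | "before zs x y"
    by auto
  then show ?case
  proof cases
    case 1
    then show ?thesis
      by (metis append_Nil split_list)
  next
    case 2
    then show ?thesis
      using Cons.IH by (metis append_Cons)
  qed
qed simp

section \<open>Baxter extensions of abstract orders\<close>

definition incomp :: "('a \<Rightarrow> 'a \<Rightarrow> bool) \<Rightarrow> 'a \<Rightarrow> 'a \<Rightarrow> bool" where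
  "incomp r x y \<longleftrightarrow> x \<noteq> y \<and> \<not> r x y \<and> \<not> r y x"

definition covers :: "('a \<Rightarrow> 'a \<Rightarrow> bool) \<Rightarrow> 'a \<Rightarrow> 'a \<Rightarrow> bool" where
  "covers r x y \<longleftrightarrow> r x y \<and> (\<nexists>z. r x z \<and> r z y)"

text \<open>A region without a drawing: \<open>A\<close> is the left and \<open>B\<close> the right
  part of the open interval, and size stands in for horizontal position.\<close>

definition split_interval ::
  "(nat \<Rightarrow> nat \<Rightarrow> bool) \<Rightarrow> nat \<Rightarrow> nat \<Rightarrow> nat set \<Rightarrow> nat set \<Rightarrow> bool" where
  "split_interval r m M A B \<longleftrightarrow> {z. r m z \<and> r z M} = A \<union> B \<and> A \<noteq> {} \<and> B \<noteq> {} \<and>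
     (\<forall>a\<in>A. \<forall>b\<in>B. incomp r a b \<and> a < b)"

text \<open>The elements of \<open>A\<close> with nothing of \<open>A\<close> to their right, that
  is, the chain that bounds the region from the left. \<open>left_boundary\<close> is the mirror
  image; together they are the two sides of the region.\<close>

definition right_boundary :: "(nat \<Rightarrow> nat \<Rightarrow> bool) \<Rightarrow> nat set \<Rightarrow> nat set" where
  "right_boundary r A = {l \<in> A. \<forall>u\<in>A. \<not> (incomp r l u \<and> l < u)}"

definition left_boundary :: "(nat \<Rightarrow> nat \<Rightarrow> bool) \<Rightarrow> nat set \<Rightarrow> nat set" where
  "left_boundary r B = {q \<in> B. \<forall>u\<in>B. \<not> (incomp r q u \<and> u < q)}"

definition extension :: "nat \<Rightarrow> (nat \<Rightarrow> nat \<Rightarrow> bool) \<Rightarrow> nat list \<Rightarrow> bool" where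
  "extension n r xs \<longleftrightarrow> distinct xs \<and> set xs = {1..n} \<and> (\<forall>x y. r x y \<longrightarrow> before xs x y)"

definition baxter_word :: "nat list \<Rightarrow> bool" where
  "baxter_word xs \<longleftrightarrow> (\<forall>us x y vs. xs = us @ x # y # vs \<longrightarrow>
     (\<forall>b\<in>set us. \<forall>c\<in>set vs. \<not> (y < b \<and> b < c \<and> c < x) \<and> \<not> (x < c \<and> c < b \<and> b < y)))"

definition respecting :: "(nat \<Rightarrow> nat \<Rightarrow> bool) \<Rightarrow> nat list \<Rightarrow> bool" where
  "respecting r xs \<longleftrightarrow> (\<forall>m M A B. split_interval r m M A B \<longrightarrow>
     (\<forall>l\<in>right_boundary r A. \<forall>q\<in>left_boundary r B. if m < M then before xs l q else before xs q l))"

lemma respectingD: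
  assumes "respecting r xs" "split_interval r m M A B" "l \<in> right_boundary r A" "q \<in> left_boundary r B"
  shows "if m < M then before xs l q else before xs q l"
  using assms(1)[unfolded respecting_def, rule_format, OF assms(2-4)] .

text \<open>A discrete intermediate value theorem. It finds the adjacent pair of a forbidden pattern
  in a word, and later the edge of a path into which a further element would fit.\<close>

lemma adjacent_change:
  assumes "P (hd w)" "\<not> P (last w)" "w \<noteq> []"
  shows "\<exists>us x y vs. w = us @ x # y # vs \<and> P x \<and> \<not> P y"
  using assms
proof (induction w)
  case (Cons a w)
  show ?case
  proof (cases w)
    case Nil
    then show ?thesis using Cons by simp
  next
    case (Cons b w')
    show ?thesis
    proof (cases "P b")
      case True
      then obtain us x y vs where "w = us @ x # y # vs" "P x" "\<not> P y"
        using Cons.IH Cons Cons.prems by auto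
      then show ?thesis by (metis append_Cons)
    next
      case False
      then show ?thesis
        using Cons Cons.prems by (metis append_Nil list.sel(1))
    qed
  qed
qed simp

text \<open>Between two consecutive values every entry is smaller or larger than both, so a Baxter
  sequence can pass only once from one kind to the other.\<close>

lemma baxter_word_between_up:
  assumes "baxter_word xs" "distinct xs" "before xs m q" "before xs q l" "before xs l (Suc m)" "l < m"
  shows "q < m"
proof (rule ccontr)
  assume nq: "\<not> q < m"
  obtain us vs ws where 1: "xs = us @ q # vs @ l # ws"
    using assms before_decomp by metis
  have m: "m \<in> set us" and M: "Suc m \<in> set ws"
    using assms(2,3,5) unfolding 1 by (auto dest: before_set)
  define w where "w = q # vs @ [l]"
  have "q \<noteq> m" using assms(2) m unfolding 1 by auto
  then obtain w1 x y w2 where w: "w = w1 @ x # y # w2" "m < x" "\<not> m < y"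
    using adjacent_change[of "\<lambda>z. m < z" w] nq assms(6) unfolding w_def by auto
  have xs: "xs = (us @ w1) @ x # y # (w2 @ ws)"
    using 1 w(1) w_def by (metis append.assoc append_Cons append_Nil)
  have "x \<noteq> Suc m" "y \<noteq> m"
    using assms(2) m M unfolding xs 
    by (auto)
  \<comment> \<open>The adjacent pair \<open>x\<close>, \<open>y\<close> plays 41, with
    \<open>m\<close> before it as 2 and \<open>Suc m\<close> after it as 3.\<close>
  then have "y < m \<and> m < Suc m \<and> Suc m < x"
    using w by auto
  then show False
    using assms(1) xs m M unfolding baxter_word_def by (metis Un_iff set_append)
qed

lemma baxter_word_between_down:
  assumes "baxter_word xs" "distinct xs" "before xs (Suc M) l" "before xs l q" "before xs q M" "Suc M < q"
  shows "M < l"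
proof (rule ccontr)
  assume nq: "\<not> M < l"
  obtain us vs ws where 1: "xs = us @ l # vs @ q # ws"
    using assms before_decomp by metis
  have m: "Suc M \<in> set us" and M: "M \<in> set ws"
    using assms(2,3,5) unfolding 1 by (auto dest: before_set)
  define w where "w = l # vs @ [q]"
  obtain w1 x y w2 where w: "w = w1 @ x # y # w2" "x \<le> M" "\<not> y \<le> M"
    using adjacent_change[of "\<lambda>z. z \<le> M" w] nq assms(6) unfolding w_def by auto
  have xs: "xs = (us @ w1) @ x # y # (w2 @ ws)"
    using 1 w(1) w_def by (metis append.assoc append_Cons append_Nil)
  have "x \<noteq> M" "y \<noteq> Suc M"
    using assms(2) m M unfolding xs 
    by (auto)
  \<comment> \<open>Here \<open>x\<close>, \<open>y\<close> plays 14, with \<open>Suc M\<close>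
    before it as 3 and \<open>M\<close> after it as 2.\<close>
  then have "x < M \<and> M < Suc M \<and> Suc M < y"
    using w by auto
  then show False
    using assms(1) xs m M unfolding baxter_word_def by (metis Un_iff set_append)
qed

lemma baxter_word_rev:
  assumes "baxter_word xs"
  shows "baxter_word (rev xs)"
  unfolding baxter_word_def
proof (intro allI impI ballI)
  fix us x y vs b c
  assume "rev xs = us @ x # y # vs" and bc: "b \<in> set us" "c \<in> set vs"
  then have "xs = rev vs @ y # x # rev us"
    by (metis append.assoc append_Cons append_Nil rev.simps(2) rev_append rev_rev_ident)
  then show "\<not> (y < b \<and> b < c \<and> c < x) \<and> \<not> (x < c \<and> c < b \<and> b < y)"
    using assms bc unfolding baxter_word_def by (metis set_rev)
qed

lemma incomp_sym: "incomp r x y \<longleftrightarrow> incomp r y x"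
  by (auto simp: incomp_def)

lemma incomp_dual: "incomp (\<lambda>x y. r y x) x y \<longleftrightarrow> incomp r x y"
  by (auto simp: incomp_def)

lemma covers_dual: "covers (\<lambda>x y. r y x) x y \<longleftrightarrow> covers r y x"
  by (auto simp: covers_def)

lemma split_dual: "split_interval (\<lambda>x y. r y x) m M A B \<longleftrightarrow> split_interval r M m A B"
  unfolding split_interval_def incomp_def by (simp only: conj_commute conj_left_commute)

lemma extension_dual: "extension n (\<lambda>x y. r y x) xs \<longleftrightarrow> extension n r (rev xs)"
  by (auto simp: extension_def)

section \<open>Strict orders and the axioms that carry the induction\<close>

locale strict_order =
  fixes n :: nat and r :: "nat \<Rightarrow> nat \<Rightarrow> bool"
  assumes carrier: "r x y \<Longrightarrow> x \<in> {1..n} \<and> y \<in> {1..n}"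
    and irrefl: "\<not> r x x"
    and trans: "r x y \<Longrightarrow> r y z \<Longrightarrow> r x z"
begin

lemma asym: "r x y \<Longrightarrow> \<not> r y x"
  using irrefl trans by blast

lemma cover_below_exists:
  assumes "r p z"
  obtains c where "covers r p c" "c = z \<or> r c z"
proof -
  let ?S = "{y. r p y \<and> (y = z \<or> r y z)}"
  have fin: "finite ?S"
    by (rule finite_subset[of _ "{1..n}"]) (use carrier in auto)
  have "\<exists>c\<in>?S. \<forall>y\<in>?S. y \<noteq> c \<longrightarrow> \<not> r y c"
  proof (rule Finite_Set.bex_min_element[OF fin])
    show "?S \<noteq> {}" using assms by blast
    show "asymp_on ?S r" by (rule asymp_onI) (rule asym)
    show "transp_on ?S r" by (rule transp_onI) (rule trans)
  qed
  then obtain c where c: "r p c" "c = z \<or> r c z"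
    and min: "\<And>y. r p y \<Longrightarrow> y = z \<or> r y z \<Longrightarrow> y \<noteq> c \<Longrightarrow> \<not> r y c"
    by blast
  have "covers r p c"
    unfolding covers_def using c min irrefl trans by metis
  then show thesis using that c by blast
qed

end

text \<open>The class of orders for the induction. On incomparable pairs \<open><\<close> behaves
  like left-of in a planar lattice, \<open>split\<close> keeps the conditions on intervals with
  disconnected interior, and \<open>no_chain\<close> merges the four chain conditions:
  \<open>min\<close> and \<open>max\<close> treat ascending and descending covers alike.\<close>

locale baxter_order = strict_order +
  assumes incomp_trans: "\<lbrakk>x \<in> {1..n}; y \<in> {1..n}; z \<in> {1..n}; incomp r x y; incomp r y z; x < y; y < z\<rbrakk> \<Longrightarrow> incomp r x z"
    and lub: "\<lbrakk>x \<in> {1..n}; y \<in> {1..n}; incomp r x y; x < y\<rbrakk> \<Longrightarrow>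
       \<exists>j. r x j \<and> r y j \<and> x < j \<and> j < y \<and> (\<forall>u. r x u \<and> r y u \<longrightarrow> u = j \<or> r j u)"
    and glb: "\<lbrakk>x \<in> {1..n}; y \<in> {1..n}; incomp r x y; x < y\<rbrakk> \<Longrightarrow>
       \<exists>j. r j x \<and> r j y \<and> x < j \<and> j < y \<and> (\<forall>u. r u x \<and> r u y \<longrightarrow> u = j \<or> r u j)"
    and split: "split_interval r m M A B \<Longrightarrow>
       (M = Suc m \<or> m = Suc M) \<and> (\<forall>a\<in>A. a < m \<and> a < M) \<and> (\<forall>b\<in>B. m < b \<and> M < b)"
    and no_chain: "\<lbrakk>covers r x y; min x y < b; b < c; c < max x y\<rbrakk> \<Longrightarrow>
       \<not> (r b x \<and> r y c) \<and> \<not> (r c x \<and> r y b)"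
    and upper_covers: "\<lbrakk>covers r x y1; covers r x y2; covers r x y3\<rbrakk> \<Longrightarrow> y1 = y2 \<or> y1 = y3 \<or> y2 = y3"
    and lower_covers: "\<lbrakk>covers r y1 x; covers r y2 x; covers r y3 x\<rbrakk> \<Longrightarrow> y1 = y2 \<or> y1 = y3 \<or> y2 = y3"
begin

lemma dual: "baxter_order n (\<lambda>x y. r y x)"
proof (unfold_locales, goal_cases)
  case (1 x y) then show ?case using carrier by blast
next
  case (2 x) then show ?case using irrefl by blast
next
  case (3 x y z) then show ?case using trans by blast
next
  case (4 x y z) then show ?case using incomp_trans[of x y z] by (simp only: incomp_dual[of r])
next
  case (5 x y) then show ?case using glb[of x y] by (simp only: incomp_dual[of r])
next
  case (6 x y) then show ?case using lub[of x y] by (simp only: incomp_dual[of r])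
next
  case (7 m M A B) then show ?case using split[of M m A B] by (auto simp only: split_dual[of r])
next
  case (8 x y b c) then show ?case
    using no_chain[of y x b c] by (simp only: covers_dual[of r] min.commute max.commute) blast
next
  case (9 x y1 y2 y3) then show ?case using lower_covers[of y1 x y2 y3] by (simp only: covers_dual[of r])
next
  case (10 y1 x y2 y3) then show ?case using upper_covers[of x y1 y2 y3] by (simp only: covers_dual[of r])
qed

text \<open>Turning the order upside down exchanges \<open>m\<close> and \<open>M\<close> and so
  flips every arrow, while left and right stay; reversing the word compensates for this.\<close>

lemma respecting_dual: "respecting (\<lambda>x y. r y x) xs \<longleftrightarrow> respecting r (rev xs)"
proof -
  have rb: "right_boundary (\<lambda>x y. r y x) A = right_boundary r A"
    "left_boundary (\<lambda>x y. r y x) A = left_boundary r A" for A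
    by (simp_all only: right_boundary_def left_boundary_def incomp_dual[of r])
  have ne: "(m < M) = (\<not> M < m)" if "split_interval r m M A B" for m M A B
    using split[OF that] by auto
  have "respecting (\<lambda>x y. r y x) xs \<longleftrightarrow> (\<forall>m M A B. split_interval r M m A B \<longrightarrow>
     (\<forall>l\<in>right_boundary r A. \<forall>q\<in>left_boundary r B. if m < M then before xs l q else before xs q l))"
    by (simp only: respecting_def rb split_dual[of r])
  also have "\<dots> \<longleftrightarrow> (\<forall>m M A B. split_interval r M m A B \<longrightarrow>
     (\<forall>l\<in>right_boundary r A. \<forall>q\<in>left_boundary r B. if M < m then before xs q l else before xs l q))"
    using ne by (auto split: if_splits)
  also have "\<dots> \<longleftrightarrow> respecting r (rev xs)"
    by (auto simp: respecting_def)
  finally show ?thesis .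
qed

text \<open>Stated for two single elements with numerical bounds, so that it applies to the abstract
  cells as well as to drawn regions. A pair placed against the arrow would force a second switch
  between small and large entries.\<close>

lemma baxter_word_split:
  assumes xs: "baxter_word xs" "extension n r xs" and "l \<noteq> q" "r m l" "r l M" "r m q" "r q M"
    and "M = Suc m \<or> m = Suc M" and l: "l < m" and q: "m < q"
  shows "if m < M then before xs l q else before xs q l"
proof -
  have d: "distinct xs" and b: "before xs m l" "before xs l M" "before xs m q" "before xs q M"
    and t: "before xs l q \<or> before xs q l"
    using assms before_total[of l xs q] carrier by (auto simp: extension_def)
  show ?thesis
  proof (cases "m < M")
    case True
    then have "M = Suc m" using assms by auto
    then show ?thesis
      using baxter_word_between_up[OF xs(1) d b(3) _ _ l] t b(2) q by auto
  next
    case False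
    then have m: "m = Suc M" using assms by auto
    have "\<not> before xs l q"
      using baxter_word_between_down[OF xs(1) d, of M l q] b q l before_irrefl[OF d]
      unfolding m by (metis Suc_leI less_antisym not_le)
    then show ?thesis
      using False t by auto
  qed
qed

lemma baxter_word_respecting:
  assumes "baxter_word xs" "extension n r xs"
  shows "respecting r xs"
  unfolding respecting_def
proof (intro allI impI ballI)
  fix m M A B l q
  assume s: "split_interval r m M A B" and l: "l \<in> right_boundary r A" and q: "q \<in> left_boundary r B"
  have "l \<in> A" "q \<in> B" using l q by (auto simp: right_boundary_def left_boundary_def)
  moreover from this have "r m l" "r l M" "r m q" "r q M"  "l \<noteq> q"
    using s by (auto simp: split_interval_def incomp_def)
  ultimately show "if m < M then before xs l q else before xs q l"
    using baxter_word_split[OF assms] split[OF s] by blast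
qed

lemma max_lt_n: "x \<in> {1..n} \<Longrightarrow> x \<noteq> n \<Longrightarrow> x < n"
  by auto

lemma incomp_gap: "x \<in> {1..n} \<Longrightarrow> y \<in> {1..n} \<Longrightarrow> incomp r x y \<Longrightarrow> x < y \<Longrightarrow> Suc x < y"
  using lub[of x y] by auto

text \<open>Two incomparable elements below \<open>n\<close> have a join that is numerically smaller
  than one of them, so the join is not \<open>n\<close> and lies strictly below it. A maximal
  element below \<open>n\<close> is therefore the greatest one.\<close>

lemma greatest_below:
  assumes "r x n"
  obtains p where "r p n" "\<And>y. r y n \<Longrightarrow> y = p \<or> r y p"
proof -
  have fin: "finite {y. r y n}"
    by (rule finite_subset[of _ "{1..n}"]) (use carrier in auto)
  have "\<exists>p\<in>{y. r y n}. \<forall>y\<in>{y. r y n}. y \<noteq> p \<longrightarrow> \<not> r p y"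
  proof (rule Finite_Set.bex_max_element[OF fin])
    show "{y. r y n} \<noteq> {}" using assms by blast
    show "asymp_on {y. r y n} r" by (rule asymp_onI) (rule asym)
    show "transp_on {y. r y n} r" by (rule transp_onI) (rule trans)
  qed
  then obtain p where p: "r p n" "\<And>y. r y n \<Longrightarrow> \<not> r p y"
    using irrefl by (metis mem_Collect_eq)
  have "y = p \<or> r y p" if "r y n" for y
  proof (rule ccontr)
    assume "\<not> ?thesis"
    then have i: "incomp r y p" using p that by (auto simp: incomp_def)
    have yp: "y \<in> {1..n}" "p \<in> {1..n}" "y \<noteq> p" "n \<in> {1..n}"
      using carrier[OF that] carrier[OF p(1)] i by (auto simp: incomp_def)
    have "\<exists>j. r y j \<and> r p j \<and> j < n \<and> (\<forall>u. r y u \<and> r p u \<longrightarrow> u = j \<or> r j u)"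
    proof (cases "y < p")
      case True
      obtain j where "r y j" "r p j" "j < p" "\<forall>u. r y u \<and> r p u \<longrightarrow> u = j \<or> r j u"
        using lub[OF yp(1,2) i True] by blast
      then show ?thesis using yp by (intro exI[of _ j]) auto
    next
      case False
      then have "p < y" using yp by auto
      obtain j where "r p j" "r y j" "j < y" "\<forall>u. r p u \<and> r y u \<longrightarrow> u = j \<or> r j u"
        using lub[OF yp(2,1) _ \<open>p < y\<close>] i incomp_sym[of r y p] by blast
      then show ?thesis using yp by (intro exI[of _ j]) auto
    qed
    then obtain j where j: "r y j" "r p j" "j < n" "\<forall>u. r y u \<and> r p u \<longrightarrow> u = j \<or> r j u"
      by blast
    then have "n = j \<or> r j n" using p(1) that by blast
    then show False using p(2)[of j] j by blast
  qed
  then show thesis using p(1) that by blast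
qed

end

section \<open>Deletion of the largest element\<close>

abbreviation below_top :: "nat \<Rightarrow> (nat \<Rightarrow> nat \<Rightarrow> bool) \<Rightarrow> nat \<Rightarrow> nat \<Rightarrow> bool" where
  "below_top n r \<equiv> \<lambda>x y. r x y \<and> x < n \<and> y < n"

lemma incomp_below: "x < n \<Longrightarrow> y < n \<Longrightarrow> incomp (below_top n r) x y \<longleftrightarrow> incomp r x y"
  by (auto simp: incomp_def)

context baxter_order
begin

lemma n_right: "x \<in> {1..n} \<Longrightarrow> incomp r x n \<Longrightarrow> x < n"
  by (auto simp: incomp_def)

text \<open>If \<open>n\<close> lies in the interval, it has to be incomparable to all of
  \<open>A\<close>. Let \<open>a\<close> in \<open>A\<close> be comparable to \<open>n\<close> and
  take any \<open>b\<close> in \<open>B\<close>. If \<open>b\<close> were incomparable to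
  \<open>n\<close>, then \<open>a\<close> would be so by transitivity. Otherwise both are below
  \<open>n\<close> or both above it, and the greatest element below (or the least above)
  \<open>n\<close> lies in the interval and is comparable to \<open>a\<close> and to
  \<open>b\<close>, although it belongs to \<open>A\<close> or to \<open>B\<close>.\<close>

lemma split_below:
  assumes s: "split_interval (below_top n r) m M A B"
  obtains "n \<notin> A \<union> B" "m < n" "M < n"
    "split_interval r m M A (if r m n \<and> r n M then insert n B else B)"
proof -
  have AB: "A \<union> B = {z. r m z \<and> m < n \<and> z < n \<and> r z M \<and> M < n}"
    and ne: "A \<noteq> {}" "B \<noteq> {}" and i: "\<And>a b. a \<in> A \<Longrightarrow> b \<in> B \<Longrightarrow> incomp (below_top n r) a b \<and> a < b"
    using s unfolding split_interval_def by auto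
  have mM: "m < n" "M < n" using AB ne by auto
  have lt: "a \<in> A \<Longrightarrow> a < n" "b \<in> B \<Longrightarrow> b < n" for a b using AB by auto
  have i': "incomp r a b \<and> a < b" if "a \<in> A" "b \<in> B" for a b
    using i[OF that] lt that incomp_below by blast
  have un: "A \<union> (if r m n \<and> r n M then insert n B else B) = {z. r m z \<and> r z M}"
  proof -
    have "z < n" if "r z M" "z \<noteq> n" for z
      using carrier[OF that(1)] that(2) by auto
    then show ?thesis using AB mM by auto
  qed
  have in': "incomp r a n \<and> a < n" if n: "r m n" "r n M" "a \<in> A" for a
  proof -
    obtain b where b: "b \<in> B" using ne by auto
    have ab: "incomp r a b" "a < b" "b < n" "a < n" using i' that(3) b lt by auto
    have abc: "a \<in> {1..n}" "b \<in> {1..n}" "n \<in> {1..n}"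
      using AB that b carrier by (metis (no_types, lifting) UnI1 UnI2 mem_Collect_eq)+
    show ?thesis
    proof (rule ccontr)
      assume "\<not> ?thesis"
      then have c: "r a n \<or> r n a" using ab by (auto simp: incomp_def)
      show False
      proof (cases "incomp r b n")
        case True
        then show False using incomp_trans[OF abc ab(1) True ab(2,3)] c by (auto simp: incomp_def)
      next
        case False
        then have d: "r b n \<or> r n b" using ab by (auto simp: incomp_def)
        have "\<not> (r a n \<and> r n b)" "\<not> (r b n \<and> r n a)"
          using ab trans by (auto simp: incomp_def)
        then consider "r a n" "r b n" | "r n a" "r n b" using c d by blast
        then show False
        proof cases
          case 1
          obtain p where p: "r p n" "\<And>y. r y n \<Longrightarrow> y = p \<or> r y p"
            using greatest_below[OF 1(1)] by blast
          have "r m p"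
            using p(2)[OF 1(1)] AB that(3) trans by blast
          then have pin: "p \<in> A \<union> B" unfolding AB
            using p(1) mM n(2) trans[OF p(1) n(2)] carrier[OF p(1)] irrefl[of n]
            by (metis (mono_tags, lifting) max_lt_n mem_Collect_eq)
          have "a = p \<or> r a p" "b = p \<or> r b p" using p 1 by auto
          moreover have "p \<in> A \<Longrightarrow> incomp r p b" "p \<in> B \<Longrightarrow> incomp r a p" using i' b that by auto
          ultimately show False using pin ab by (auto simp: incomp_def)
        next
          case 2
          interpret d: baxter_order n "\<lambda>x y. r y x" by (rule dual)
          obtain p where p: "r n p" "\<And>y. r n y \<Longrightarrow> y = p \<or> r p y"
            using d.greatest_below[OF 2(1)] by blast
          have "r p M"
            using p(2)[OF 2(1)] AB that(3) trans by blast
          then have pin: "p \<in> A \<union> B" unfolding AB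
            using p(1) mM n(1) trans[OF n(1) p(1)] carrier[OF p(1)] irrefl[of n]
            by (metis (mono_tags, lifting) max_lt_n mem_Collect_eq)
          have "a = p \<or> r p a" "b = p \<or> r p b" using p 2 by auto
          moreover have "p \<in> A \<Longrightarrow> incomp r p b" "p \<in> B \<Longrightarrow> incomp r a p" using i' b that by auto
          ultimately show False using pin ab by (auto simp: incomp_def)
        qed
      qed
    qed
  qed
  have "split_interval r m M A (if r m n \<and> r n M then insert n B else B)"
    unfolding split_interval_def using un ne i' in' by auto
  moreover have "n \<notin> A \<union> B" using AB by auto
  ultimately show thesis using that mM by blast
qed


lemma covers_below_top:
  assumes "covers (below_top n r) x y"
  shows "x < n" "y < n" "r x y" "covers r x y \<or> covers r x n \<and> covers r n y"
proof -
  have *: "r x y" "x < n" "y < n" "\<And>z. r x z \<Longrightarrow> r z y \<Longrightarrow> \<not> z < n"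
    using assms by (auto simp: covers_def)
  then show "x < n" "y < n" "r x y" by auto
  have eq: "z = n" if "r x z" "r z y" for z
    using *(4)[OF that] max_lt_n[of z] carrier[OF that(1)] by blast
  show "covers r x y \<or> covers r x n \<and> covers r n y"
  proof (cases "covers r x y")
    case False
    then have n: "r x n" "r n y" using eq *(1) unfolding covers_def by blast+
    have "covers r x n" "covers r n y"
      unfolding covers_def using n eq trans irrefl by metis+
    then show ?thesis by blast
  qed simp
qed

text \<open>This keeps the bound of two covers under deletion: a new cover takes the place of the
  cover \<open>n\<close>, and only one new cover can do so.\<close>

lemma lower_cover_top_unique:
  assumes "covers r y n" "covers r y' n"
  shows "y = y'"
proof -
  obtain p where "r p n" "\<And>y. r y n \<Longrightarrow> y = p \<or> r y p"
    using greatest_below assms(1) unfolding covers_def by blast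
  then show ?thesis using assms unfolding covers_def by metis
qed

lemma upper_cover_top_unique:
  assumes "covers r n y" "covers r n y'"
  shows "y = y'"
proof -
  interpret d: baxter_order n "\<lambda>x y. r y x" by (rule dual)
  show ?thesis
    using d.lower_cover_top_unique[of y y'] assms by (simp only: covers_dual[of r])
qed

lemma below: "baxter_order (n - 1) (below_top n r)"
proof (unfold_locales, goal_cases)
  case (1 x y) then show ?case using carrier[of x y] by auto
next
  case (2 x) then show ?case using irrefl by blast
next
  case (3 x y z) then show ?case using trans by blast
next
  case (4 x y z)
  then have "x < n" "y < n" "z < n" by auto
  then show ?case using 4 incomp_trans[of x y z] by (simp add: incomp_below)
next
  case (5 x y)
  then have xy: "x \<in> {1..n}" "y \<in> {1..n}" "incomp r x y" "x < n" "y < n"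
    using incomp_below[of x n y r] by auto
  obtain j where "r x j" "r y j" "x < j" "j < y" "\<forall>u. r x u \<and> r y u \<longrightarrow> u = j \<or> r j u"
    using lub[OF xy(1-3) 5(4)] by blast
  then show ?case using xy by (intro exI[of _ j]) auto
next
  case (6 x y)
  then have xy: "x \<in> {1..n}" "y \<in> {1..n}" "incomp r x y" "x < n" "y < n"
    using incomp_below[of x n y r] by auto
  obtain j where "r j x" "r j y" "x < j" "j < y" "\<forall>u. r u x \<and> r u y \<longrightarrow> u = j \<or> r u j"
    using glb[OF xy(1-3) 6(4)] by blast
  then show ?case using xy by (intro exI[of _ j]) auto
next
  case (7 m M A B)
  from split_below[OF this] show ?case
  proof cases
    case 1
    from split[OF 1(4)] show ?thesis by (auto split: if_splits)
  qed
next
  case (8 x y b c)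
  from covers_below_top[OF 8(1)] have xy: "x < n" "y < n" "r x y"
    and c: "covers r x y \<or> covers r x n \<and> covers r n y" by auto
  show ?case
  proof (cases "covers r x y")
    case True
    from no_chain[OF this 8(2-4)] show ?thesis by blast
  next
    case False
    then have n: "covers r x n" "covers r n y" "r x n" "r n y" using c by (auto simp: covers_def)
    show ?thesis
    \<comment> \<open>The new cover passes through \<open>n\<close>. A forbidden chain around it
      yields one around \<open>x\<close>, \<open>n\<close> or around \<open>n\<close>,
      \<open>y\<close>: the larger end of the cover is replaced by \<open>n\<close>, which only
      widens the range.\<close>
    proof (cases "x < y")
      case True
      then have "min x n < b" "c < max x n" using 8 xy by auto
      from no_chain[OF n(1) this(1) 8(3) this(2)] show ?thesis using n(4) trans by blast
    next
      case False
      then have "min n y < b" "c < max n y" using 8 xy by auto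
      from no_chain[OF n(2) this(1) 8(3) this(2)] show ?thesis using n(3) trans by blast
    qed
  qed
next
  case (9 x y1 y2 y3)
  note c = covers_below_top[OF 9(1)] covers_below_top[OF 9(2)] covers_below_top[OF 9(3)]
  then have "y1 \<noteq> n" "y2 \<noteq> n" "y3 \<noteq> n" by auto
  then show ?case
    using c(4,8,12) upper_covers[of x] upper_cover_top_unique by metis
next
  case (10 y1 x y2 y3)
  note c = covers_below_top[OF 10(1)] covers_below_top[OF 10(2)] covers_below_top[OF 10(3)]
  then have "y1 \<noteq> n" "y2 \<noteq> n" "y3 \<noteq> n" by auto
  then show ?case
    using c(4,8,12) lower_covers[of _ x] lower_cover_top_unique by metis
qed

lemma right_boundary_below: "\<forall>a\<in>A. a < n \<Longrightarrow> right_boundary (below_top n r) A = right_boundary r A"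
  by (auto simp: right_boundary_def incomp_below)

lemma left_boundary_below:
  "\<forall>a\<in>B. a < n \<Longrightarrow> left_boundary (below_top n r) B = left_boundary r B"
  "\<forall>a\<in>B. a < n \<Longrightarrow> left_boundary r B \<subseteq> left_boundary r (insert n B)"
  by (auto simp: left_boundary_def incomp_below)

text \<open>Every cell of the smaller order extends to a cell of the larger one. Adding
  \<open>n\<close> to \<open>B\<close> removes nothing from the left boundary, since
  \<open>n\<close> is to the left of no element.\<close>

lemma respecting_below:
  assumes "respecting r ys"
  shows "respecting (below_top n r) (removeAll n ys)"
  unfolding respecting_def
proof (intro allI impI ballI)
  fix m M A B l q
  assume s: "split_interval (below_top n r) m M A B"
    and l: "l \<in> right_boundary (below_top n r) A" and q: "q \<in> left_boundary (below_top n r) B"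
  have lt: "\<forall>a\<in>A. a < n" "\<forall>b\<in>B. b < n"
    using s unfolding split_interval_def by blast+
  have "l \<in> right_boundary r A" using l right_boundary_below[OF lt(1)] by simp
  moreover have "q \<in> left_boundary r (if r m n \<and> r n M then insert n B else B)"
    using q left_boundary_below[OF lt(2)] by auto
  moreover have "split_interval r m M A (if r m n \<and> r n M then insert n B else B)"
    using split_below[OF s] by blast
  ultimately have "if m < M then before ys l q else before ys q l"
    using respectingD[OF assms] by blast
  moreover have "l \<noteq> n" "q \<noteq> n"
    using l q lt by (auto simp: right_boundary_def left_boundary_def)
  ultimately show "if m < M then before (removeAll n ys) l q else before (removeAll n ys) q l"
    by (simp add: before_removeAll)
qed

lemma extension_below:
  assumes "extension n r ys"
  shows "extension (n - 1) (below_top n r) (removeAll n ys)"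
  using assms by (auto simp: extension_def before_removeAll distinct_removeAll)

lemma extension_not_before: "extension n r xs \<Longrightarrow> before xs x y \<Longrightarrow> \<not> r y x"
  using before_asym[of xs x y] by (auto simp: extension_def)

text \<open>Uniqueness is demanded among the arrow-respecting extensions. This is the stronger form,
  since every Baxter extension respects the arrows, and the insertion of \<open>n\<close> relies on
  it.\<close>

definition outcome :: "nat list \<Rightarrow> bool" where
  "outcome xs \<longleftrightarrow> extension n r xs \<and> baxter_word xs \<and> (\<forall>ys. extension n r ys \<and> respecting r ys \<longrightarrow> ys = xs)"

end

lemma before_suffix: "distinct (us @ p # vs) \<Longrightarrow> before (us @ p # vs) x y \<Longrightarrow> x \<in> insert p (set vs) \<Longrightarrow> y \<in> set vs"
  by (auto dest: before_set)

lemma before_prefix: "distinct (us @ p # vs) \<Longrightarrow> before (us @ p # vs) x y \<Longrightarrow> y \<in> insert p (set us) \<Longrightarrow> x \<in> set us"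
  by (auto dest: before_set)

lemma no_before_between:
  "distinct (us @ p # s # vs) \<Longrightarrow> before (us @ p # s # vs) p z \<Longrightarrow> \<not> before (us @ p # s # vs) z s"
  by (auto dest: before_set)

section \<open>Reinsertion of the largest element directly after its lower cover\<close>

locale baxter_step = baxter_order +
  fixes p us vs
  assumes prev: "r (n - 1) n"
    and p: "r p n" and p_greatest: "\<And>y. r y n \<Longrightarrow> y = p \<or> r y p"
    and IH: "baxter_order.outcome (n - 1) (below_top n r) (us @ p # vs)"
begin

sublocale b: baxter_order "n - 1" "below_top n r"
  by (rule below)

lemma smaller: "extension (n - 1) (below_top n r) (us @ p # vs)" "baxter_word (us @ p # vs)"
  "\<And>ys. extension (n - 1) (below_top n r) ys \<Longrightarrow> respecting (below_top n r) ys \<Longrightarrow> ys = us @ p # vs"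
  using IH unfolding b.outcome_def by blast+

lemma dist: "distinct (us @ p # vs)" and elts: "set (us @ p # vs) = {1..n - 1}"
  using smaller(1) by (auto simp: extension_def)

lemma n_in: "n \<in> {1..n}"
  using carrier[OF prev] by blast

lemma elt: "x \<in> set us \<union> set vs \<or> x = p \<Longrightarrow> x \<in> {1..n} \<and> x < n"
proof -
  assume "x \<in> set us \<union> set vs \<or> x = p"
  then have "x \<in> set (us @ p # vs)" by auto
  then have "x \<in> {1..n - 1}" unfolding elts .
  then show ?thesis using n_in by auto
qed

lemma before_old: "r x y \<Longrightarrow> x < n \<Longrightarrow> y < n \<Longrightarrow> before (us @ p # vs) x y"
  using smaller(1) by (auto simp: extension_def)

lemma covers_p: "covers r p n"
  unfolding covers_def using p p_greatest asym by blast

lemma above_p: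
  assumes "r p y" "y \<noteq> n"
  shows "y \<in> set vs"
proof -
  have "y < n" "p < n" using carrier[OF assms(1)] assms(2) elt[of p] by auto
  from before_suffix[OF dist before_old[OF assms(1) this(2,1)]] show ?thesis by simp
qed

lemma not_below_n: "s \<in> set vs \<Longrightarrow> \<not> r s n"
proof
  assume s: "s \<in> set vs" "r s n"
  then have "r s p" using p_greatest[of s] dist by auto
  have "s < n" "p < n" using elt[of s] elt[of p] s by auto
  from before_suffix[OF dist before_old[OF \<open>r s p\<close> this]] show False using s dist by simp
qed

lemma after_p: "v \<in> set vs \<Longrightarrow> v < p"
proof (rule ccontr)
  assume v: "v \<in> set vs" "\<not> v < p"
  define s where "s = Max (set vs)"
  have s: "s \<in> set vs" "v \<le> s" using v unfolding s_def by (auto intro: Max_in)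
  have "p \<noteq> s" using s dist by auto
  then have ps: "p < s" using v s by auto
  have sn: "s < n" "s \<in> {1..n}" using elt s by blast+
  consider "r n s" | "incomp r s n" using not_below_n[OF s(1)] sn by (auto simp: incomp_def)
  then show False
  proof cases
    case 1
    \<comment> \<open>With \<open>n\<close> below \<open>s\<close>, the elements
      \<open>n - 1\<close>, \<open>p\<close>, \<open>n\<close>, \<open>s\<close> form a 3-14-2
      chain, because \<open>p < s < n - 1 < n\<close>.\<close>
    have "s \<noteq> n - 1" using 1 prev trans irrefl by blast
    then have lt: "s < n - 1" using sn by auto
    then have "r (n - 1) p" using p_greatest[OF prev] ps by auto
    moreover have "min p n < s" "n - 1 < max p n" using ps sn by auto
    ultimately show False using no_chain[OF covers_p _ lt] 1 by blast
  next
    case 2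
    \<comment> \<open>The join of \<open>s\<close> and \<open>n\<close> lies above \<open>p\<close>,
      so it also comes after \<open>p\<close>; being larger than \<open>s\<close>, it contradicts
      the choice of \<open>s\<close> as the maximum.\<close>
    obtain j where j: "r s j" "r n j" "s < j" "j < n"
      using lub[OF sn(2) n_in 2 sn(1)] by blast
    have "j \<in> set vs" using above_p[of j] trans[OF p j(2)] j by blast
    then show False using j s unfolding s_def by (meson List.finite_set Max_ge not_le)
  qed
qed

lemma extension_new: "extension n r (us @ p # n # vs)"
  unfolding extension_def
proof (intro conjI allI impI)
  have "n \<notin> set us" "n \<notin> set vs" "n \<noteq> p" using elt by blast+
  then show "distinct (us @ p # n # vs)" using dist by auto
  have "set (us @ p # n # vs) = insert n {1..n - 1}" using elts by auto
  also have "\<dots> = {1..n}" using n_in by auto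
  finally show "set (us @ p # n # vs) = {1..n}" .
  fix x y assume xy: "r x y"
  consider "x = n" | "y = n" | "x < n" "y < n"
    using carrier[OF xy] max_lt_n by blast
  then show "before (us @ p # n # vs) x y"
  proof cases
    case 1
    then have "y \<noteq> n" "r p y" using trans[OF p, of y] xy irrefl by blast+
    then have "y \<in> set vs" using above_p by blast
    then show ?thesis using 1 by simp
  next
    case 2
    then have "x = p \<or> r x p" using p_greatest xy by auto
    moreover have "x \<in> set us" if "r x p"
    proof -
      have "x \<noteq> n" using xy 2 irrefl by blast
      then have "x < n" "p < n" using carrier[OF xy] elt[of p] by auto
      from before_prefix[OF dist before_old[OF that this]] show ?thesis by simp
    qed
    ultimately show ?thesis using 2 by auto
  next
    case 3
    then show ?thesis using before_old[OF xy 3] by auto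
  qed
qed

text \<open>In a new pattern \<open>n\<close> can only be the largest entry, so it belongs to the
  adjacent pair. The pair \<open>p\<close>, \<open>n\<close> would need a later entry above
  \<open>p\<close>, and the pair \<open>n\<close>, \<open>y\<close> leads back to an old
  pattern.\<close>

lemma baxter_word_new: "baxter_word (us @ p # n # vs)"
  unfolding baxter_word_def
proof (intro allI impI ballI)
  fix us2 x y vs2 b c
  assume eq: "us @ p # n # vs = us2 @ x # y # vs2" and b: "b \<in> set us2" and c: "c \<in> set vs2"
  have d: "distinct (us @ p # n # vs)" using extension_new by (simp add: extension_def)
  consider "x = n" | "y = n" | "x \<noteq> n" "y \<noteq> n" by blast
  then show "\<not> (y < b \<and> b < c \<and> c < x) \<and> \<not> (x < c \<and> c < b \<and> b < y)"
  proof cases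
    case 1
    have "(us @ [p]) @ n # vs = us2 @ n # (y # vs2)" using eq 1 by simp
    then have e: "us2 = us @ [p]" "vs = y # vs2"
      using d append_Cons_eq_iff[of n "us @ [p]" vs us2 "y # vs2"] by (auto simp del: append_assoc)
    have "c < p" "c < n" using after_p elt c e by auto
    moreover have "b \<in> set us \<or> b = p" using b e by auto
    \<comment> \<open>Since \<open>c < p\<close>, a pattern with \<open>n\<close> as 4 would already
      be one with \<open>p\<close> as 4, and \<open>p\<close>, \<open>y\<close> are adjacent in the
      smaller word.\<close>
    moreover have "\<not> (y < b \<and> b < c \<and> c < p)" if "b \<in> set us"
      using smaller(2) e that c unfolding baxter_word_def by blast
    ultimately show ?thesis using 1 by auto
  next
    case 2
    have "(us @ [p]) @ n # vs = (us2 @ [x]) @ n # vs2" using eq 2 by simp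
    then have e: "us2 = us" "x = p" "vs = vs2"
      using d append_Cons_eq_iff[of n "us @ [p]" vs "us2 @ [x]" vs2] by (auto simp del: append_assoc)
    have "c < p" "b < n" using after_p elt c b e by auto
    then show ?thesis using e 2 by auto
  next
    case 3
    have "removeAll n (us @ p # n # vs) = us @ p # vs" using d elt[of p] by auto
    then have e: "us @ p # vs = removeAll n us2 @ x # y # removeAll n vs2"
      unfolding eq using 3 by simp
    have "x \<le> n" "y \<le> n" using extension_new unfolding eq extension_def by auto
    moreover have "\<not> (y < b \<and> b < c \<and> c < x) \<and> \<not> (x < c \<and> c < b \<and> b < y)" if "b \<noteq> n" "c \<noteq> n"
    proof -
      have "b \<in> set (removeAll n us2)" "c \<in> set (removeAll n vs2)" using b c that by auto
      then show ?thesis using smaller(2) e unfolding baxter_word_def by blast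
    qed
    moreover have "b = n \<or> c = n \<Longrightarrow> n \<le> b \<or> n \<le> c" by blast
    ultimately show ?thesis by (metis less_trans not_le)
  qed
qed

lemma next_not_above:
  assumes ys: "extension n r ys" "respecting r ys" and s: "vs = s # ws" "before ys s n"
  shows "\<not> r p s"
proof
  assume ps: "r p s"
  have sn: "s \<in> {1..n}" "s < n" using elt s by auto
  have i: "incomp r s n"
    using not_below_n[of s] s extension_not_before[OF ys(1) s(2)] sn by (auto simp: incomp_def)
  have d: "distinct (us @ p # s # ws)" using dist s by simp
  have covers: "covers r p s"
    unfolding covers_def
  proof (intro conjI ps notI)
    \<comment> \<open>An element between \<open>p\<close> and \<open>s\<close> would have to stand
      between two adjacent entries of the smaller word.\<close>
    assume "\<exists>z. r p z \<and> r z s"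
    then obtain z where z: "r p z" "r z s" by blast
    then have "z \<noteq> n" using i by (auto simp: incomp_def)
    then have "z < n" "p < n" using carrier[OF z(1)] max_lt_n elt[of p] by auto
    then show False using no_before_between[OF d] before_old z sn s by metis
  qed
  obtain J where J: "r s J" "r n J" "s < J" "J < n" "\<And>u. r s u \<Longrightarrow> r n u \<Longrightarrow> u = J \<or> r J u"
    using lub[OF sn(1) n_in i sn(2)] by blast
  \<comment> \<open>The two upper covers of \<open>p\<close> are \<open>s\<close> and
    \<open>n\<close>; \<open>A\<close> and \<open>B\<close> collect what lies above each of them and
    below the join \<open>J\<close>.\<close>
  define A where "A = {z. r p z \<and> r z J \<and> (z = s \<or> r s z)}"
  define B where "B = {z. r p z \<and> r z J \<and> (z = n \<or> r n z)}"
  have "split_interval r p J A B"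
    unfolding split_interval_def
  proof (intro conjI ballI)
    show "{z. r p z \<and> r z J} = A \<union> B"
    proof (intro equalityI subsetI)
      fix z assume z: "z \<in> {z. r p z \<and> r z J}"
      then obtain c where c: "covers r p c" "c = z \<or> r c z"
        using cover_below_exists[of p z] by blast
      then have "c = s \<or> c = n" using upper_covers[OF covers covers_p c(1)] sn by blast
      then show "z \<in> A \<union> B" using c z unfolding A_def B_def by blast
    qed (auto simp: A_def B_def)
    show "A \<noteq> {}" "B \<noteq> {}" unfolding A_def B_def using J p ps by blast+
    fix a b assume ab: "a \<in> A" "b \<in> B"
    have a: "r p a" "r a J" "a = s \<or> r s a" and b: "r p b" "r b J" "b = n \<or> r n b"
      using ab by (auto simp: A_def B_def)
    have na: "\<not> (a = n \<or> r n a)" and nb: "\<not> (b = s \<or> r s b)"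
      using a b J(5) asym i irrefl unfolding incomp_def by metis+
    show iab: "incomp r a b"
      unfolding incomp_def using a b na nb trans by metis
    have "incomp r a n" using na a(3) i trans unfolding incomp_def by metis
    moreover have abn: "a \<in> {1..n}" "b \<in> {1..n}" using carrier a b by blast+
    ultimately have "a < n" using n_right by blast
    \<comment> \<open>\<open>a\<close> is left of \<open>n\<close>. If \<open>b\<close> were left of
      \<open>a\<close>, transitivity would make it incomparable to \<open>n\<close>, but
      \<open>b\<close> is \<open>n\<close> or above it.\<close>
    show "a < b"
    proof (rule ccontr)
      assume "\<not> a < b"
      then have "b < a" using iab by (auto simp: incomp_def)
      then have "incomp r b n"
        using incomp_trans[OF abn(2,1) n_in] iab incomp_sym[of r a b] \<open>incomp r a n\<close> \<open>a < n\<close> by blast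
      then show False using b by (auto simp: incomp_def)
    qed
  qed
  moreover have "s \<in> right_boundary r A" "n \<in> left_boundary r B"
    using J p ps unfolding right_boundary_def left_boundary_def A_def B_def incomp_def by auto
  \<comment> \<open>\<open>J\<close> is above \<open>p\<close>, so it comes after \<open>p\<close>
    and is smaller than \<open>p\<close>. The arrow points left and demands \<open>n\<close> before
    \<open>s\<close>.\<close>
  moreover have "\<not> p < J"
    using after_p[of J] above_p[OF trans[OF p J(2)]] J by auto
  ultimately have "before ys n s" using respectingD[OF ys(2)] by meson
  then show False using s(2) ys(1) before_asym unfolding extension_def by metis
qed

lemma next_not_incomparable:
  assumes ys: "extension n r ys" "respecting r ys" and s: "vs = s # ws" "before ys s n"
  shows "\<not> incomp r p s"
proof
  assume ips: "incomp r p s"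
  let ?r = "below_top n r" and ?xs = "us @ p # s # ws" and ?zs = "us @ s # p # ws"
  have sn: "s \<in> {1..n}" "s < n" and pn: "p \<in> {1..n}" "p < n" using elt s by auto
  have sp: "s < p" using after_p s by auto
  have d: "distinct ?xs" using dist s by simp
  have bz: "before ?zs x y" if "before ?xs x y" "\<not> (x = p \<and> y = s)" for x y
    using that d by auto
  have "extension (n - 1) ?r ?zs"
    unfolding extension_def
  proof (intro conjI allI impI)
    show "distinct ?zs" using d by auto
    show "set ?zs = {1..n - 1}" using elts s by auto
    fix x y assume "?r x y"
    then show "before ?zs x y" using bz[of x y] before_old[of x y] ips s by (auto simp: incomp_def)
  qed
  \<comment> \<open>The exchanged word is an extension different from the only respecting one, so
    some cell objects to the exchange.\<close>
  then have "\<not> respecting ?r ?zs"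
    using smaller(3)[of ?zs] s sp by auto
  then obtain m M A B l q where sp1: "split_interval ?r m M A B"
    and l: "l \<in> right_boundary ?r A" and q: "q \<in> left_boundary ?r B"
    and bad: "\<not> (if m < M then before ?zs l q else before ?zs q l)"
    unfolding respecting_def Ball_def not_all not_imp by (elim exE conjE)
  have respecting': "respecting ?r ?xs" using b.baxter_word_respecting[OF smaller(2,1)] s by simp
  note good = respectingD[OF respecting' sp1 l q]
  \<comment> \<open>The two words differ only in the order of \<open>p\<close> and \<open>s\<close>,
    so these form the offending pair. As \<open>s < p\<close> and \<open>l < q\<close>, the second
    alternative holds and the arrow points left.\<close>
  have "m < M \<and> l = p \<and> q = s \<or> \<not> m < M \<and> l = s \<and> q = p"
  proof (cases "m < M")
    case True
    with good bad have "before ?xs l q" "\<not> before ?zs l q"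
      by (simp_all only: if_True not_False_eq_True)
    with True bz[of l q] show ?thesis by blast
  next
    case False
    with good bad have "before ?xs q l" "\<not> before ?zs q l"
      by (simp_all only: if_False not_False_eq_True)
    with False bz[of q l] show ?thesis by blast
  qed
  moreover have "l < q"
    using l q sp1 unfolding right_boundary_def left_boundary_def split_interval_def by blast
  ultimately have arrow: "\<not> m < M" and lq: "l = s" "q = p" using sp by auto
  have lt: "\<forall>a\<in>A. a < n" "\<forall>b\<in>B. b < n"
    using sp1 unfolding split_interval_def by blast+
  have B1: "x \<in> {1..n}" if "x \<in> B" for x
    using that sp1 carrier unfolding split_interval_def by blast
  have pB: "p \<in> B" and pmin: "\<And>u. u \<in> B \<Longrightarrow> incomp r p u \<Longrightarrow> \<not> u < p"
    using q lq left_boundary_below(1)[OF lt(2)] by (auto simp: left_boundary_def)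
  have after: "\<not> before ?xs z s" if "r p z" "z < n" for z
    using no_before_between[OF d] before_old[OF that(1) pn(2) that(2)] s by blast
  \<comment> \<open>The numerically smallest element of \<open>B\<close> above \<open>p\<close>
    would be on the left boundary and thus precede \<open>s\<close> by the arrow. But it must come
    after \<open>p\<close>, whose direct successor is \<open>s\<close>.\<close>
  have Z: False if "u \<in> B" "r p u" for u
  proof -
    define z where "z = Min {u \<in> B. r p u}"
    have fin: "finite {u \<in> B. r p u}" by (rule finite_subset[of _ "{1..n}"]) (use B1 in blast, simp)
    have z: "z \<in> B" "r p z" and zmin: "\<And>w. w \<in> B \<Longrightarrow> r p w \<Longrightarrow> z \<le> w"
      using Min_in[OF fin] Min_le[OF fin] that unfolding z_def by blast+
    have "\<not> (incomp r z w \<and> w < z)" if w: "w \<in> B" for w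
    proof
      assume i: "incomp r z w \<and> w < z"
      have "\<not> r p w" using zmin[OF w] i by auto
      moreover have "w \<noteq> p" "\<not> r w p" using i z trans unfolding incomp_def by blast+
      ultimately have ipw: "incomp r p w" by (auto simp: incomp_def)
      then have "p < w" using pmin[OF w] by (auto simp: incomp_def)
      then have "incomp r p z"
        using incomp_trans[OF B1[OF pB] B1[OF w] B1[OF z(1)] ipw] i incomp_sym[of r z w] by blast
      then show False using z by (auto simp: incomp_def)
    qed
    then have "z \<in> left_boundary ?r B"
      using z left_boundary_below(1)[OF lt(2)] by (auto simp: left_boundary_def)
    then have "before ?xs z s"
      using respectingD[OF respecting' sp1 l] lq arrow by simp
    then show False using after[OF z(2)] z lt by blast
  qed
  \<comment> \<open>Otherwise \<open>p\<close>, \<open>u\<close>, \<open>n\<close> would follow one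
    another from left to right, making \<open>p\<close> incomparable to \<open>n\<close>.\<close>
  have nB: "\<not> (incomp r n u \<and> u < n)" if u: "u \<in> B" for u
  proof
    assume i: "incomp r n u \<and> u < n"
    have "u \<noteq> p" "\<not> r u p" using i p trans unfolding incomp_def by blast+
    then have ipu: "incomp r p u" using Z[OF u] by (auto simp: incomp_def)
    then have "p < u" using pmin[OF u] by (auto simp: incomp_def)
    then have "incomp r p n"
      using incomp_trans[OF B1[OF pB] B1[OF u] n_in ipu] i incomp_sym[of r n u] by blast
    then show False using p by (auto simp: incomp_def)
  qed
  have mp: "r m p" "r p M" using pB sp1 unfolding split_interval_def by blast+
  from split_below[OF sp1] have sp2: "split_interval r m M A (if r m n \<and> r n M then insert n B else B)"
    and Mn: "M < n" by blast+
  have "p \<in> (if r m n \<and> r n M then insert n B else B)" using pB by simp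
  then have M: "m = Suc M" "m < p" using split[OF sp2] arrow by force+
  show False
  proof (cases "r n M")
    case True
    \<comment> \<open>Here \<open>n\<close> itself is on the right side of the cell, so the arrow in
      the full order puts \<open>n\<close> before \<open>s\<close>.\<close>
    then have "split_interval r m M A (insert n B)" using sp2 trans[OF mp(1) p] by simp
    moreover have "n \<in> left_boundary r (insert n B)"
      using nB by (auto simp: left_boundary_def)
    moreover have "s \<in> right_boundary r A" using l lq right_boundary_below[OF lt(1)] by simp
    ultimately have "before ys n s" using respectingD[OF ys(2)] arrow by meson
    then show False using s(2) ys(1) before_asym unfolding extension_def by metis
  next
    case False
    then have i: "incomp r M n"
      using Mn p_greatest[of M] mp asym irrefl unfolding incomp_def by blast
    have covers: "covers r p M"
      unfolding covers_def
    proof (intro conjI mp notI)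
      assume "\<exists>z. r p z \<and> r z M"
      then obtain z where z: "r p z" "r z M" by blast
      have "z \<in> A \<union> (if r m n \<and> r n M then insert n B else B)"
        using z trans[OF mp(1)] sp2 unfolding split_interval_def by blast
      then have "z \<in> A \<union> B" using False by simp
      moreover have "incomp r z p" if "z \<in> A" using that pB sp2 unfolding split_interval_def by auto
      ultimately show False using Z z by (auto simp: incomp_def)
    qed
    \<comment> \<open>\<open>m\<close>, \<open>p\<close>, \<open>M\<close>, \<open>J\<close> is a
      2-41-3 chain: \<open>M < m < J < p\<close>, since \<open>m = Suc M\<close>, \<open>J\<close>
      differs from \<open>m\<close>, and \<open>J\<close> comes after \<open>p\<close>.\<close>
    obtain J where J: "r M J" "r n J" "M < J" "J < n"
      using lub[OF _ n_in i Mn] carrier[OF mp(2)] by blast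
    have "J < p" using after_p[of J] above_p[OF trans[OF p J(2)]] J by auto
    moreover have "J \<noteq> m" using trans[OF mp(1) trans[OF p J(2)]] irrefl by blast
    ultimately show False
      using no_chain[OF covers, of m J] M J mp by auto
  qed
qed

lemma outcome_new: "outcome (us @ p # n # vs)"
  unfolding outcome_def
proof (intro conjI allI impI extension_new baxter_word_new)
  fix ys assume ys: "extension n r ys \<and> respecting r ys"
  have "removeAll n ys = us @ p # vs"
    using smaller(3) extension_below respecting_below ys by blast
  moreover have "n \<in> set ys" and dy: "distinct ys" using ys n_in by (auto simp: extension_def)
  then obtain \<alpha> \<beta> where ab: "ys = \<alpha> @ n # \<beta>" by (meson split_list)
  ultimately have eq: "\<alpha> @ \<beta> = us @ p # vs" using dy by simp
  have "before ys p n" using ys p by (auto simp: extension_def)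
  then have "p \<in> set \<alpha>" using dy before_prefix[of \<alpha> n \<beta> p n] ab by auto
  then obtain \<gamma> \<delta> where \<alpha>: "\<alpha> = \<gamma> @ p # \<delta>" by (meson split_list)
  have "us = \<gamma>" "vs = \<delta> @ \<beta>"
    using eq dist append_Cons_eq_iff[of p us vs \<gamma> "\<delta> @ \<beta>"] unfolding \<alpha> by auto
  \<comment> \<open>\<open>\<delta>\<close> is the stretch between \<open>p\<close> and
    \<open>n\<close> in \<open>ys\<close>; its first entry would be the successor of
    \<open>p\<close> in the smaller word.\<close>
  moreover have "\<delta> = []"
  proof (cases \<delta>)
    case (Cons s \<delta>')
    then have s: "vs = s # (\<delta>' @ \<beta>)" "before ys s n" "before ys p s" 
      using calculation ab \<alpha> by auto
    have "p \<noteq> s" using dist s by auto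
    then have "incomp r p s"
      using next_not_above[OF _ _ s(1,2)] extension_not_before[OF _ s(3)] ys by (auto simp: incomp_def)
    then show ?thesis using next_not_incomparable[OF _ _ s(1,2)] ys by blast
  qed simp
  ultimately show "ys = us @ p # n # vs" using ab \<alpha> by simp
qed

end

section \<open>Duality and the induction on the size\<close>

lemma (in baxter_order) outcome_dual:
  assumes "baxter_order.outcome n (\<lambda>x y. r y x) xs"
  shows "outcome (rev xs)"
proof -
  interpret d: baxter_order n "\<lambda>x y. r y x" by (rule dual)
  have *: "extension n r (rev xs)" "baxter_word (rev xs)"
    "\<And>ys. extension n r (rev ys) \<Longrightarrow> respecting r (rev ys) \<Longrightarrow> ys = xs"
    using assms baxter_word_rev unfolding d.outcome_def extension_dual[of n r] respecting_dual by blast+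
  show ?thesis
    unfolding outcome_def
  proof (intro conjI allI impI *)
    fix ys assume "extension n r ys \<and> respecting r ys"
    then have "rev ys = xs" using *(3)[of "rev ys"] by simp
    then show "ys = rev xs" by auto
  qed
qed

lemma (in baxter_order) outcome_step:
  assumes "r (n - 1) n" and IH: "baxter_order.outcome (n - 1) (below_top n r) xs"
  shows "\<exists>ys. outcome ys"
proof -
  interpret b: baxter_order "n - 1" "below_top n r" by (rule below)
  obtain p where p: "r p n" "\<And>y. r y n \<Longrightarrow> y = p \<or> r y p"
    using greatest_below[OF assms(1)] by blast
  have "p \<noteq> n" using p irrefl by blast
  then have "p \<in> set xs" using IH carrier[OF p(1)] unfolding b.outcome_def extension_def by auto
  then obtain us vs where xs: "xs = us @ p # vs" by (meson split_list)
  interpret baxter_step n r p us vs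
    by unfold_locales (use assms p xs in auto)
  show ?thesis using outcome_new by blast
qed

theorem baxter_order_outcome: "baxter_order n r \<Longrightarrow> \<exists>xs. baxter_order.outcome n r xs"
proof (induction n arbitrary: r)
  case 0
  then interpret baxter_order 0 r .
  have "\<not> r x y" for x y using carrier[of x y] by auto
  then have "outcome []" by (simp add: outcome_def extension_def baxter_word_def)
  then show ?case by blast
next
  case (Suc n)
  then interpret baxter_order "Suc n" r by blast
  interpret d: baxter_order "Suc n" "\<lambda>x y. r y x" by (rule dual)
  \<comment> \<open>In the one-element case the largest number has no predecessor in the carrier.
    Otherwise the two largest numbers are consecutive and hence comparable, as a join would have to
    fit strictly between them.\<close>
  consider "n = 0" | "r n (Suc n)" | "r (Suc n) n"
    using incomp_gap[of n "Suc n"] by (cases "n = 0") (auto simp: incomp_def)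
  then show ?case
  proof cases
    case 1
    have nr: "\<not> r x y" for x y using carrier[of x y] irrefl[of x] 1 by auto
    have "outcome [Suc 0]"
      unfolding outcome_def
    proof (intro conjI allI impI)
      show "extension (Suc n) r [Suc 0]" using nr 1 by (auto simp: extension_def)
      show "baxter_word [Suc 0]" unfolding baxter_word_def by (auto simp: Cons_eq_append_conv)
      fix ys assume "extension (Suc n) r ys \<and> respecting r ys"
      then have "distinct ys" "set ys = {Suc 0}" using 1 by (auto simp: extension_def)
      then have "length ys = 1" using distinct_card[of ys] by simp
      then show "ys = [Suc 0]" using \<open>set ys = {Suc 0}\<close> by (cases ys) auto
    qed
    then show ?thesis by blast
  next
    case 2
    have "\<exists>xs. baxter_order.outcome n (below_top (Suc n) r) xs" using Suc.IH below by simp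
    then show ?thesis using outcome_step 2 by auto
  next
    case 3
    have "\<exists>xs. baxter_order.outcome n (below_top (Suc n) (\<lambda>x y. r y x)) xs"
      using Suc.IH d.below by simp
    then show ?thesis using d.outcome_step 3 outcome_dual by fastforce
  qed
qed

section \<open>Planar orders\<close>

text \<open>The interface to the geometry: \<open>lies_left\<close> is a transitive orientation of
  incomparability, joins and meets merely exist, and numerical information enters only through
  \<open>split_lies_left\<close>. The aim is to recover \<open>lies_left\<close> as the numerical
  order.\<close>

locale planar_order = strict_order +
  fixes lies_left :: "nat \<Rightarrow> nat \<Rightarrow> bool"
  assumes lies_left_incomp: "lies_left x y \<Longrightarrow> x \<in> {1..n} \<and> y \<in> {1..n} \<and> incomp r x y"
    and lies_left_total: "\<lbrakk>x \<in> {1..n}; y \<in> {1..n}; incomp r x y\<rbrakk> \<Longrightarrow> lies_left x y \<or> lies_left y x"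
    and lies_left_trans: "lies_left x y \<Longrightarrow> lies_left y z \<Longrightarrow> lies_left x z"
    and ex_lub: "\<lbrakk>x \<in> {1..n}; y \<in> {1..n}; incomp r x y\<rbrakk> \<Longrightarrow>
       \<exists>j. r x j \<and> r y j \<and> (\<forall>u. r x u \<and> r y u \<longrightarrow> u = j \<or> r j u)"
    and ex_glb: "\<lbrakk>x \<in> {1..n}; y \<in> {1..n}; incomp r x y\<rbrakk> \<Longrightarrow>
       \<exists>j. r j x \<and> r j y \<and> (\<forall>u. r u x \<and> r u y \<longrightarrow> u = j \<or> r u j)"
    and two_upper: "\<lbrakk>covers r x y1; covers r x y2; covers r x y3\<rbrakk> \<Longrightarrow> y1 = y2 \<or> y1 = y3 \<or> y2 = y3"
    and two_lower: "\<lbrakk>covers r y1 x; covers r y2 x; covers r y3 x\<rbrakk> \<Longrightarrow> y1 = y2 \<or> y1 = y3 \<or> y2 = y3"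
    and split_lies_left: "\<lbrakk>{z. r m z \<and> r z M} = A \<union> B; A \<noteq> {}; B \<noteq> {}; \<And>a b. a \<in> A \<Longrightarrow> b \<in> B \<Longrightarrow> lies_left a b\<rbrakk> \<Longrightarrow>
       (M = Suc m \<or> m = Suc M) \<and> (\<forall>a\<in>A. a < m \<and> a < M) \<and> (\<forall>b\<in>B. m < b \<and> M < b)"
begin

lemma dual: "planar_order n (\<lambda>x y. r y x) lies_left"
proof (unfold_locales, goal_cases)
  case (1 x y) then show ?case using carrier by blast
next
  case (2 x) then show ?case using irrefl by blast
next
  case (3 x y z) then show ?case using trans by blast
next
  case (4 x y) then show ?case using lies_left_incomp[of x y] by (simp only: incomp_dual[of r])
next
  case (5 x y) then show ?case using lies_left_total[of x y] by (simp only: incomp_dual[of r])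
next
  case (6 x y z) then show ?case using lies_left_trans by blast
next
  case (7 x y) then show ?case using ex_glb[of x y] by (simp only: incomp_dual[of r])
next
  case (8 x y) then show ?case using ex_lub[of x y] by (simp only: incomp_dual[of r])
next
  case (9 x y1 y2 y3) then show ?case using two_lower[of y1 x y2 y3] by (simp only: covers_dual[of r])
next
  case (10 y1 x y2 y3) then show ?case using two_upper[of x y1 y2 y3] by (simp only: covers_dual[of r])
next
  case (11 m M A B)
  then have "{z. r M z \<and> r z m} = A \<union> B" by blast
  from split_lies_left[OF this 11(2-4)] show ?case by blast
qed

text \<open>If \<open>a'\<close> were on the other side of \<open>b\<close>, then \<open>a\<close>
  would be left of \<open>a'\<close> by transitivity, although the two are comparable.\<close>

lemma lies_left_comparable_left:
  assumes "lies_left a b" "incomp r a' b" "a' = a \<or> r a a' \<or> r a' a"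
  shows "lies_left a' b"
proof -
  have "a' \<in> {1..n}" "b \<in> {1..n}" using assms lies_left_incomp[OF assms(1)] carrier by blast+
  then have "lies_left a' b \<or> lies_left b a'" using lies_left_total assms(2) by blast
  moreover have "\<not> lies_left b a'"
  proof
    assume "lies_left b a'"
    from lies_left_incomp[OF lies_left_trans[OF assms(1) this]] show False
      using assms(3) by (auto simp: incomp_def)
  qed
  ultimately show ?thesis by blast
qed

lemma lies_left_comparable_right:
  assumes "lies_left a b" "incomp r a b'" "b' = b \<or> r b b' \<or> r b' b"
  shows "lies_left a b'"
proof -
  have "a \<in> {1..n}" "b' \<in> {1..n}" using assms lies_left_incomp[OF assms(1)] carrier by blast+
  then have "lies_left a b' \<or> lies_left b' a" using lies_left_total assms(2) by blast
  moreover have "\<not> lies_left b' a"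
  proof
    assume "lies_left b' a"
    from lies_left_incomp[OF lies_left_trans[OF this assms(1)]] show False
      using assms(3) by (auto simp: incomp_def)
  qed
  ultimately show ?thesis by blast
qed

text \<open>Induction from the top: above the meet \<open>g\<close> of \<open>x\<close> and \<open>y\<close> there is a cell with minimum \<open>g\<close> and
  some maximum \<open>M\<close>. Either \<open>x\<close> is on its left side, or \<open>x\<close> is left of \<open>M\<close> and meets \<open>M\<close> above \<open>g\<close>.\<close>

lemma between_glb:
  assumes "lies_left x y" "r g x" "r g y" "\<And>u. r u x \<Longrightarrow> r u y \<Longrightarrow> u = g \<or> r u g"
  shows "x < g \<and> g < y"
  using assms
proof (induction "card {z. r g z}" arbitrary: g x y rule: less_induct)
  case less
  note lies_left = less.prems(1) and gx = less.prems(2) and gy = less.prems(3) and g = less.prems(4)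
  have xy: "x \<in> {1..n}" "y \<in> {1..n}" "incomp r x y" using lies_left_incomp[OF lies_left] by auto
  obtain x1 where x1: "covers r g x1" "x1 = x \<or> r x1 x" using cover_below_exists[OF gx] by blast
  obtain y1 where y1: "covers r g y1" "y1 = y \<or> r y1 y" using cover_below_exists[OF gy] by blast
  have gx1: "r g x1" and gy1: "r g y1" using x1 y1 by (auto simp: covers_def)
  \<comment> \<open>Otherwise \<open>x1\<close> would be a common lower bound of \<open>x\<close>
    and \<open>y\<close> strictly above their meet \<open>g\<close>.\<close>
  have x1y: "\<not> (x1 = y \<or> r x1 y)"
    using x1(2) xy(3) g[of x1] gx1 asym irrefl unfolding incomp_def by metis
  have y1x: "\<not> (y1 = x \<or> r y1 x)"
    using y1(2) xy(3) g[of y1] gy1 asym irrefl unfolding incomp_def by metis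
  have i1: "incomp r x1 y1"
    using x1 y1 x1y y1x trans gx1 gy1 unfolding covers_def incomp_def by metis
  have in1: "x1 \<in> {1..n}" "y1 \<in> {1..n}" using carrier gx1 gy1 by blast+
  have "incomp r x1 y" using x1y x1(2) xy(3) trans unfolding incomp_def by metis
  then have "lies_left x1 y" using lies_left_comparable_left[OF lies_left] x1(2) by blast
  then have lf1: "lies_left x1 y1" using lies_left_comparable_right[OF _ i1] y1(2) by blast
  obtain M where M: "r x1 M" "r y1 M" "\<And>u. r x1 u \<Longrightarrow> r y1 u \<Longrightarrow> u = M \<or> r M u"
    using ex_lub[OF in1 i1] by blast
  define A where "A = {z. (z = x1 \<or> r x1 z) \<and> r z M}"
  define B where "B = {z. (z = y1 \<or> r y1 z) \<and> r z M}"
  have AB: "{z. r g z \<and> r z M} = A \<union> B"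
  proof (intro equalityI subsetI)
    fix z assume z: "z \<in> {z. r g z \<and> r z M}"
    then obtain c where c: "covers r g c" "c = z \<or> r c z" using cover_below_exists by blast
    then have "c = x1 \<or> c = y1" using two_upper[OF x1(1) y1(1)] i1 by (auto simp: incomp_def)
    then show "z \<in> A \<union> B" using c z unfolding A_def B_def by blast
  next
    fix z assume "z \<in> A \<union> B"
    then show "z \<in> {z. r g z \<and> r z M}" using gx1 gy1 trans unfolding A_def B_def by blast
  qed
  have disj: "\<not> r z M" if "z = x1 \<or> r x1 z" "z = y1 \<or> r y1 z" for z
  proof -
    have "r x1 z" "r y1 z" using that i1 by (auto simp: incomp_def)
    from M(3)[OF this] show ?thesis using irrefl asym by blast
  qed
  have iab: "incomp r a b" if ab: "a \<in> A" "b \<in> B" for a b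
  proof -
    have a: "a = x1 \<or> r x1 a" "r a M" and b: "b = y1 \<or> r y1 b" "r b M"
      using ab by (simp_all add: A_def B_def)
    have "a \<noteq> b" using disj[of a] a b by blast
    moreover have "\<not> r a b" using disj[of b] a b trans[of x1 a b] by blast
    moreover have "\<not> r b a" using disj[of a] a b trans[of y1 b a] by blast
    ultimately show ?thesis by (simp add: incomp_def)
  qed
  have lfab: "lies_left a b" if ab: "a \<in> A" "b \<in> B" for a b
  proof -
    have "y1 \<in> B" "x1 \<in> A" using M by (auto simp: A_def B_def)
    then have "lies_left a y1" using lies_left_comparable_left[OF lf1 iab] ab by (auto simp: A_def)
    then show ?thesis using lies_left_comparable_right[OF _ iab] ab by (auto simp: B_def)
  qed
  have ne: "A \<noteq> {}" "B \<noteq> {}" using M by (auto simp: A_def B_def)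
  note split = split_lies_left[OF AB ne lfab]
  have smaller: "card {z. r g' z} < card {z. r g z}" if "r g g'" for g'
  proof (rule psubset_card_mono)
    show "finite {z. r g z}" by (rule finite_subset[of _ "{1..n}"]) (use carrier in blast, simp)
    show "{z. r g' z} \<subset> {z. r g z}" using that trans irrefl by blast
  qed
  have Min: "M \<in> {1..n}" using M carrier by blast
  have "x < g"
  proof (cases "r x M")
    case True
    then have "x \<in> A" using x1 by (auto simp: A_def)
    then show ?thesis using split by blast
  next
    case False
    have "x \<noteq> M" "\<not> r M x" using y1x M(2) trans[of y1 M x] by auto
    then have iM: "incomp r x M" using False by (auto simp: incomp_def)
    have "incomp r x y1" using y1x i1 x1(2) trans[of x1 x y1] by (auto simp: incomp_def)
    then have "lies_left x y1" using lies_left_comparable_right[OF lies_left] y1(2) by blast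
    then have lM: "lies_left x M" using lies_left_comparable_right[OF _ iM] M(2) by blast
    obtain g' where g': "r g' x" "r g' M" "\<And>u. r u x \<Longrightarrow> r u M \<Longrightarrow> u = g' \<or> r u g'"
      using ex_glb[OF xy(1) Min iM] by blast
    have "r x1 x" using x1(2) False M(1) by blast
    then have "r g g'" using g'(3)[of x1] M(1) gx1 trans[of g x1 g'] by blast
    from less.hyps[OF smaller[OF this] lM g'(1,2)] g'(3) have "x < M" by force
    \<comment> \<open>\<open>g\<close> and \<open>M\<close> are consecutive numbers, so
      \<open>x < M\<close> together with \<open>x \<noteq> g\<close> gives \<open>x < g\<close> in
      either order of the two.\<close>
    moreover have "x \<noteq> g" using gx irrefl by blast
    ultimately show ?thesis using split by auto
  qed
  moreover have "g < y"
  proof (cases "r y M")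
    case True
    then have "y \<in> B" using y1 by (auto simp: B_def)
    then show ?thesis using split by blast
  next
    case False
    have "y \<noteq> M" "\<not> r M y" using x1y M(1) trans[of x1 M y] by auto
    then have iM: "incomp r M y" using False by (auto simp: incomp_def)
    have lM: "lies_left M y"
      using lies_left_comparable_left[OF \<open>lies_left x1 y\<close> iM] M(1) by blast
    obtain g' where g': "r g' M" "r g' y" "\<And>u. r u M \<Longrightarrow> r u y \<Longrightarrow> u = g' \<or> r u g'"
      using ex_glb[OF Min xy(2) iM] by blast
    have "r y1 y" using y1(2) False M(2) by blast
    then have "r g g'" using g'(3)[of y1] M(2) gy1 trans[of g y1 g'] by blast
    from less.hyps[OF smaller[OF this] lM g'(1,2)] g'(3) have "M < y" by force
    moreover have "y \<noteq> g" using gy irrefl by blast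
    ultimately show ?thesis using split by auto
  qed
  ultimately show ?case by blast
qed

lemma lies_left_glb:
  assumes "lies_left x y"
  shows "\<exists>j. r j x \<and> r j y \<and> x < j \<and> j < y \<and> (\<forall>u. r u x \<and> r u y \<longrightarrow> u = j \<or> r u j)"
proof -
  obtain j where j: "r j x" "r j y" "\<forall>u. r u x \<and> r u y \<longrightarrow> u = j \<or> r u j"
    using ex_glb[of x y] lies_left_incomp[OF assms] by blast
  then show ?thesis using between_glb[OF assms, of j] by blast
qed

lemma lies_left_lub:
  assumes "lies_left x y"
  shows "\<exists>j. r x j \<and> r y j \<and> x < j \<and> j < y \<and> (\<forall>u. r x u \<and> r y u \<longrightarrow> u = j \<or> r j u)"
proof -
  interpret d: planar_order n "\<lambda>x y. r y x" lies_left by (rule dual)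
  show ?thesis using d.lies_left_glb[OF assms] .
qed

text \<open>The meet separates the two elements numerically, with the left one below it. From here
  on the drawing can be forgotten in the combinatorial part.\<close>

lemma lies_left_iff: "x \<in> {1..n} \<Longrightarrow> y \<in> {1..n} \<Longrightarrow> incomp r x y \<Longrightarrow> lies_left x y \<longleftrightarrow> x < y"
  using lies_left_glb[of x y] lies_left_glb[of y x] lies_left_total[of x y] by auto

lemma lies_left_if_less: "x \<in> {1..n} \<Longrightarrow> y \<in> {1..n} \<Longrightarrow> incomp r x y \<Longrightarrow> x < y \<Longrightarrow> lies_left x y"
  using lies_left_iff by blast

lemma baxter_order:
  assumes no_chain: "\<And>x y b c. \<lbrakk>covers r x y; min x y < b; b < c; c < max x y\<rbrakk> \<Longrightarrow>
       \<not> (r b x \<and> r y c) \<and> \<not> (r c x \<and> r y b)"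
  shows "baxter_order n r"
proof (unfold_locales, goal_cases)
  case (1 x y z)
  from lies_left_incomp[OF lies_left_trans[OF lies_left_if_less[OF 1(1,2,4,6)] lies_left_if_less[OF 1(2,3,5,7)]]] show ?case by blast
next
  case (2 x y)
  show ?case by (rule lies_left_lub[OF lies_left_if_less[OF 2]])
next
  case (3 x y)
  show ?case by (rule lies_left_glb[OF lies_left_if_less[OF 3]])
next
  case (4 m M A B)
  then have AB: "{z. r m z \<and> r z M} = A \<union> B" "A \<noteq> {}" "B \<noteq> {}"
    and i: "\<And>a b. a \<in> A \<Longrightarrow> b \<in> B \<Longrightarrow> incomp r a b \<and> a < b"
    unfolding split_interval_def by blast+
  have "lies_left a b" if "a \<in> A" "b \<in> B" for a b
  proof -
    have "r m a" "r m b" using AB(1) that by auto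
    then show ?thesis using i[OF that] lies_left_if_less[of a b] carrier[of m a] carrier[of m b] by blast
  qed
  from split_lies_left[OF AB this] show ?case .
next
  case (5 x y b c) show ?case by (rule no_chain[OF 5])
next
  case (6 x y1 y2 y3) show ?case by (rule two_upper[OF 6])
next
  case (7 y1 x y2 y3) show ?case by (rule two_lower[OF 7])
qed

end

section \<open>Graphs and bands in the plane\<close>

lemma segment_graph:
  fixes p q :: "real \<times> real"
  assumes "snd p < snd q"
  defines "g \<equiv> \<lambda>h. fst p + (h - snd p) / (snd q - snd p) * (fst q - fst p)"
  shows "continuous_on {snd p..snd q} g" "closed_segment p q = (\<lambda>h. (g h, h)) ` {snd p..snd q}"
proof -
  show "continuous_on {snd p..snd q} g"
    unfolding g_def using assms by (intro continuous_intros) auto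
  let ?d = "snd q - snd p"
  have d: "0 < ?d" using assms by simp
  have *: "(1 - u) *\<^sub>R p + u *\<^sub>R q = (g (snd p + u * ?d), snd p + u * ?d)" for u
    using d by (simp add: prod_eq_iff g_def field_simps)
  show "closed_segment p q = (\<lambda>h. (g h, h)) ` {snd p..snd q}"
  proof (intro equalityI subsetI)
    fix z assume "z \<in> closed_segment p q"
    then obtain u where u: "0 \<le> u" "u \<le> 1" "z = (1 - u) *\<^sub>R p + u *\<^sub>R q"
      by (auto simp: closed_segment_def)
    have "u * ?d \<le> ?d" "0 \<le> u * ?d"
      using mult_right_mono[of u 1 ?d] mult_nonneg_nonneg[of u ?d] d u by simp_all
    then have "snd p \<le> snd p + u * ?d" "snd p + u * ?d \<le> snd q" by linarith+
    then have "snd p + u * ?d \<in> {snd p..snd q}" by (simp only: atLeastAtMost_iff)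
    then show "z \<in> (\<lambda>h. (g h, h)) ` {snd p..snd q}" using u(3) * by auto
  next
    fix z assume "z \<in> (\<lambda>h. (g h, h)) ` {snd p..snd q}"
    then obtain h where h: "snd p \<le> h" "h \<le> snd q" "z = (g h, h)" by auto
    define u where "u = (h - snd p) / ?d"
    have "snd p + u * ?d = h" using d by (simp add: u_def)
    then have "z = (1 - u) *\<^sub>R p + u *\<^sub>R q" using * h by simp
    moreover have "0 \<le> u" "u \<le> 1" using h d by (auto simp: u_def field_simps)
    ultimately show "z \<in> closed_segment p q" by (auto simp: closed_segment_def)
  qed
qed

lemma join_graphs:
  fixes f g :: "real \<Rightarrow> real"
  assumes "a \<le> b" "b \<le> c" "continuous_on {a..b} f" "continuous_on {b..c} g" "f b = g b"
  shows "\<exists>k. continuous_on {a..c} k \<and>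
     (\<lambda>h. (f h, h)) ` {a..b} \<union> (\<lambda>h. (g h, h)) ` {b..c} = (\<lambda>h. (k h, h)) ` {a..c}"
proof -
  define k where "k = (\<lambda>h. if h \<le> b then f h else g h)"
  have ac: "{a..c} = {a..b} \<union> {b..c}" using assms by auto
  have "continuous_on ({a..b} \<union> {b..c}) k"
    unfolding k_def by (rule continuous_on_cases) (use assms in auto)
  moreover have "(\<lambda>h. (f h, h)) ` {a..b} = (\<lambda>h. (k h, h)) ` {a..b}"
    by (rule image_cong) (auto simp: k_def)
  moreover have "(\<lambda>h. (g h, h)) ` {b..c} = (\<lambda>h. (k h, h)) ` {b..c}"
    using assms(5) by (intro image_cong) (auto simp: k_def)
  ultimately show ?thesis unfolding ac image_Un by (intro exI[of _ k] conjI) simp_all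
qed

lemma shift_in:
  fixes p :: "real \<times> real"
  assumes "p \<in> interior S"
  obtains e where "0 < e" "(fst p + e, snd p) \<in> S" "(fst p - e, snd p) \<in> S"
proof -
  obtain e where e: "0 < e" "cball p e \<subseteq> S" using assms by (auto simp: mem_interior_cball)
  have "(fst p + e, snd p) \<in> cball p e" "(fst p - e, snd p) \<in> cball p e"
    using e(1) by (auto simp: dist_prod_def dist_real_def)
  then show thesis using that e by blast
qed

text \<open>The shape of a region: two graphs over the same heights that meet exactly at their
  ends.\<close>

locale band =
  fixes a c :: real and f g :: "real \<Rightarrow> real"
  assumes ac: "a < c" and cont: "continuous_on {a..c} f" "continuous_on {a..c} g"
    and ends: "f a = g a" "f c = g c" and lt_inside: "\<And>h. a < h \<Longrightarrow> h < c \<Longrightarrow> f h < g h"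
begin

definition U :: "(real \<times> real) set" where
  "U = {p. a < snd p \<and> snd p < c \<and> f (snd p) < fst p \<and> fst p < g (snd p)}"

lemma open_U: "open U"
proof -
  let ?S = "snd -` {a<..<c} :: (real \<times> real) set"
  have S: "open ?S" by (intro open_vimage open_greaterThanLessThan continuous_on_snd continuous_on_id)
  have sub: "snd ` ?S \<subseteq> {a..c}" by auto
  have sc: "continuous_on ?S (snd :: real \<times> real \<Rightarrow> real)" by (intro continuous_intros)
  note fc = continuous_on_compose2[OF cont(1) sc sub] continuous_on_compose2[OF cont(2) sc sub]
  have "open (?S \<inter> (\<lambda>p. fst p - f (snd p)) -` {0<..})"
    by (rule continuous_open_preimage[OF _ S]) (intro continuous_intros fc; simp)+
  moreover have "open (?S \<inter> (\<lambda>p. g (snd p) - fst p) -` {0<..})"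
    by (rule continuous_open_preimage[OF _ S]) (intro continuous_intros fc; simp)+
  moreover have "U = (?S \<inter> (\<lambda>p. fst p - f (snd p)) -` {0<..}) \<inter> (?S \<inter> (\<lambda>p. g (snd p) - fst p) -` {0<..})"
    by (auto simp: U_def)
  ultimately show ?thesis by (simp add: open_Int)
qed

text \<open>Interpolates horizontally between the two graphs, so that a rectangle is mapped onto the
  band. Connectedness, compactness and the closure of the band are inherited from the
  rectangle.\<close>

definition \<Phi> :: "real \<times> real \<Rightarrow> real \<times> real" where
  "\<Phi> x = ((1 - fst x) * f (snd x) + fst x * g (snd x), snd x)"

lemma \<Phi>_cont: "continuous_on ({0..1} \<times> {a..c}) \<Phi>"
proof -
  have "continuous_on ({0..1} \<times> {a..c}) (\<lambda>x::real \<times> real. f (snd x))"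
    "continuous_on ({0..1} \<times> {a..c}) (\<lambda>x::real \<times> real. g (snd x))"
    by (rule continuous_on_compose2[OF cont(1)] continuous_on_compose2[OF cont(2)]; force intro: continuous_intros)+
  then show ?thesis unfolding \<Phi>_def by (intro continuous_intros) auto
qed

lemma U_image: "U = \<Phi> ` ({0<..<1} \<times> {a<..<c})"
proof (intro equalityI subsetI)
  fix p assume p: "p \<in> U"
  define s where "s = (fst p - f (snd p)) / (g (snd p) - f (snd p))"
  have d: "0 < g (snd p) - f (snd p)" using p by (auto simp: U_def)
  then have s: "0 < s" "s < 1" "s * (g (snd p) - f (snd p)) = fst p - f (snd p)"
    using p by (auto simp: U_def s_def field_simps)
  then have "\<Phi> (s, snd p) = p" by (simp add: \<Phi>_def prod_eq_iff algebra_simps)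
  then show "p \<in> \<Phi> ` ({0<..<1} \<times> {a<..<c})"
    using p s by (intro image_eqI[of _ _ "(s, snd p)"]) (auto simp: U_def)
next
  fix p assume "p \<in> \<Phi> ` ({0<..<1} \<times> {a<..<c})"
  then obtain s h where p: "p = \<Phi> (s, h)" "0 < s" "s < 1" "a < h" "h < c" by auto
  have d: "f h < g h" using lt_inside p by auto
  have "0 < s * (g h - f h)" "s * (g h - f h) < 1 * (g h - f h)"
    using p d by (simp, intro mult_strict_right_mono, auto)
  then show "p \<in> U" using p by (auto simp: U_def \<Phi>_def algebra_simps)
qed

definition V :: "(real \<times> real) set" where
  "V = {p. a \<le> snd p \<and> snd p \<le> c \<and> f (snd p) \<le> fst p \<and> fst p \<le> g (snd p)}"

lemma le_inside: "a \<le> h \<Longrightarrow> h \<le> c \<Longrightarrow> f h \<le> g h"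
  using ends lt_inside[of h] by (cases "h = a"; cases "h = c") auto

lemma V_image: "V = \<Phi> ` ({0..1} \<times> {a..c})"
proof (intro equalityI subsetI)
  fix p assume p: "p \<in> V"
  \<comment> \<open>At the tips the two graphs coincide and the fibre is a single point, for which
    the parameter 0 is taken.\<close>
  define s where "s = (if f (snd p) = g (snd p) then 0 else (fst p - f (snd p)) / (g (snd p) - f (snd p)))"
  have d: "f (snd p) \<le> g (snd p)" using p by (auto simp: V_def)
  then have s: "0 \<le> s" "s \<le> 1" "s * (g (snd p) - f (snd p)) = fst p - f (snd p)"
    using p by (auto simp: V_def s_def field_simps)
  then have "\<Phi> (s, snd p) = p" by (simp add: \<Phi>_def prod_eq_iff algebra_simps)
  then show "p \<in> \<Phi> ` ({0..1} \<times> {a..c})"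
    using p s by (intro image_eqI[of _ _ "(s, snd p)"]) (auto simp: V_def)
next
  fix p assume "p \<in> \<Phi> ` ({0..1} \<times> {a..c})"
  then obtain s h where p: "p = \<Phi> (s, h)" "0 \<le> s" "s \<le> 1" "a \<le> h" "h \<le> c" by auto
  have d: "f h \<le> g h" using le_inside p by auto
  have "0 \<le> s * (g h - f h)" "s * (g h - f h) \<le> 1 * (g h - f h)"
    using p d by (simp, intro mult_right_mono, auto)
  then show "p \<in> V" using p by (auto simp: V_def \<Phi>_def algebra_simps)
qed

lemma compact_V: "compact V"
  unfolding V_image by (intro compact_continuous_image \<Phi>_cont compact_Times) auto

lemma U_V: "U \<subseteq> V"
  by (auto simp: U_def V_def)

lemma connected_U: "connected U"
  unfolding U_image
proof (rule connected_continuous_image)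
  show "continuous_on ({0<..<1} \<times> {a<..<c}) \<Phi>"
    by (rule continuous_on_subset[OF \<Phi>_cont]) auto
  show "connected ({0<..<1::real} \<times> {a<..<c})"
    by (intro connected_Times) auto
qed

lemma closure_U: "closure U = V"
proof
  show "closure U \<subseteq> V" using U_V compact_V by (simp add: closure_minimal compact_imp_closed)
  have "closure ({0<..<1} \<times> {a<..<c}) = {0..1::real} \<times> {a..c}"
    using ac by (simp add: closure_Times)
  moreover have "\<Phi> ` closure ({0<..<1} \<times> {a<..<c}) \<subseteq> closure U"
  proof (rule image_closure_subset)
    show "continuous_on (closure ({0<..<1} \<times> {a<..<c})) \<Phi>" using \<Phi>_cont calculation by simp
    show "\<Phi> ` ({0<..<1} \<times> {a<..<c}) \<subseteq> closure U"
      unfolding U_image[symmetric] by (rule closure_subset)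
  qed simp
  ultimately show "V \<subseteq> closure U" by (simp add: V_image)
qed

lemma interior_V: "interior V = U"
proof
  show "U \<subseteq> interior V" using U_V open_U by (rule interior_maximal)
  show "interior V \<subseteq> U"
  proof
    fix p assume p: "p \<in> interior V"
    obtain e where e: "0 < e" "(fst p + e, snd p) \<in> V" "(fst p - e, snd p) \<in> V"
      using shift_in[OF p] by blast
    then have "a \<le> snd p" "snd p \<le> c" "f (snd p) < fst p" "fst p < g (snd p)" by (auto simp: V_def)
    moreover from this have "snd p \<noteq> a" "snd p \<noteq> c" using ends by auto
    ultimately show "p \<in> U" by (auto simp: U_def)
  qed
qed

lemma frontier_V: "frontier V = (\<lambda>h. (f h, h)) ` {a..c} \<union> (\<lambda>h. (g h, h)) ` {a..c}"
proof -
  have "frontier V = V - U"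
    using interior_V compact_V by (simp add: frontier_def compact_imp_closed)
  also have "\<dots> = (\<lambda>h. (f h, h)) ` {a..c} \<union> (\<lambda>h. (g h, h)) ` {a..c}"
  proof (intro equalityI subsetI)
    fix p assume p: "p \<in> V - U"
    then have h: "a \<le> snd p" "snd p \<le> c" "f (snd p) \<le> fst p" "fst p \<le> g (snd p)"
      by (auto simp: V_def)
    have "fst p = f (snd p) \<or> fst p = g (snd p)"
      using p h ends by (cases "snd p = a"; cases "snd p = c") (auto simp: U_def)
    then have "p = (f (snd p), snd p) \<or> p = (g (snd p), snd p)" by (auto simp: prod_eq_iff)
    then show "p \<in> (\<lambda>h. (f h, h)) ` {a..c} \<union> (\<lambda>h. (g h, h)) ` {a..c}"
      using h by fastforce
  qed (auto simp: U_def V_def le_inside)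
  finally show ?thesis .
qed

lemma U_ne: "U \<noteq> {}"
  using ac unfolding U_image by auto

end

text \<open>A larger connected set avoiding \<open>D\<close> would have to cross the frontier of
  \<open>U\<close>, which is contained in \<open>D\<close>.\<close>

lemma component_if_frontier_disjoint:
  fixes U :: "'a::real_normed_vector set"
  assumes "U \<noteq> {}" "open U" "connected U" "U \<inter> D = {}" "frontier U \<subseteq> D"
  shows "U \<in> components (- D)"
  unfolding in_components_maximal
proof (intro conjI allI impI)
  show "U \<subseteq> - D" using assms by auto
  fix d assume d: "d \<noteq> {} \<and> U \<subseteq> d \<and> d \<subseteq> - D \<and> connected d"
  then have "d \<inter> frontier U = {}" using assms(5) by blast
  moreover have "d \<inter> U \<noteq> {}" using d assms(1) by blast
  ultimately have "d - U = {}" using connected_Int_frontier[of d U] d by blast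
  then show "d = U" using d by blast
qed (use assms in auto)

lemma connected_nonzero_sign:
  fixes \<phi> :: "'a::topological_space \<Rightarrow> real"
  assumes "connected S" "continuous_on S \<phi>" "\<And>x. x \<in> S \<Longrightarrow> \<phi> x \<noteq> 0"
  shows "(\<forall>x\<in>S. \<phi> x < 0) \<or> (\<forall>x\<in>S. 0 < \<phi> x)"
proof (rule ccontr)
  assume "\<not> ?thesis"
  then obtain x y where "x \<in> S" "y \<in> S" "0 \<le> \<phi> x" "\<phi> y \<le> 0"
    by (auto simp: not_less)
  moreover have "connected (\<phi> ` S)" using assms connected_continuous_image by blast
  ultimately have "0 \<in> \<phi> ` S"
    using connectedD_interval[of "\<phi> ` S" "\<phi> y" "\<phi> x" 0] by blast
  then show False using assms(3) by auto
qed

lemma ray_meets_frontier: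
  fixes p :: "real \<times> real"
  assumes "bounded R" "p \<in> R" "\<sigma> = 1 \<or> \<sigma> = -1"
  obtains s where "0 \<le> s" "(fst p + \<sigma> * s, snd p) \<in> frontier R"
proof -
  define S where "S = (\<lambda>s. (fst p + \<sigma> * s, snd p)) ` {0..}"
  have "connected S" unfolding S_def by (intro connected_continuous_image continuous_intros) auto
  moreover have "p \<in> S" unfolding S_def by (rule image_eqI[of _ _ 0]) auto
  then have "S \<inter> R \<noteq> {}" using assms by blast
  moreover have "S - R \<noteq> {}"
  proof
    assume "S - R = {}"
    obtain B where B: "\<And>x. x \<in> R \<Longrightarrow> norm x \<le> B"
      using assms(1) by (auto simp: bounded_iff)
    \<comment> \<open>Far enough for the first coordinate to exceed the bound \<open>B\<close> in
      absolute value, whichever direction \<open>\<sigma>\<close> selects.\<close>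
    define s where "s = \<bar>fst p\<bar> + \<bar>B\<bar> + 1"
    have "(fst p + \<sigma> * s, snd p) \<in> S"
      unfolding S_def by (rule image_eqI[of _ _ s]) (auto simp: s_def)
    then have "norm (fst p + \<sigma> * s, snd p) \<le> B" using B \<open>S - R = {}\<close> by blast
    moreover have "\<bar>fst p + \<sigma> * s\<bar> \<le> norm (fst p + \<sigma> * s, snd p)"
      using norm_fst_le[of "fst p + \<sigma> * s" "snd p"] by simp
    moreover have "B < \<bar>fst p + \<sigma> * s\<bar>" using assms(3) by (auto simp: s_def)
    ultimately show False by linarith
  qed
  ultimately have "S \<inter> frontier R \<noteq> {}" by (rule connected_Int_frontier)
  then show thesis using that unfolding S_def by auto
qed

section \<open>Planar drawings\<close>

text \<open>\<open>nontrivial\<close> ensures that a maximal chain has at least one edge, so that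
  each of its points lies on an edge. The one-element poset is treated separately.\<close>

locale planar_drawing =
  fixes n :: nat and P :: "nat rel" and pos :: "nat \<Rightarrow> real \<times> real" and b t :: nat
  assumes po: "partial_order_on {1..n} P"
    and planar: "planar_embedding n P pos"
    and b_in: "b \<in> {1..n}" and t_in: "t \<in> {1..n}"
    and b_least: "x \<in> {1..n} \<Longrightarrow> (b, x) \<in> P"
    and t_greatest: "x \<in> {1..n} \<Longrightarrow> (x, t) \<in> P"
    and nontrivial: "b \<noteq> t"
begin

abbreviation "H x \<equiv> snd (pos x)"
abbreviation "X x \<equiv> fst (pos x)"
abbreviation "lt \<equiv> less_in P"

lemma P_carrier: "(x, y) \<in> P \<Longrightarrow> x \<in> {1..n} \<and> y \<in> {1..n}"
  using po by (auto simp: partial_order_on_def preorder_on_def)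

lemma P_refl: "x \<in> {1..n} \<Longrightarrow> (x, x) \<in> P"
  using po by (auto simp: partial_order_on_def preorder_on_def refl_on_def)

lemma P_trans: "(x, y) \<in> P \<Longrightarrow> (y, z) \<in> P \<Longrightarrow> (x, z) \<in> P"
  using po by (auto simp: partial_order_on_def preorder_on_def dest: transD)

lemma P_antisym: "(x, y) \<in> P \<Longrightarrow> (y, x) \<in> P \<Longrightarrow> x = y"
  using po by (auto simp: partial_order_on_def dest: antisymD)

sublocale strict_order n lt
proof (unfold_locales, goal_cases)
  case (1 x y) then show ?case using P_carrier unfolding less_in_def by blast
next
  case (2 x) then show ?case by (simp add: less_in_def)
next
  case (3 x y z) then show ?case using P_trans[of x y z] P_antisym[of x y] unfolding less_in_def by metis
qed

lemma P_iff: "x \<in> {1..n} \<Longrightarrow> (x, y) \<in> P \<longleftrightarrow> x = y \<or> lt x y"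
  using P_refl[of x] by (auto simp: less_in_def)

lemma covers_eq: "covers lt = covered_by P"
  by (auto simp: covers_def covered_by_def fun_eq_iff)

lemma covers_lt: "covers lt x y \<Longrightarrow> lt x y"
  by (simp add: covers_def)

lemma H_cov: "covers lt x y \<Longrightarrow> H x < H y"
  using planar unfolding covers_eq planar_embedding_def hasse_diagram_def by blast

lemma pos_inj: "x \<in> {1..n} \<Longrightarrow> y \<in> {1..n} \<Longrightarrow> pos x = pos y \<Longrightarrow> x = y"
  using planar unfolding planar_embedding_def hasse_diagram_def inj_on_def by blast

lemma edges_meet:
  assumes "covers lt a a'" "covers lt c c'" "(a, a') \<noteq> (c, c')"
    "p \<in> closed_segment (pos a) (pos a')" "p \<in> closed_segment (pos c) (pos c')"
  shows "p \<in> pos ` ({a, a'} \<inter> {c, c'})"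
proof -
  have *: "\<forall>a b c d. covered_by P a b \<and> covered_by P c d \<and> (a, b) \<noteq> (c, d) \<longrightarrow>
        closed_segment (pos a) (pos b) \<inter> closed_segment (pos c) (pos d) \<subseteq> pos ` ({a, b} \<inter> {c, d})"
    using planar unfolding planar_embedding_def by (rule conjunct2)
  have "closed_segment (pos a) (pos a') \<inter> closed_segment (pos c) (pos c') \<subseteq> pos ` ({a, a'} \<inter> {c, c'})"
    by (rule *[rule_format]) (use assms in \<open>simp add: covers_eq\<close>)
  then show ?thesis using subsetD[OF _ IntI[OF assms(4,5)]] by blast
qed

section \<open>Saturated chains as vertex lists\<close>

definition is_path :: "nat list \<Rightarrow> bool" where
  "is_path vs \<longleftrightarrow> vs \<noteq> [] \<and> set vs \<subseteq> {1..n} \<and> successively (covers lt) vs"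

lemma is_path_simps [simp]:
  "\<not> is_path []" "is_path [v] \<longleftrightarrow> v \<in> {1..n}"
  "is_path (u # v # ws) \<longleftrightarrow> covers lt u v \<and> is_path (v # ws)"
  using carrier[of u v] covers_lt[of u v] by (auto simp: is_path_def)

lemma path_above_hd: "is_path (u # vs) \<Longrightarrow> y \<in> set vs \<Longrightarrow> lt u y"
proof (induction vs arbitrary: u)
  case (Cons v ws)
  then have "lt u v" using covers_lt by simp
  moreover have "y = v \<or> lt v y" using Cons by auto
  ultimately show ?case using trans by blast
qed simp

lemma path_chain: "is_path vs \<Longrightarrow> x \<in> set vs \<Longrightarrow> y \<in> set vs \<Longrightarrow> x = y \<or> lt x y \<or> lt y x"
proof (induction vs)
  case (Cons v vs)
  have "x = y \<or> lt x y \<or> lt y x" if "x \<in> set vs" "y \<in> set vs"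
  proof -
    have "is_path vs" using Cons(2) that by (cases vs) auto
    then show ?thesis using Cons(1) that by blast
  qed
  then show ?case using Cons(3,4) path_above_hd[OF Cons(2)] by auto
qed simp

lemma path_last: "is_path vs \<Longrightarrow> x \<in> set vs \<Longrightarrow> x = last vs \<or> lt x (last vs)"
proof (induction vs)
  case (Cons v vs)
  show ?case
  proof (cases vs)
    case Nil then show ?thesis using Cons by simp
  next
    case (Cons u us)
    then have "is_path vs" using Cons.prems by auto
    then show ?thesis using Cons.IH Cons.prems path_above_hd[OF Cons.prems(1), of "last vs"] Cons by auto
  qed
qed simp

lemma path_hd: "is_path vs \<Longrightarrow> x \<in> set vs \<Longrightarrow> x = hd vs \<or> lt (hd vs) x"
  using path_above_hd[of "hd vs" "tl vs" x] by (cases vs) auto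

lemma ex_path:
  assumes "(x, y) \<in> P"
  shows "\<exists>vs. is_path vs \<and> hd vs = x \<and> last vs = y"
  using assms
proof (induction "card {z. lt x z}" arbitrary: x rule: less_induct)
  case less
  have x: "x \<in> {1..n}" using less(2) P_carrier by blast
  show ?case
  proof (cases "x = y")
    case True then show ?thesis using x by (intro exI[of _ "[x]"]) auto
  next
    case False
    then have "lt x y" using less(2) by (simp add: less_in_def)
    then obtain c where c: "covers lt x c" "c = y \<or> lt c y" using cover_below_exists by blast
    have "card {z. lt c z} < card {z. lt x z}"
    proof (rule psubset_card_mono)
      show "finite {z. lt x z}" by (rule finite_subset[of _ "{1..n}"]) (use carrier in blast, simp)
      show "{z. lt c z} \<subset> {z. lt x z}" using covers_lt[OF c(1)] trans irrefl by blast
    qed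
    moreover have "(c, y) \<in> P" using c P_iff carrier[OF covers_lt[OF c(1)]] by blast
    ultimately obtain vs where "is_path vs" "hd vs = c" "last vs = y" using less(1) by blast
    then show ?thesis using c(1) by (intro exI[of _ "x # vs"]) (cases vs; auto)
  qed
qed

lemma H_lt:
  assumes "lt x y"
  shows "H x < H y"
proof -
  obtain vs where "is_path vs" "hd vs = x" "last vs = y"
    using ex_path assms unfolding less_in_def by blast
  moreover have "H (hd vs) \<le> H (last vs)" "hd vs = last vs \<or> H (hd vs) < H (last vs)" if "is_path vs" for vs
    using that
  proof (induction vs)
    case (Cons v vs)
    { case 1 then show ?case using Cons H_cov by (cases vs) fastforce+ }
    { case 2 then show ?case using Cons H_cov by (cases vs) fastforce+ }
  qed auto
  ultimately show ?thesis using assms irrefl by metis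
qed

lemma drawn_single: "drawn P pos {v} = {pos v}"
  using irrefl covers_lt unfolding drawn_def covers_eq[symmetric] by auto

text \<open>\<open>drawn\<close> includes a segment for every cover relation inside the set. On a
  path these are only the consecutive pairs: any later vertex than \<open>v\<close> is above
  \<open>v\<close> and hence no cover of \<open>u\<close>.\<close>

lemma drawn_path:
  assumes "is_path (u # v # ws)"
  shows "drawn P pos (set (u # v # ws)) = closed_segment (pos u) (pos v) \<union> drawn P pos (set (v # ws))"
proof
  have uv: "covers lt u v" and p: "is_path (v # ws)" using assms by auto
  have above: "\<And>y. y \<in> set (v # ws) \<Longrightarrow> lt u y"
    using path_above_hd[OF assms] by blast
  show "drawn P pos (set (u # v # ws)) \<subseteq> closed_segment (pos u) (pos v) \<union> drawn P pos (set (v # ws))"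
  proof
    fix p assume "p \<in> drawn P pos (set (u # v # ws))"
    then consider w where "w \<in> set (u # v # ws)" "p = pos w"
      | x y where "x \<in> set (u # v # ws)" "y \<in> set (u # v # ws)" "covers lt x y" "p \<in> closed_segment (pos x) (pos y)"
      unfolding drawn_def covers_eq by blast
    then show "p \<in> closed_segment (pos u) (pos v) \<union> drawn P pos (set (v # ws))"
    proof cases
      case 1 then show ?thesis by (auto simp: drawn_def)
    next
      case 2
      show ?thesis
      proof (cases "x = u")
        case True
        then have "y \<in> set (v # ws)" using 2 covers_lt[OF 2(3)] irrefl by auto
        then have "y = v \<or> lt v y" using path_above_hd[OF p] by auto
        then have "y = v" using 2(3) covers_lt[OF uv] True unfolding covers_def by blast
        then show ?thesis using 2 True by auto
      next
        case False
        then have x: "x \<in> set (v # ws)" using 2 by auto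
        then have "lt u y" using above trans covers_lt[OF 2(3)] by blast
        then have "y \<in> set (v # ws)" using 2 irrefl by auto
        then show ?thesis using x 2 unfolding drawn_def covers_eq by blast
      qed
    qed
  qed
  show "closed_segment (pos u) (pos v) \<union> drawn P pos (set (v # ws)) \<subseteq> drawn P pos (set (u # v # ws))"
  proof
    fix p assume "p \<in> closed_segment (pos u) (pos v) \<union> drawn P pos (set (v # ws))"
    then consider "p \<in> closed_segment (pos u) (pos v)" | "p \<in> drawn P pos (set (v # ws))" by blast
    then show "p \<in> drawn P pos (set (u # v # ws))"
    proof cases
      case 1
      have "u \<in> set (u # v # ws)" "v \<in> set (u # v # ws)" by auto
      then show ?thesis using 1 uv unfolding drawn_def covers_eq by blast
    next
      case 2
      have "set (v # ws) \<subseteq> set (u # v # ws)" by auto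
      then show ?thesis using 2 unfolding drawn_def by blast
    qed
  qed
qed

lemma path_graph:
  assumes "is_path vs"
  shows "\<exists>f. continuous_on {H (hd vs)..H (last vs)} f \<and>
     drawn P pos (set vs) = (\<lambda>h. (f h, h)) ` {H (hd vs)..H (last vs)}"
  using assms
proof (induction vs rule: induct_list012)
  case (2 v)
  then show ?case using drawn_single[of v] by (intro exI[of _ "\<lambda>_. X v"]) simp
next
  case (3 u v ws)
  let ?z = "last (v # ws)"
  have p: "is_path (v # ws)" and uv: "covers lt u v" using 3 by auto
  obtain f where f: "continuous_on {H v..H ?z} f" "drawn P pos (set (v # ws)) = (\<lambda>h. (f h, h)) ` {H v..H ?z}"
    using 3(2)[OF p] by auto
  obtain g where g: "continuous_on {H u..H v} g" "closed_segment (pos u) (pos v) = (\<lambda>h. (g h, h)) ` {H u..H v}"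
    using segment_graph[OF H_cov[OF uv]] by blast
  have le: "H u \<le> H v" "H v \<le> H ?z" using H_cov[OF uv] path_last[OF p, of v] H_lt by force+
  have "pos v \<in> drawn P pos (set (v # ws))" by (auto simp: drawn_def)
  then have "f (H v) = X v" unfolding f(2) by (metis (mono_tags, lifting) fst_conv imageE snd_conv)
  moreover have "pos v \<in> closed_segment (pos u) (pos v)" by simp
  then have "g (H v) = X v" unfolding g(2) by (metis (mono_tags, lifting) fst_conv imageE snd_conv)
  ultimately show ?case
    using join_graphs[OF le g(1) f(1)] drawn_path[OF 3(3)] f(2) g(2) by simp
qed simp

lemma path_edges:
  assumes "is_path vs" "2 \<le> length vs" "p \<in> drawn P pos (set vs)"
  shows "\<exists>x\<in>set vs. \<exists>y\<in>set vs. covers lt x y \<and> p \<in> closed_segment (pos x) (pos y)"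
  using assms
proof (induction vs rule: induct_list012)
  case (3 u v ws)
  have p: "is_path (v # ws)" and uv: "covers lt u v" using 3 by auto
  show ?case
  proof (cases "p \<in> closed_segment (pos u) (pos v)")
    case True then show ?thesis using uv by auto
  next
    case False
    then have d: "p \<in> drawn P pos (set (v # ws))" using 3 drawn_path[OF 3(3)] by blast
    have "ws \<noteq> []"
    proof
      assume "ws = []"
      then have "p = pos v" using d drawn_single[of v] by simp
      then show False using False by simp
    qed
    then have "2 \<le> length (v # ws)" by (cases ws) auto
    then show ?thesis using 3(2)[OF p _ d] by auto
  qed
qed auto

lemma path_maximal_chain:
  assumes vs: "is_path vs" and xy: "hd vs = x" "last vs = y"
  shows "set vs \<in> maximal_chains_in P (closed_interval P x y)"
  unfolding maximal_chains_in_def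
proof (intro CollectI conjI ballI impI)
  have in_n: "set vs \<subseteq> {1..n}" using vs by (simp add: is_path_def)
  show "set vs \<in> Chains P"
    unfolding Chains_def using path_chain[OF vs] in_n P_iff by blast
  show sub: "set vs \<subseteq> closed_interval P x y"
  proof
    fix z assume z: "z \<in> set vs"
    then have zn: "z \<in> {1..n}" using in_n by blast
    have "x = z \<or> lt x z" "z = y \<or> lt z y" using path_hd[OF vs z] path_last[OF vs z] xy by auto
    then show "z \<in> closed_interval P x y"
      using P_refl[OF zn] unfolding closed_interval_def less_in_def by auto
  qed
  fix D assume D: "D \<in> Chains P" "set vs \<subseteq> D \<and> D \<subseteq> closed_interval P x y"
  have "z \<in> set vs" if z: "z \<in> D" for z
  proof (rule ccontr)
    assume nz: "z \<notin> set vs"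
    have zn: "z \<in> {1..n}" and xz: "(x, z) \<in> P" "(z, y) \<in> P"
      using D z P_carrier unfolding closed_interval_def by blast+
    have "\<forall>v\<in>set vs. lt v z \<or> lt z v"
    proof
      fix v assume v: "v \<in> set vs"
      then have "v \<noteq> z" "(v, z) \<in> P \<or> (z, v) \<in> P"
        using nz D z unfolding Chains_def by auto
      then show "lt v z \<or> lt z v" by (auto simp: less_in_def)
    qed
    moreover have "vs \<noteq> []" using vs by auto
    moreover from this have "hd vs \<in> set vs" "last vs \<in> set vs" by auto
    moreover have "lt (hd vs) z" "\<not> lt (last vs) z"
      using calculation xz xy nz irrefl P_antisym unfolding less_in_def by metis+
    \<comment> \<open>\<open>z\<close> is above the first vertex but not above the last, so it fits
      strictly inside some edge, which is a cover.\<close>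
    ultimately obtain us u v ws where "vs = us @ u # v # ws" "lt u z" "\<not> lt v z"
      using adjacent_change[of "\<lambda>v. lt v z" vs] by blast
    moreover from this have "lt z v" "covers lt u v"
      using \<open>\<forall>v\<in>set vs. lt v z \<or> lt z v\<close> vs
        by (auto simp: is_path_def successively_append_iff)
    ultimately show False unfolding covers_def by blast
  qed
  then show "D = set vs" using D by blast
qed

lemma maximal_chain_path:
  assumes C: "C \<in> maximal_chains_in P (closed_interval P x y)" and xy: "(x, y) \<in> P"
  shows "\<exists>vs. is_path vs \<and> hd vs = x \<and> last vs = y \<and> set vs = C"
proof -
  have chain: "C \<in> Chains P" and sub: "C \<subseteq> closed_interval P x y"
    and max: "\<And>D. D \<in> Chains P \<Longrightarrow> C \<subseteq> D \<Longrightarrow> D \<subseteq> closed_interval P x y \<Longrightarrow> D = C"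
    using C unfolding maximal_chains_in_def by blast+
  have in_n: "C \<subseteq> {1..n}" using sub P_carrier unfolding closed_interval_def by blast
  have fin: "finite C" using in_n finite_subset by blast
  have cmp: "u = v \<or> lt u v \<or> lt v u" if "u \<in> C" "v \<in> C" for u v
    using chain that unfolding Chains_def less_in_def by blast
  have ins: "z \<in> C" if z: "(x, z) \<in> P" "(z, y) \<in> P" "\<And>v. v \<in> C \<Longrightarrow> (v, z) \<in> P \<or> (z, v) \<in> P" for z
  proof -
    have "(z, z) \<in> P" using z P_refl P_carrier by blast
    then have "insert z C \<in> Chains P" using chain z(3) unfolding Chains_def by auto
    moreover have "insert z C \<subseteq> closed_interval P x y"
      using sub z by (auto simp: closed_interval_def)
    ultimately show ?thesis using max by blast
  qed
  have ends: "x \<in> C" "y \<in> C"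
    using ins[of x] ins[of y] sub xy P_carrier[OF xy] P_refl unfolding closed_interval_def by blast+
  \<comment> \<open>Height increases along the order, so sorting a chain by height lists it in its
    own order.\<close>
  define vs where "vs = sort_key H (sorted_list_of_set C)"
  have set: "set vs = C" and dist: "distinct vs" and sorted: "sorted (map H vs)"
    using fin by (auto simp: vs_def)
  have srt: "sorted_wrt lt vs"
    unfolding sorted_wrt_iff_nth_less
  proof (intro allI impI)
    fix i j assume ij: "i < j" "j < length vs"
    then have "H (vs ! i) \<le> H (vs ! j)" "vs ! i \<noteq> vs ! j" "vs ! i \<in> C" "vs ! j \<in> C"
      using sorted dist set by (auto simp: sorted_map sorted_wrt_iff_nth_less nth_eq_iff_index_eq)
    then show "lt (vs ! i) (vs ! j)" using cmp H_lt by (metis leD)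
  qed
  have suc: "successively (covers lt) vs"
    unfolding successively_conv_nth
  proof (intro allI impI)
    fix i assume i: "Suc i < length vs"
    then have inC: "vs ! i \<in> C" "vs ! Suc i \<in> C" and l: "lt (vs ! i) (vs ! Suc i)"
      using set srt by (auto simp: sorted_wrt_iff_nth_less)
    show "covers lt (vs ! i) (vs ! Suc i)"
      unfolding covers_def
    proof (intro conjI l notI)
      assume "\<exists>z. lt (vs ! i) z \<and> lt z (vs ! Suc i)"
      then obtain z where z: "lt (vs ! i) z" "lt z (vs ! Suc i)" by blast
      have "z \<in> C"
      proof (rule ins)
        show "(x, z) \<in> P" "(z, y) \<in> P"
          using z inC sub P_trans unfolding less_in_def closed_interval_def by blast+
        fix v assume "v \<in> C"
        then obtain k where k: "v = vs ! k" "k < length vs" using set by (metis in_set_conv_nth)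
        consider "k \<le> i" | "Suc i \<le> k" by linarith
        then show "(v, z) \<in> P \<or> (z, v) \<in> P"
        proof cases
          case 1
          then have "v = vs ! i \<or> lt v (vs ! i)"
            using srt i k by (metis Suc_lessD le_neq_implies_less sorted_wrt_iff_nth_less)
          then show ?thesis using z P_trans unfolding less_in_def by blast
        next
          case 2
          then have "v = vs ! Suc i \<or> lt (vs ! Suc i) v"
            using srt k by (metis le_neq_implies_less sorted_wrt_iff_nth_less)
          then show ?thesis using z P_trans unfolding less_in_def by blast
        qed
      qed
      then obtain k where k: "z = vs ! k" "k < length vs" using set by (metis in_set_conv_nth)
      consider "k < i" | "k = i" | "k = Suc i" | "Suc i < k" by linarith
      then show False using z k i srt irrefl asym by cases (auto simp: sorted_wrt_iff_nth_less)
    qed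
  qed
  have ne: "vs \<noteq> []" using set ends by auto
  then have path: "is_path vs" using suc set in_n by (simp add: is_path_def)
  have "hd vs \<in> C" "last vs \<in> C" using ne set by auto
  then have "(x, hd vs) \<in> P" "(last vs, y) \<in> P" using sub by (auto simp: closed_interval_def)
  moreover have "x = hd vs \<or> lt (hd vs) x" "y = last vs \<or> lt y (last vs)"
    using path_hd[OF path] path_last[OF path] ends set by auto
  ultimately have "hd vs = x" "last vs = y" using P_antisym unfolding less_in_def by metis+
  then show ?thesis using path set by blast
qed

section \<open>Maximal chains as graphs over the height\<close>

definition full :: "nat set \<Rightarrow> bool" where
  "full C \<longleftrightarrow> (\<exists>vs. is_path vs \<and> hd vs = b \<and> last vs = t \<and> set vs = C)"

text \<open>Only meaningful for heights \<open>h\<close> between those of \<open>b\<close> and \<open>t\<close>.\<close>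

definition F :: "nat set \<Rightarrow> real \<Rightarrow> real" where
  "F C h = (THE s. (s, h) \<in> drawn P pos C)"

lemma carrier_interval: "closed_interval P b t = {1..n}"
  using b_least t_greatest P_carrier unfolding closed_interval_def by blast

lemma full_iff: "full C \<longleftrightarrow> C \<in> maximal_chains_in P {1..n}"
  using path_maximal_chain[of _ b t] maximal_chain_path[of C b t] b_least[OF t_in]
  unfolding full_def carrier_interval by blast

lemma full_carrier: "full C \<Longrightarrow> x \<in> C \<Longrightarrow> x \<in> {1..n}"
  unfolding full_def is_path_def by blast

lemma full_chain: "full C \<Longrightarrow> x \<in> C \<Longrightarrow> y \<in> C \<Longrightarrow> x = y \<or> lt x y \<or> lt y x"
  unfolding full_def using path_chain by blast

lemma full_H: "full C \<Longrightarrow> x \<in> C \<Longrightarrow> y \<in> C \<Longrightarrow> H x < H y \<longleftrightarrow> lt x y"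
  using full_chain[of C x y] H_lt[of x y] H_lt[of y x] by auto

lemma full_H_le: "full C \<Longrightarrow> x \<in> C \<Longrightarrow> y \<in> C \<Longrightarrow> H x \<le> H y \<longleftrightarrow> x = y \<or> lt x y"
  using full_chain[of C x y] H_lt[of x y] H_lt[of y x] by auto

lemma H_range: "x \<in> {1..n} \<Longrightarrow> H x \<in> {H b..H t}"
  using b_least[of x] t_greatest[of x] H_lt[of b x] H_lt[of x t]
  by (cases "b = x"; cases "x = t") (auto simp: less_in_def)

lemma full_graph:
  assumes "full C"
  shows "continuous_on {H b..H t} (F C)" "(s, h) \<in> drawn P pos C \<longleftrightarrow> h \<in> {H b..H t} \<and> s = F C h"
proof -
  obtain f where f: "continuous_on {H b..H t} f" "drawn P pos C = (\<lambda>h. (f h, h)) ` {H b..H t}"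
    using assms path_graph unfolding full_def by metis
  have d: "(s, h) \<in> drawn P pos C \<longleftrightarrow> h \<in> {H b..H t} \<and> s = f h" for s h
    unfolding f(2) by auto
  have eq: "F C h = f h" if "h \<in> {H b..H t}" for h
    unfolding F_def d using that by (intro the_equality) auto
  show "continuous_on {H b..H t} (F C)" using f(1) eq continuous_on_cong by metis
  show "(s, h) \<in> drawn P pos C \<longleftrightarrow> h \<in> {H b..H t} \<and> s = F C h"
    using d eq by auto
qed

lemma full_graph_point:
  "full C \<Longrightarrow> p \<in> drawn P pos C \<longleftrightarrow> snd p \<in> {H b..H t} \<and> fst p = F C (snd p)"
  using full_graph(2)[of C "fst p" "snd p"] by (simp only: prod.collapse)

lemma F_pos:
  assumes "full C" "x \<in> C"
  shows "F C (H x) = X x"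
proof -
  have "pos x \<in> drawn P pos C" using assms by (auto simp: drawn_def)
  then show ?thesis using full_graph_point[OF assms(1)] by simp
qed

lemma F_cont: "full C \<Longrightarrow> {h1..h2} \<subseteq> {H b..H t} \<Longrightarrow> continuous_on {h1..h2} (F C)"
  using full_graph(1) continuous_on_subset by blast

lemma full_edge:
  assumes "full C" "h \<in> {H b..H t}"
  obtains x y where "x \<in> C" "y \<in> C" "covers lt x y" "(F C h, h) \<in> closed_segment (pos x) (pos y)"
proof -
  obtain vs where vs: "is_path vs" "hd vs = b" "last vs = t" "set vs = C"
    using assms(1) unfolding full_def by blast
  have "length vs \<noteq> 0" "length vs \<noteq> 1"
    using vs nontrivial by (auto simp: length_Suc_conv)
  then have "2 \<le> length vs" by linarith
  then show thesis
    using path_edges[OF vs(1), of "(F C h, h)"] full_graph(2)[OF assms(1)] assms(2) vs(4) that by blast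
qed

lemma segment_height:
  assumes "covers lt x y" "p \<in> closed_segment (pos x) (pos y)"
  shows "H x \<le> snd p" "snd p \<le> H y"
  using segment_graph(2)[OF H_cov[OF assms(1)]] assms(2) by auto

lemma full_edge_F:
  assumes "full C" "x \<in> C" "y \<in> C" "covers lt x y" "H x \<le> h" "h \<le> H y"
  shows "(F C h, h) \<in> closed_segment (pos x) (pos y)"
proof -
  have "\<exists>g. closed_segment (pos x) (pos y) = (\<lambda>h. (g h, h)) ` {H x..H y}"
    by (rule exI, rule segment_graph(2)[OF H_cov[OF assms(4)]])
  then obtain g where g: "closed_segment (pos x) (pos y) = (\<lambda>h. (g h, h)) ` {H x..H y}" by blast
  then have "(g h, h) \<in> closed_segment (pos x) (pos y)" using assms by auto
  moreover from this have "(g h, h) \<in> drawn P pos C" using assms unfolding drawn_def covers_eq by blast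
  ultimately show ?thesis using full_graph(2)[OF assms(1)] by auto
qed

lemma segment_unique:
  assumes "covers lt x y" "(s, h) \<in> closed_segment (pos x) (pos y)" "(s', h) \<in> closed_segment (pos x) (pos y)"
  shows "s = s'"
  using segment_graph(2)[OF H_cov[OF assms(1)]] assms(2,3) by auto

text \<open>By planarity a common point is on a common edge or at a common vertex. The second case
  is expressed by \<open>z = z'\<close>, so that both can be used alike.\<close>

lemma full_meet:
  assumes "full C" "full K" "h \<in> {H b..H t}" "F C h = F K h"
  obtains z z' where "z \<in> C \<inter> K" "z' \<in> C \<inter> K" "z = z' \<or> covers lt z z'" "H z \<le> h" "h \<le> H z'"
proof -
  obtain x x' where x: "x \<in> C" "x' \<in> C" "covers lt x x'" "(F C h, h) \<in> closed_segment (pos x) (pos x')"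
    using full_edge[OF assms(1,3)] by blast
  obtain y y' where y: "y \<in> K" "y' \<in> K" "covers lt y y'" "(F C h, h) \<in> closed_segment (pos y) (pos y')"
    using full_edge[OF assms(2,3)] assms(4) by metis
  show thesis
  proof (cases "(x, x') = (y, y')")
    case True
    then show ?thesis using that[of x x'] x y segment_height[OF x(3,4)] by auto
  next
    case False
    from edges_meet[OF x(3) y(3) False x(4) y(4)]
    obtain z where z: "z \<in> {x, x'} \<inter> {y, y'}" "(F C h, h) = pos z" by blast
    then have "H z = h" by (metis snd_conv)
    then show ?thesis using that[of z z] z(1) x y by auto
  qed
qed

lemma full_cross:
  assumes "full C" "full K" "H b \<le> h1" "h1 \<le> h2" "h2 \<le> H t" "F C h1 \<le> F K h1" "F K h2 \<le> F C h2"
  obtains h where "h1 \<le> h" "h \<le> h2" "F C h = F K h"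
proof -
  have sub: "{h1..h2} \<subseteq> {H b..H t}" using assms by auto
  have "continuous_on {h1..h2} (\<lambda>h. F C h - F K h)"
    using F_cont[OF assms(1) sub] F_cont[OF assms(2) sub] by (intro continuous_intros)
  then have "\<exists>h\<ge>h1. h \<le> h2 \<and> F C h - F K h = 0"
    using assms by (intro IVT') auto
  then show thesis using that by auto
qed

text \<open>A chain has no vertex inside one of its edges. So a strict comparison with
  \<open>h\<close> places \<open>v\<close> at or beyond the near end of the shared edge, while at
  equal height only the far end is safe.\<close>

lemma full_below_meet:
  assumes "full C" "full K" "z \<in> C \<inter> K" "z' \<in> C \<inter> K" "z = z' \<or> covers lt z z'" "H z \<le> h" "h \<le> H z'"
    and "v \<in> C \<union> K"
  shows "H v < h \<Longrightarrow> v = z \<or> lt v z" "H v \<le> h \<Longrightarrow> v = z' \<or> lt v z'"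
    "h < H v \<Longrightarrow> v = z' \<or> lt z' v" "h \<le> H v \<Longrightarrow> v = z \<or> lt z v"
proof -
  have "\<exists>D. full D \<and> v \<in> D \<and> z \<in> D \<and> z' \<in> D" using assms by blast
  then obtain D where D: "full D" "v \<in> D" "z \<in> D" "z' \<in> D" by blast
  note c = full_H[OF D(1)] full_H_le[OF D(1)]
  show "H v \<le> h \<Longrightarrow> v = z' \<or> lt v z'" using c(2)[OF D(2,4)] assms(7) by auto
  show "h \<le> H v \<Longrightarrow> v = z \<or> lt z v" using c(2)[OF D(3,2)] assms(6) by auto
  show "v = z \<or> lt v z" if "H v < h"
  proof -
    have "lt v z'" using c(1)[OF D(2,4)] assms(7) that by auto
    moreover have "v = z \<or> lt v z \<or> lt z v" using full_chain[OF D(1-3)] by blast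
    ultimately show ?thesis using assms(5) unfolding covers_def by blast
  qed
  show "v = z' \<or> lt z' v" if "h < H v"
  proof -
    have "lt z v" using c(1)[OF D(3,2)] assms(6) that by auto
    moreover have "v = z' \<or> lt v z' \<or> lt z' v" using full_chain[OF D(1,2,4)] by blast
    ultimately show ?thesis using assms(5) unfolding covers_def by blast
  qed
qed

lemma path_append:
  assumes "is_path us" "is_path vs" "last us = hd vs"
  shows "is_path (us @ tl vs)" "hd (us @ tl vs) = hd us" "last (us @ tl vs) = last vs"
    "set (us @ tl vs) = set us \<union> set vs"
proof -
  obtain v ws where vs: "vs = v # ws" using assms(2) by (cases vs) auto
  have ne: "us \<noteq> []" using assms(1) by auto
  have "v \<in> set us" using ne assms(3) vs by (metis last_in_set list.sel(1))
  then show "set (us @ tl vs) = set us \<union> set vs" using vs by auto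
  show "hd (us @ tl vs) = hd us" using ne by simp
  show "last (us @ tl vs) = last vs" using vs assms(3) by auto
  have "ws \<noteq> [] \<Longrightarrow> covers lt (last us) (hd ws)" using assms vs by (cases ws) auto
  then show "is_path (us @ tl vs)"
    using assms vs ne by (auto simp: is_path_def successively_append_iff successively_Cons)
qed

text \<open>The path is completed by arbitrary paths from \<open>b\<close> to \<open>x\<close> and
  from \<open>y\<close> to \<open>t\<close>; these add no vertex at the heights of the given
  path.\<close>

lemma full_extend:
  assumes "is_path vs" "hd vs = x" "last vs = y"
  obtains C where "full C" "set vs \<subseteq> C" "\<And>z. z \<in> C \<Longrightarrow> H x \<le> H z \<Longrightarrow> H z \<le> H y \<Longrightarrow> z \<in> set vs"
proof -
  have ne: "vs \<noteq> []" using assms(1) by auto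
  then have xy: "x \<in> set vs" "y \<in> set vs" using assms by auto
  then have in_n: "x \<in> {1..n}" "y \<in> {1..n}" using assms(1) by (auto simp: is_path_def)
  obtain us where us: "is_path us" "hd us = b" "last us = x" using ex_path[OF b_least[OF in_n(1)]] by blast
  obtain ws where ws: "is_path ws" "hd ws = y" "last ws = t"
    using ex_path[OF t_greatest[OF in_n(2)]] by blast
  have 1: "last us = hd vs" using us assms by simp
  note p1 = path_append[OF us(1) assms(1) 1]
  have 2: "last (us @ tl vs) = hd ws" using p1 assms ws by simp
  note p2 = path_append[OF p1(1) ws(1) 2]
  define C where "C = set us \<union> set vs \<union> set ws"
  have full: "full C"
    unfolding full_def C_def using p2 p1 us ws by metis
  show thesis
  proof (rule that[OF full])
    show "set vs \<subseteq> C" by (auto simp: C_def)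
    fix z assume z: "z \<in> C" "H x \<le> H z" "H z \<le> H y"
    have "z = x \<or> lt z x" if "z \<in> set us" using path_last[OF us(1) that] us by simp
    moreover have "z = y \<or> lt y z" if "z \<in> set ws" using path_hd[OF ws(1) that] ws by simp
    ultimately show "z \<in> set vs" using z xy H_lt[of z x] H_lt[of y z] unfolding C_def by force
  qed
qed

lemma full_through:
  assumes "(x, y) \<in> P"
  obtains C where "full C" "x \<in> C" "y \<in> C"
proof -
  obtain vs where vs: "is_path vs" "hd vs = x" "last vs = y" using ex_path[OF assms] by blast
  then have "vs \<noteq> []" by auto
  then have "x \<in> set vs" "y \<in> set vs" using vs by auto
  then show thesis using full_extend[OF vs] that by (metis subsetD)
qed

lemma full_through1:
  assumes "x \<in> {1..n}"
  obtains C where "full C" "x \<in> C"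
  using full_through[OF P_refl[OF assms]] by blast

section \<open>The left-of relation on incomparable elements\<close>

definition between :: "nat \<Rightarrow> nat \<Rightarrow> real set" where
  "between x y = {min (H x) (H y)..max (H x) (H y)}"

lemma between_range: "x \<in> {1..n} \<Longrightarrow> y \<in> {1..n} \<Longrightarrow> between x y \<subseteq> {H b..H t}"
  using H_range[of x] H_range[of y] by (auto simp: between_def)

lemma between_commute: "between x y = between y x"
  by (simp add: between_def min.commute max.commute)

text \<open>A common point at such a height is on a shared vertex or edge. That vertex or an end of
  that edge would then be above one of \<open>x\<close>, \<open>y\<close> and below the other,
  making them comparable; at equal height they would share a position.\<close>

lemma incomparable_disjoint:
  assumes "incomp lt x y" "full C" "full K" "x \<in> C" "y \<in> K" "h \<in> between x y"
  shows "F C h \<noteq> F K h"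
  using assms
proof (induction "H x" "H y" arbitrary: x y C K rule: linorder_wlog)
  case le
  have in_n: "x \<in> {1..n}" "y \<in> {1..n}" using full_carrier le by blast+
  show ?case
  proof
    assume eq: "F C h = F K h"
    have h: "H x \<le> h" "h \<le> H y" "h \<in> {H b..H t}"
      using le between_range[OF in_n] by (auto simp: between_def)
    obtain z z' where z: "z \<in> C \<inter> K" "z' \<in> C \<inter> K" "z = z' \<or> covers lt z z'" "H z \<le> h" "h \<le> H z'"
      using full_meet[OF le(3,4) h(3) eq] by blast
    note x = full_below_meet[OF le(3,4) z, of x] and y = full_below_meet[OF le(3,4) z, of y]
    consider "H x < h" | "h < H y" | "H x = h" "H y = h" using h by linarith
    then show False
    proof cases
      case 1
      then have "x = z \<or> lt x z" "y = z \<or> lt z y" using x(1) y(4) le h by blast+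
      then show False using le(2) trans unfolding incomp_def by blast
    next
      case 2
      then have "x = z' \<or> lt x z'" "y = z' \<or> lt z' y" using x(2) y(3) le h by blast+
      then show False using le(2) trans unfolding incomp_def by blast
    next
      case 3
      then have "pos x = pos y"
        using F_pos[OF le(3,5)] F_pos[OF le(4,6)] eq by (simp add: prod_eq_iff)
      then show False using pos_inj in_n le(2) unfolding incomp_def by blast
    qed
  qed
next
  case sym
  then show ?case using incomp_sym[of lt] between_commute by metis
qed

lemma incomparable_side:
  assumes "incomp lt x y" "full C" "full K" "x \<in> C" "y \<in> K" "h1 \<in> between x y" "h2 \<in> between x y" "F C h1 < F K h1"
  shows "F C h2 < F K h2"
proof (rule ccontr)
  assume n: "\<not> F C h2 < F K h2"
  have in_n: "x \<in> {1..n}" "y \<in> {1..n}" using full_carrier assms by blast+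
  have r: "h1 \<in> {H b..H t}" "h2 \<in> {H b..H t}" using between_range[OF in_n] assms by blast+
  have "\<exists>h\<in>between x y. F C h = F K h"
  proof (cases "h1 \<le> h2")
    case True
    then obtain h where "h1 \<le> h" "h \<le> h2" "F C h = F K h"
      using full_cross[OF assms(2,3), of h1 h2] r assms n by auto
    then show ?thesis using assms by (intro bexI[of _ h]) (auto simp: between_def)
  next
    case False
    then obtain h where "h2 \<le> h" "h \<le> h1" "F K h = F C h"
      using full_cross[OF assms(3,2), of h2 h1] r assms n by auto
    then show ?thesis using assms by (intro bexI[of _ h]) (auto simp: between_def)
  qed
  then show False using incomparable_disjoint[OF assms(1-5)] by blast
qed

definition lies_left :: "nat \<Rightarrow> nat \<Rightarrow> bool" where
  "lies_left x y \<longleftrightarrow> incomp lt x y \<and> (\<exists>C K. full C \<and> full K \<and> x \<in> C \<and> y \<in> K \<and> F C (H y) < F K (H y))"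

lemma ends_between: "H x \<in> between x y" "H y \<in> between x y"
  by (auto simp: between_def)

text \<open>The witnessing chains can be replaced one at a time, because all chains through
  \<open>x\<close> agree at height \<open>H x\<close> and all chains through \<open>y\<close> at
  \<open>H y\<close>. So the existential definition holds for every choice of chains.\<close>

lemma lies_leftD:
  assumes "lies_left x y" "full C" "full K" "x \<in> C" "y \<in> K" "h \<in> between x y"
  shows "F C h < F K h"
proof -
  obtain C' K' where i: "incomp lt x y" and CK: "full C'" "full K'" "x \<in> C'" "y \<in> K'" "F C' (H y) < F K' (H y)"
    using assms(1) unfolding lies_left_def by blast
  have "F C' (H x) < F K' (H x)"
    using incomparable_side[OF i CK(1-4) _ _ CK(5)] ends_between by blast
  then have "F C (H x) < F K' (H x)" using F_pos CK assms by metis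
  then have "F C (H y) < F K' (H y)"
    using incomparable_side[OF i assms(2) CK(2) assms(4) CK(4)] ends_between by blast
  then have "F C (H y) < F K (H y)" using F_pos CK assms by metis
  then show ?thesis
    using incomparable_side[OF i assms(2-5)] ends_between assms(6) by blast
qed

lemma lies_left_carrier: "lies_left x y \<Longrightarrow> x \<in> {1..n} \<and> y \<in> {1..n} \<and> incomp lt x y"
  unfolding lies_left_def using full_carrier by blast

lemma lies_left_tot:
  assumes "x \<in> {1..n}" "y \<in> {1..n}" "incomp lt x y"
  shows "lies_left x y \<or> lies_left y x"
proof -
  obtain C where C: "full C" "x \<in> C" using full_through1[OF assms(1)] by blast
  obtain K where K: "full K" "y \<in> K" using full_through1[OF assms(2)] by blast
  have i: "incomp lt y x" using assms(3) incomp_sym[of lt x y] by simp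
  have "F C (H y) \<noteq> F K (H y)" "F K (H x) \<noteq> F C (H x)"
    using incomparable_disjoint[OF assms(3) C(1) K(1) C(2) K(2)] ends_between by force+
  moreover have "F K (H y) < F C (H y) \<Longrightarrow> F K (H x) < F C (H x)"
    using incomparable_side[OF i K(1) C(1) K(2) C(2)] ends_between by blast
  ultimately show ?thesis
    unfolding lies_left_def using C K assms(3) i by (metis linorder_neqE_linordered_idom)
qed

lemma lies_left_tr:
  assumes xy: "lies_left x y" and yz: "lies_left y z"
  shows "lies_left x z"
proof -
  have in_n: "x \<in> {1..n}" "y \<in> {1..n}" "z \<in> {1..n}" using lies_left_carrier assms by blast+
  obtain K where K: "full K" "y \<in> K" using full_through1 in_n by blast
  \<comment> \<open>A single chain through \<open>x\<close> and \<open>z\<close> would pass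
    \<open>y\<close> on both sides at the height of \<open>y\<close>.\<close>
  have common: False if D: "full D" "x \<in> D" "z \<in> D" for D
    using lies_leftD[OF xy D(1) K(1) D(2) K(2) ends_between(2)] lies_leftD[OF yz K(1) D(1) K(2) D(3) ends_between(1)] by simp
  have i: "incomp lt x z"
  proof (rule ccontr)
    assume "\<not> incomp lt x z"
    then have "(x, z) \<in> P \<or> (z, x) \<in> P" using P_iff in_n by (auto simp: incomp_def)
    then show False using full_through common by metis
  qed
  have "\<not> lies_left z x"
  proof
    assume zx: "lies_left z x"
    obtain C where C: "full C" "x \<in> C" using full_through1 in_n by blast
    obtain E where E: "full E" "z \<in> E" using full_through1 in_n by blast
    \<comment> \<open>The median of the three heights lies between any two of them.\<close>
    have "\<exists>h. h \<in> between x y \<and> h \<in> between y z \<and> h \<in> between z x"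
      by (rule exI[of _ "max (min (H x) (H y)) (min (max (H x) (H y)) (H z))"]) (auto simp: between_def)
    then obtain h where h: "h \<in> between x y" "h \<in> between y z" "h \<in> between z x" by blast
    have "F C h < F K h" "F K h < F E h" "F E h < F C h"
      using lies_leftD[OF xy C(1) K(1) C(2) K(2) h(1)] lies_leftD[OF yz K(1) E(1) K(2) E(2) h(2)]
        lies_leftD[OF zx E(1) C(1) E(2) C(2) h(3)] by auto
    then show False by simp
  qed
  then show ?thesis using lies_left_tot[OF in_n(1,3) i] by blast
qed

section \<open>Joins and meets from crossing chains\<close>

lemma interpolate_aux:
  assumes ab: "lies_left x y" and cd: "lies_left c d" and lt: "lt x c" "lt x d" "lt y c" "lt y d"
  obtains z where "x = z \<or> lt x z" "y = z \<or> lt y z" "z = c \<or> lt z c" "z = d \<or> lt z d"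
proof -
  obtain C where C: "full C" "x \<in> C" "d \<in> C" using full_through lt(2) unfolding less_in_def by metis
  obtain K where K: "full K" "y \<in> K" "c \<in> K" using full_through lt(3) unfolding less_in_def by metis
  define h1 where "h1 = max (H x) (H y)"
  define h2 where "h2 = min (H c) (H d)"
  have 1: "F C h1 < F K h1" using lies_leftD[OF ab C(1) K(1) C(2) K(2)] by (auto simp: between_def h1_def)
  have 2: "F K h2 < F C h2" using lies_leftD[OF cd K(1) C(1) K(3) C(3)] by (auto simp: between_def h2_def)
  have r: "h1 \<in> {H b..H t}" "h2 \<in> {H b..H t}"
    using H_range full_carrier C K unfolding h1_def h2_def max_def min_def by presburger+
  have le: "h1 \<le> h2" using H_lt lt unfolding h1_def h2_def by (simp add: less_imp_le)
  \<comment> \<open>\<open>C\<close> runs from \<open>x\<close> to \<open>d\<close> and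
    \<open>K\<close> from \<open>y\<close> to \<open>c\<close>. So \<open>C\<close> starts to the
    left of \<open>K\<close> and ends to the right of it, and the two cross.\<close>
  obtain h where h: "h1 \<le> h" "h \<le> h2" "F C h = F K h"
    using full_cross[OF C(1) K(1) _ le] r 1 2 by auto
  then have "h1 < h" "h < h2" using 1 2 by (auto simp: order.order_iff_strict)
  then have hs: "H x < h" "H y < h" "h \<le> H c" "h \<le> H d" by (auto simp: h1_def h2_def)
  have "h \<in> {H b..H t}" using r h by auto
  then obtain z z' where z: "z \<in> C \<inter> K" "z' \<in> C \<inter> K" "z = z' \<or> covers lt z z'" "H z \<le> h" "h \<le> H z'"
    using full_meet[OF C(1) K(1) _ h(3)] by blast
  note m = full_below_meet[OF C(1) K(1) z]
  show thesis
  proof (rule that)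
    show "x = z \<or> lt x z" "y = z \<or> lt y z" using m(1) hs C K by blast+
    show "z = c \<or> lt z c" "z = d \<or> lt z d" using m(4)[of c] m(4)[of d] hs C K by auto
  qed
qed

lemma interpolate:
  assumes "incomp lt x y" "incomp lt c d" "lt x c" "lt x d" "lt y c" "lt y d"
  obtains z where "x = z \<or> lt x z" "y = z \<or> lt y z" "z = c \<or> lt z c" "z = d \<or> lt z d"
proof -
  have in_n: "x \<in> {1..n}" "y \<in> {1..n}" "c \<in> {1..n}" "d \<in> {1..n}"
    using carrier[OF assms(3)] carrier[OF assms(6)] by auto
  consider "lies_left x y" "lies_left c d" | "lies_left x y" "lies_left d c" | "lies_left y x" "lies_left c d" | "lies_left y x" "lies_left d c"
    using lies_left_tot[OF in_n(1,2) assms(1)] lies_left_tot[OF in_n(3,4) assms(2)] by blast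
  then show thesis
  proof cases
    case 1 from interpolate_aux[OF this assms(3-6)] show ?thesis using that by metis
  next
    case 2 then show ?thesis by (rule interpolate_aux[OF _ _ assms(4,3,6,5)]) (rule that; assumption)
  next
    case 3 then show ?thesis by (rule interpolate_aux[OF _ _ assms(5,6,3,4)]) (rule that; assumption)
  next
    case 4 then show ?thesis by (rule interpolate_aux[OF _ _ assms(6,5,4,3)]) (rule that; assumption)
  qed
qed

text \<open>Two minimal common upper bounds would be incomparable, and the crossing point supplied
  by \<open>interpolate\<close> would be a common upper bound below both. This is the classical fact
  that a bounded planar poset is a lattice.\<close>

lemma lub_exists:
  assumes "x \<in> {1..n}" "y \<in> {1..n}" "incomp lt x y"
  shows "\<exists>j. lt x j \<and> lt y j \<and> (\<forall>u. lt x u \<and> lt y u \<longrightarrow> u = j \<or> lt j u)"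
proof -
  let ?S = "{u. lt x u \<and> lt y u}"
  have "(x, t) \<in> P" "(y, t) \<in> P" using t_greatest assms by auto
  then have "x = t \<or> lt x t" "y = t \<or> lt y t" using P_iff assms by auto
  then have "t \<in> ?S" using assms(3) by (auto simp: incomp_def)
  moreover have fin: "finite ?S" by (rule finite_subset[of _ "{1..n}"]) (use carrier in blast, simp)
  ultimately have "\<exists>j\<in>?S. \<forall>u\<in>?S. u \<noteq> j \<longrightarrow> \<not> lt u j"
  proof (intro Finite_Set.bex_min_element)
    show "asymp_on ?S lt" by (rule asymp_onI) (rule asym)
    show "transp_on ?S lt" by (rule transp_onI) (rule trans)
  qed auto
  then obtain j where j: "lt x j" "lt y j" "\<And>u. lt x u \<Longrightarrow> lt y u \<Longrightarrow> u \<noteq> j \<Longrightarrow> \<not> lt u j" by blast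
  have "u = j \<or> lt j u" if u: "lt x u" "lt y u" for u
  proof (rule ccontr)
    assume n: "\<not> ?thesis"
    then have i: "incomp lt u j" using j(3)[OF u] by (auto simp: incomp_def)
    obtain z where z: "x = z \<or> lt x z" "y = z \<or> lt y z" "z = u \<or> lt z u" "z = j \<or> lt z j"
      using interpolate[OF assms(3) i u(1) j(1) u(2) j(2)] by blast
    have "lt x z" "lt y z" using z assms(3) by (auto simp: incomp_def)
    then have "z = j" using j(3) z(4) by blast
    then show False using z(3) n by blast
  qed
  then show ?thesis using j by blast
qed

lemma glb_exists:
  assumes "x \<in> {1..n}" "y \<in> {1..n}" "incomp lt x y"
  shows "\<exists>j. lt j x \<and> lt j y \<and> (\<forall>u. lt u x \<and> lt u y \<longrightarrow> u = j \<or> lt u j)"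
proof -
  let ?S = "{u. lt u x \<and> lt u y}"
  have "(b, x) \<in> P" "(b, y) \<in> P" using b_least assms by auto
  then have "b = x \<or> lt b x" "b = y \<or> lt b y" using P_iff[OF b_in] by auto
  then have "b \<in> ?S" using assms(3) by (auto simp: incomp_def)
  moreover have fin: "finite ?S" by (rule finite_subset[of _ "{1..n}"]) (use carrier in blast, simp)
  ultimately have "\<exists>j\<in>?S. \<forall>u\<in>?S. u \<noteq> j \<longrightarrow> \<not> lt j u"
  proof (intro Finite_Set.bex_max_element)
    show "asymp_on ?S lt" by (rule asymp_onI) (rule asym)
    show "transp_on ?S lt" by (rule transp_onI) (rule trans)
  qed auto
  then obtain j where j: "lt j x" "lt j y" "\<And>u. lt u x \<Longrightarrow> lt u y \<Longrightarrow> u \<noteq> j \<Longrightarrow> \<not> lt j u" by blast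
  have "u = j \<or> lt u j" if u: "lt u x" "lt u y" for u
  proof (rule ccontr)
    assume n: "\<not> ?thesis"
    then have i: "incomp lt u j" using j(3)[OF u] by (auto simp: incomp_def)
    obtain z where z: "u = z \<or> lt u z" "j = z \<or> lt j z" "z = x \<or> lt z x" "z = y \<or> lt z y"
      using interpolate[OF i assms(3) u j(1,2)] by blast
    have "lt z x" "lt z y" using z assms(3) u j i by (auto simp: incomp_def)
    then have "z = j" using j(3) z(2) by blast
    then show False using z(1) n by blast
  qed
  then show ?thesis using j by blast
qed

text \<open>This makes the natural condition, which is phrased with \<open>left_of\<close>,
  available for \<open>lies_left\<close>. At the height of \<open>y\<close> all chains through
  \<open>x\<close> are strictly left of \<open>y\<close>, and the horizontal segments between them
  stay there by convexity.\<close>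

lemma lies_left_left_of:
  assumes "lies_left x y"
  shows "left_of n P pos x y"
proof -
  have in_n: "x \<in> {1..n}" "y \<in> {1..n}" using lies_left_carrier assms by auto
  obtain K where K: "full K" "y \<in> K" using full_through1 in_n by blast
  have thr: "fst p < X y" if th: "p \<in> chains_through n P pos x" "snd p = H y" for p
  proof -
    obtain C where C: "full C" "x \<in> C" "p \<in> drawn P pos C"
      using th(1) unfolding chains_through_def full_iff by blast
    have "fst p = F C (H y)" using full_graph_point[OF C(1)] C(3) th(2) by simp
    then show ?thesis
      using lies_leftD[OF assms C(1) K(1) C(2) K(2) ends_between(2)] F_pos[OF K] by simp
  qed
  have span: "fst p < X y" if p: "p \<in> span_region n P pos x" "snd p = H y" for p
  proof -
    consider "p \<in> chains_through n P pos x"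
      | q q' where "q \<in> chains_through n P pos x" "q' \<in> chains_through n P pos x" "snd q = snd q'"
        "p \<in> closed_segment q q'"
      using p(1) unfolding span_region_def by blast
    then show ?thesis
    proof cases
      case 1 then show ?thesis using thr p by blast
    next
      case 2
      then obtain u where u: "0 \<le> u" "u \<le> 1" "p = (1 - u) *\<^sub>R q + u *\<^sub>R q'"
        by (auto simp: closed_segment_def)
      then have "snd p = (1 - u) * snd q + u * snd q'" by simp
      then have "snd p = snd q" using 2(3) by (simp add: algebra_simps)
      then have "fst q < X y" "fst q' < X y" using thr 2 p by auto
      moreover have "fst p = (1 - u) * fst q + u * fst q'" using u by simp
      ultimately show ?thesis using u convex_bound_lt[of "fst q" "X y" "fst q'" "1 - u" u] by simp
    qed
  qed
  obtain C where C: "full C" "x \<in> C" using full_through1 in_n by blast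
  have "(F C (H y), H y) \<in> drawn P pos C"
    using full_graph(2)[OF C(1)] H_range[OF in_n(2)] by blast
  then have S: "(F C (H y), H y) \<in> span_region n P pos x"
    using C unfolding span_region_def chains_through_def full_iff by blast
  have le: "F C (H y) \<le> X y" using span[OF S] by simp
  have "pos y \<notin> span_region n P pos x" using span[of "pos y"] by auto
  moreover have "{(s, H y) | s. s \<le> X y} \<inter> span_region n P pos x \<noteq> {}"
    using S le by blast
  ultimately show ?thesis unfolding left_of_def by blast
qed

text \<open>Planarity speaks about pairs of edges only, so \<open>v\<close> is first placed on an
  edge of a chain through it.\<close>

lemma vertex_on_edge:
  assumes v: "v \<in> {1..n}" and cd: "covers lt c d" "pos v \<in> closed_segment (pos c) (pos d)"
  shows "v = c \<or> v = d"
proof -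
  obtain E where E: "full E" "v \<in> E" using full_through1[OF v] by blast
  have pv: "(F E (H v), H v) = pos v" using F_pos[OF E] by simp
  obtain x y where xy: "x \<in> E" "y \<in> E" "covers lt x y" "pos v \<in> closed_segment (pos x) (pos y)"
    using full_edge[OF E(1) H_range[OF v]] pv by metis
  show ?thesis
  proof (cases "(x, y) = (c, d)")
    case True
    have "H x \<le> H v" "H v \<le> H y" using segment_height[OF xy(3,4)] by auto
    then have "x = v \<or> lt x v" "v = y \<or> lt v y" using full_H_le[OF E(1)] xy E by auto
    then show ?thesis using xy(3) True unfolding covers_def by blast
  next
    case False
    from edges_meet[OF xy(3) cd(1) False xy(4) cd(2)]
    obtain z where "z \<in> {x, y} \<inter> {c, d}" "pos v = pos z" by blast
    moreover from this have "z \<in> {1..n}" using carrier[OF covers_lt[OF cd(1)]] by blast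
    ultimately show ?thesis using pos_inj[OF v] by blast
  qed
qed

lemma vertex_on_full:
  assumes v: "v \<in> {1..n}" and C: "full C" "F C (H v) = X v"
  shows "v \<in> C"
proof -
  obtain x y where xy: "x \<in> C" "y \<in> C" "covers lt x y" "(F C (H v), H v) \<in> closed_segment (pos x) (pos y)"
    using full_edge[OF C(1) H_range[OF v]] by blast
  then have "pos v \<in> closed_segment (pos x) (pos y)" using C(2) by simp
  then show ?thesis using vertex_on_edge[OF v xy(3)] xy by blast
qed

lemma full_drawn:
  assumes "full C"
  shows "drawn P pos C \<subseteq> drawn P pos {1..n}"
  using full_carrier[OF assms] unfolding drawn_def by blast

lemma F_drawn: "full C \<Longrightarrow> h \<in> {H b..H t} \<Longrightarrow> (F C h, h) \<in> drawn P pos {1..n}"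
  using full_graph(2)[of C "F C h" h] full_drawn by blast

lemma drawn_full_edge:
  assumes "p \<in> drawn P pos {1..n}"
  obtains K c d where "full K" "c \<in> K" "d \<in> K" "covers lt c d" "p \<in> closed_segment (pos c) (pos d)"
    "p = (F K (snd p), snd p)" "snd p \<in> {H b..H t}"
proof -
  consider v where "v \<in> {1..n}" "p = pos v"
    | x y where "covers lt x y" "p \<in> closed_segment (pos x) (pos y)"
    using assms unfolding drawn_def covers_eq by blast
  then have "\<exists>K. full K \<and> p \<in> drawn P pos K"
  proof cases
    case 1
    then obtain K where "full K" "v \<in> K" using full_through1 by blast
    then show ?thesis using 1 unfolding drawn_def by blast
  next
    case 2
    then have "(x, y) \<in> P" using covers_lt[of x y] by (simp add: less_in_def)
    then obtain K where "full K" "x \<in> K" "y \<in> K" using full_through by blast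
    then show ?thesis using 2 unfolding drawn_def covers_eq by blast
  qed
  then obtain K where K: "full K" "p \<in> drawn P pos K" by blast
  then have p: "snd p \<in> {H b..H t}" "fst p = F K (snd p)" using full_graph_point by auto
  then have pe: "p = (F K (snd p), snd p)" by (simp add: prod_eq_iff)
  obtain c d where cd: "c \<in> K" "d \<in> K" "covers lt c d" "(F K (snd p), snd p) \<in> closed_segment (pos c) (pos d)"
    using full_edge[OF K(1) p(1)] by blast
  have "p \<in> closed_segment (pos c) (pos d)" using cd(4) unfolding pe[symmetric] .
  then show thesis by (rule that[OF K(1) cd(1-3) _ pe p(1)])
qed

lemma drawn_subpath:
  assumes "is_path vs" "hd vs = m" "last vs = M" "full C" "set vs \<subseteq> C"
  shows "drawn P pos (set vs) = (\<lambda>h. (F C h, h)) ` {H m..H M}"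
proof -
  obtain f where f: "drawn P pos (set vs) = (\<lambda>h. (f h, h)) ` {H m..H M}"
    using path_graph[OF assms(1)] assms by blast
  have "drawn P pos (set vs) \<subseteq> drawn P pos C" using assms(5) unfolding drawn_def by blast
  then have "f h = F C h" if "h \<in> {H m..H M}" for h
    using full_graph(2)[OF assms(4), of "f h" h] that unfolding f by blast
  then show ?thesis unfolding f by (intro image_cong) auto
qed

lemma maximal_chain_full:
  assumes "L \<in> maximal_chains_in P (closed_interval P m M)" "lt m M"
  obtains C where "full C" "L \<subseteq> C" "m \<in> L" "M \<in> L"
    "\<And>z. z \<in> C \<Longrightarrow> H m \<le> H z \<Longrightarrow> H z \<le> H M \<Longrightarrow> z \<in> L"
    "drawn P pos L = (\<lambda>h. (F C h, h)) ` {H m..H M}"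
proof -
  obtain vs where vs: "is_path vs" "hd vs = m" "last vs = M" "set vs = L"
    using maximal_chain_path[OF assms(1)] assms(2) unfolding less_in_def by blast
  obtain C where C: "full C" "set vs \<subseteq> C" "\<And>z. z \<in> C \<Longrightarrow> H m \<le> H z \<Longrightarrow> H z \<le> H M \<Longrightarrow> z \<in> set vs"
    using full_extend[OF vs(1-3)] by blast
  have "vs \<noteq> []" using vs(1) by auto
  then have "m \<in> L" "M \<in> L" using vs by auto
  moreover have "drawn P pos L = (\<lambda>h. (F C h, h)) ` {H m..H M}"
    using drawn_subpath[OF vs(1-3) C(1,2)] vs(4) by simp
  ultimately show thesis using that[of C] C vs(4) by blast
qed

text \<open>A meeting point at an inner height would involve a shared vertex strictly between
  \<open>m\<close> and \<open>M\<close>, or else the edge from \<open>m\<close> to \<open>M\<close>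
  itself.\<close>

lemma disjoint_inside:
  assumes C: "full C" "m \<in> C" "M \<in> C" and K: "full K" "m \<in> K" "M \<in> K"
    and disj: "\<And>z. z \<in> C \<Longrightarrow> z \<in> K \<Longrightarrow> lt m z \<Longrightarrow> \<not> lt z M"
    and ncov: "\<not> covers lt m M" and h: "H m < h" "h < H M"
  shows "F C h \<noteq> F K h"
proof
  assume eq: "F C h = F K h"
  have "h \<in> {H b..H t}" using h H_range[of m] H_range[of M] full_carrier C by fastforce
  then obtain z z' where z: "z \<in> C \<inter> K" "z' \<in> C \<inter> K" "z = z' \<or> covers lt z z'" "H z \<le> h" "h \<le> H z'"
    using full_meet[OF C(1) K(1) _ eq] by blast
  note m = full_below_meet[OF C(1) K(1) z, of m] and M = full_below_meet[OF C(1) K(1) z, of M]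
  have mz: "m = z \<or> lt m z" and zM: "M = z' \<or> lt z' M" using m(1) M(3) h C by blast+
  have "z \<noteq> M" using z(4) h by auto
  have "z' \<noteq> m" using z(5) h by auto
  have zM': "lt z M" using zM z(3) \<open>z \<noteq> M\<close> trans covers_lt by blast
  have mz': "lt m z'" using mz z(3) \<open>z' \<noteq> m\<close> trans covers_lt by blast
  have "z = m" using disj[of z] z(1) mz zM' by blast
  moreover have "z' = M" using disj[of z'] z(2) mz' zM by blast
  ultimately show False using z(3) ncov h by auto
qed

end

section \<open>Regions of natural embeddings\<close>

locale natural_drawing = planar_drawing +
  assumes natural: "natural_embedding n P pos"
    and adjacent_ends: "(x, y) \<in> P \<Longrightarrow> disconnected P (open_interval P x y) \<Longrightarrow> \<bar>int x - int y\<bar> = 1"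
    and two_covers: "x \<in> {1..n} \<Longrightarrow> card {y. covered_by P x y} \<le> 2 \<and> card {y. covered_by P y x} \<le> 2"
    and chains: "\<not> has_2_14_3_chain n P" "\<not> has_3_14_2_chain n P" "\<not> has_2_41_3_chain n P" "\<not> has_3_41_2_chain n P"
begin

text \<open>Comparability never leads out of \<open>A\<close>, so \<open>u\<close> and
  \<open>v\<close> are in different components and the natural condition applies. It compares with
  the minimum \<open>m\<close> only; because \<open>m\<close> and \<open>M\<close> are consecutive
  and \<open>M\<close> differs from \<open>u\<close> and \<open>v\<close>, the same bounds hold for
  \<open>M\<close>.\<close>

lemma natural_split:
  assumes I: "{z. lt m z \<and> lt z M} = A \<union> B" and AB: "\<And>u v. u \<in> A \<Longrightarrow> v \<in> B \<Longrightarrow> incomp lt u v"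
    and u: "u \<in> A" and v: "v \<in> B" and uv: "lies_left u v"
  shows "(M = Suc m \<or> m = Suc M) \<and> u < m \<and> u < M \<and> m < v \<and> M < v"
proof -
  define I where "I = open_interval P m M"
  have I': "I = A \<union> B" using I by (simp add: I_def open_interval_def)
  define E where "E = (comparability P I)\<^sup>* \<inter> I \<times> I"
  have closed: "w \<in> A" if "(z, w) \<in> (comparability P I)\<^sup>*" "z \<in> A" for z w
    using that
  proof (induction rule: rtrancl_induct)
    case (step y w)
    then have "y \<in> A" "w \<in> A \<union> B" "(y, w) \<in> P \<or> (w, y) \<in> P"
      by (auto simp: comparability_def I')
    then show ?case using AB[of y w] by (auto simp: incomp_def less_in_def)
  qed
  have uI: "u \<in> I" "v \<in> I" using u v I' by auto
  have comps: "E `` {u} \<in> poset_components P I" "E `` {v} \<in> poset_components P I"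
    unfolding poset_components_def E_def[symmetric] using uI by (auto intro: quotientI)
  have uv_in: "u \<in> E `` {u}" "v \<in> E `` {v}" using uI by (auto simp: E_def)
  have "v \<notin> E `` {u}"
  proof
    assume "v \<in> E `` {u}"
    then have "v \<in> A" using closed[of u v] u by (auto simp: E_def)
    then show False using AB[of v v] v by (auto simp: incomp_def)
  qed
  then have ne: "E `` {u} \<noteq> E `` {v}" using uv_in by blast
  then have disc: "disconnected P I"
    unfolding disconnected_def by (intro bexI[OF _ comps(1)] bexI[OF _ comps(2)])
  have lt: "lt m u" "lt u M" "lt m v" "lt v M" using uI by (auto simp: I_def open_interval_def)
  then have mM: "(m, M) \<in> P" using trans[of m u M] by (auto simp: less_in_def)
  have "\<bar>int m - int M\<bar> = 1" using adjacent_ends[OF mM] disc by (simp add: I_def)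
  moreover have "u < m \<and> m < v"
  proof -
    have "\<forall>x y. (x, y) \<in> P \<and> disconnected P (open_interval P x y) \<longrightarrow>
        (\<forall>C\<in>poset_components P (open_interval P x y).
         \<forall>D\<in>poset_components P (open_interval P x y). C \<noteq> D \<longrightarrow>
           (\<forall>w\<in>C. \<forall>z\<in>D. left_of n P pos w z \<longrightarrow> w < x \<and> x < z))"
      using natural unfolding natural_embedding_def by (rule conjunct2)
    from this[rule_format, of m M, folded I_def, OF conjI[OF mM disc] comps ne uv_in lies_left_left_of[OF uv]]
    show ?thesis .
  qed
  moreover have "u \<noteq> M" "v \<noteq> M" using lt irrefl by auto
  ultimately show ?thesis by auto
qed

lemma no_three:
  assumes "finite S" "card S \<le> 2" "y1 \<in> S" "y2 \<in> S" "y3 \<in> S"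
  shows "y1 = y2 \<or> y1 = y3 \<or> y2 = y3"
proof (rule ccontr)
  assume "\<not> ?thesis"
  then have "card {y1, y2, y3} = 3" by auto
  moreover have "card {y1, y2, y3} \<le> card S" using assms by (intro card_mono) auto
  ultimately show False using assms by simp
qed

sublocale planar_order n lt lies_left
proof (unfold_locales, goal_cases)
  case (1 x y) show ?case using lies_left_carrier[OF 1] .
next
  case (2 x y) show ?case by (rule lies_left_tot[OF 2])
next
  case (3 x y z) show ?case by (rule lies_left_tr[OF 3])
next
  case (4 x y) show ?case by (rule lub_exists[OF 4])
next
  case (5 x y) show ?case by (rule glb_exists[OF 5])
next
  case (6 x y1 y2 y3)
  have x: "x \<in> {1..n}" using 6(1) covers_lt carrier by blast
  have fin: "finite {y. covered_by P x y}"
    by (rule finite_subset[of _ "{1..n}"]) (use carrier covers_lt in \<open>auto simp: covers_eq[symmetric] simp del: atLeastAtMost_iff\<close>)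
  show ?case by (rule no_three[OF fin]) (use 6 two_covers[OF x] in \<open>auto simp: covers_eq\<close>)
next
  case (7 y1 x y2 y3)
  have x: "x \<in> {1..n}" using 7(1) covers_lt carrier by blast
  have fin: "finite {y. covered_by P y x}"
    by (rule finite_subset[of _ "{1..n}"]) (use carrier covers_lt in \<open>auto simp: covers_eq[symmetric] simp del: atLeastAtMost_iff\<close>)
  show ?case by (rule no_three[OF fin]) (use 7 two_covers[OF x] in \<open>auto simp: covers_eq\<close>)
next
  case (8 m M A B)
  have i: "incomp lt u v" if "u \<in> A" "v \<in> B" for u v
    using lies_left_carrier[OF 8(4)[OF that]] by blast
  note s = natural_split[OF 8(1) i _ _ 8(4)]
  show ?case using s 8(2,3) by blast
qed

sublocale order: baxter_order n lt
proof (rule baxter_order)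
  fix x y c d assume xy: "covers lt x y" "min x y < c" "c < d" "d < max x y"
  have in_n: "x \<in> {1..n}" "y \<in> {1..n}" using carrier[OF covers_lt[OF xy(1)]] by auto
  have c: "covered_by P x y" using xy(1) by (simp add: covers_eq)
  have n1: "\<not> (lt c x \<and> lt y d)"
  proof
    assume l: "lt c x \<and> lt y d"
    then have cd: "c \<in> {1..n}" "d \<in> {1..n}" using carrier by blast+
    consider "x < c" "d < y" | "y < c" "d < x" using xy by (cases "x \<le> y") (auto simp: min_def max_def)
    then show False
    proof cases
      case 1
      then show ?thesis using chains(1) l c cd in_n xy(3) unfolding has_2_14_3_chain_def by blast
    next
      case 2
      then show ?thesis using chains(3) l c cd in_n xy(3) unfolding has_2_41_3_chain_def by blast
    qed
  qed
  have n2: "\<not> (lt d x \<and> lt y c)"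
  proof
    assume l: "lt d x \<and> lt y c"
    then have cd: "c \<in> {1..n}" "d \<in> {1..n}" using carrier by blast+
    consider "x < c" "d < y" | "y < c" "d < x" using xy by (cases "x \<le> y") (auto simp: min_def max_def)
    then show False
    proof cases
      case 1
      then show ?thesis using chains(2) l c cd in_n xy(3) unfolding has_3_14_2_chain_def by blast
    next
      case 2
      then show ?thesis using chains(4) l c cd in_n xy(3) unfolding has_3_41_2_chain_def by blast
    qed
  qed
  show "\<not> (lt c x \<and> lt y d) \<and> \<not> (lt d x \<and> lt y c)" using n1 n2 by blast
qed

text \<open>From the drawing to the order: a region with given boundary chains is shown to be a
  band, and its sides fall into two mutually incomparable parts of the open interval, to which
  \<open>natural_split\<close> applies.\<close>

lemma region_sides:
  assumes R: "R \<in> regions n P pos" and bd: "region_boundary P pos R m M L Q"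
    and l: "l \<in> L - {m, M}" and q: "q \<in> Q - {m, M}"
  shows "lt m l \<and> lt l M \<and> lt m q \<and> lt q M \<and> (M = Suc m \<or> m = Suc M) \<and> l < m \<and> m < q"
proof -
  define D where "D = drawn P pos {1..n}"
  obtain W where W: "W \<in> components (- D)" "bounded W" "R = closure W"
    using R unfolding regions_def D_def by blast
  have Wc: "connected W" "W \<noteq> {}" "W \<inter> D = {}"
    using W(1) in_components_connected in_components_nonempty in_components_subset by blast+
  have bR: "bounded R" using W by (simp add: bounded_closure)
  have WR: "W \<subseteq> R" using W(3) closure_subset by blast
  have mM: "lt m M" and L: "L \<in> maximal_chains_in P (closed_interval P m M)"
    and Q: "Q \<in> maximal_chains_in P (closed_interval P m M)"
    and fr: "frontier R = drawn P pos L \<union> drawn P pos Q"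
    and le: "\<And>p q. p \<in> drawn P pos L \<Longrightarrow> q \<in> drawn P pos Q \<Longrightarrow> snd p = snd q \<Longrightarrow> fst p \<le> fst q"
    using bd unfolding region_boundary_def by blast+
  obtain C where C: "full C" "L \<subseteq> C" "m \<in> L" "M \<in> L"
    "\<And>z. z \<in> C \<Longrightarrow> H m \<le> H z \<Longrightarrow> H z \<le> H M \<Longrightarrow> z \<in> L"
    "drawn P pos L = (\<lambda>h. (F C h, h)) ` {H m..H M}"
    using maximal_chain_full[OF L mM] by blast
  obtain K where K: "full K" "Q \<subseteq> K" "m \<in> Q" "M \<in> Q"
    "\<And>z. z \<in> K \<Longrightarrow> H m \<le> H z \<Longrightarrow> H z \<le> H M \<Longrightarrow> z \<in> Q"
    "drawn P pos Q = (\<lambda>h. (F K h, h)) ` {H m..H M}"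
    using maximal_chain_full[OF Q mM] by blast
  have in_n: "m \<in> {1..n}" "M \<in> {1..n}" using carrier[OF mM] by auto
  have rng: "{H m..H M} \<subseteq> {H b..H t}" using H_range in_n by auto
  have HmM: "H m < H M" using H_lt mM by blast
  have le': "F C h \<le> F K h" if "h \<in> {H m..H M}" for h
    using le[of "(F C h, h)" "(F K h, h)"] that unfolding C(6) K(6) by auto
  have ends: "F C (H m) = F K (H m)" "F C (H M) = F K (H M)"
    using F_pos C K by (metis subsetD)+
  have frD: "frontier R \<subseteq> D"
    using F_drawn[OF C(1)] F_drawn[OF K(1)] rng unfolding fr C(6) K(6) D_def by auto
  have inner: "lt m z \<and> lt z M" if "z \<in> L \<union> Q" "z \<noteq> m" "z \<noteq> M" for z
    using that L Q unfolding maximal_chains_in_def closed_interval_def less_in_def by blast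
  \<comment> \<open>Both horizontal rays from a point of the bounded set \<open>R\<close> reach its
    frontier, which consists of the two chains. So the point is enclosed by them.\<close>
  have WU: "H m < snd p \<and> snd p < H M \<and> F C (snd p) < fst p \<and> fst p < F K (snd p)" if p: "p \<in> W" for p
  proof -
    have pR: "p \<in> R" using p WR by blast
    have "p \<notin> drawn P pos L \<union> drawn P pos Q" using p Wc(3) frD fr by blast
    then have off: "snd p \<in> {H m..H M} \<Longrightarrow> fst p \<noteq> F C (snd p) \<and> fst p \<noteq> F K (snd p)"
      unfolding C(6) K(6) by (metis (no_types, lifting) UnI1 UnI2 image_eqI prod.collapse)
    obtain s where s: "0 \<le> s" "(fst p + s, snd p) \<in> frontier R"
      using ray_meets_frontier[OF bR pR, of 1] by auto
    obtain s' where s': "0 \<le> s'" "(fst p - s', snd p) \<in> frontier R"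
      using ray_meets_frontier[OF bR pR, of "-1"] by auto
    have h: "snd p \<in> {H m..H M}" using s(2) unfolding fr C(6) K(6) by auto
    have "fst p + s = F C (snd p) \<or> fst p + s = F K (snd p)" using s(2) unfolding fr C(6) K(6) by auto
    moreover have "fst p - s' = F C (snd p) \<or> fst p - s' = F K (snd p)"
      using s'(2) unfolding fr C(6) K(6) by auto
    ultimately have "F C (snd p) < fst p" "fst p < F K (snd p)"
      using off[OF h] le'[OF h] s(1) s'(1) by linarith+
    moreover from this have "snd p \<noteq> H m" "snd p \<noteq> H M" using ends by auto
    ultimately show ?thesis using h by auto
  qed
  \<comment> \<open>The closure \<open>R\<close> might have interior points outside
    \<open>W\<close>, hence on the drawing. To exclude this, each maximal chain is shown to leave
    \<open>W\<close> on one side; this passes to the closure.\<close>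
  have side: "(\<forall>p\<in>R. fst p \<le> F E (snd p)) \<or> (\<forall>p\<in>R. F E (snd p) \<le> fst p)" if E: "full E" for E
  proof -
    let ?S = "snd -` {H m..H M} :: (real \<times> real) set"
    have S: "closed ?S" by (intro closed_vimage closed_atLeastAtMost continuous_on_snd continuous_on_id)
    have WS: "W \<subseteq> ?S" using WU by force
    have RS: "R \<subseteq> ?S" unfolding W(3) by (rule closure_minimal[OF WS S])
    have sc: "continuous_on ?S (snd :: real \<times> real \<Rightarrow> real)" by (intro continuous_intros)
    have "continuous_on ?S (\<lambda>p. F E (snd p))"
      by (rule continuous_on_compose2[OF F_cont[OF E rng] sc]) auto
    then have cont: "continuous_on ?S (\<lambda>p. fst p - F E (snd p))" by (intro continuous_intros)
    have "fst p - F E (snd p) \<noteq> 0" if p: "p \<in> W" for p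
    proof
      assume "fst p - F E (snd p) = 0"
      then have "p = (F E (snd p), snd p)" by (simp add: prod_eq_iff)
      moreover have "snd p \<in> {H b..H t}" using WU[OF p] rng by auto
      ultimately have "p \<in> D" using F_drawn[OF E] unfolding D_def by metis
      then show False using p Wc(3) by blast
    qed
    then have "(\<forall>p\<in>W. fst p - F E (snd p) < 0) \<or> (\<forall>p\<in>W. 0 < fst p - F E (snd p))"
      by (rule connected_nonzero_sign[OF Wc(1) continuous_on_subset[OF cont WS]])
    then show ?thesis
    proof
      assume "\<forall>p\<in>W. fst p - F E (snd p) < 0"
      then have "W \<subseteq> ?S \<inter> (\<lambda>p. fst p - F E (snd p)) -` {..0}" using WS by force
      moreover have "closed (?S \<inter> (\<lambda>p. fst p - F E (snd p)) -` {..0})"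
        by (rule continuous_closed_preimage[OF cont S closed_atMost])
      ultimately have "R \<subseteq> ?S \<inter> (\<lambda>p. fst p - F E (snd p)) -` {..0}"
        unfolding W(3) by (rule closure_minimal)
      then show ?thesis by auto
    next
      assume "\<forall>p\<in>W. 0 < fst p - F E (snd p)"
      then have "W \<subseteq> ?S \<inter> (\<lambda>p. fst p - F E (snd p)) -` {0..}" using WS by force
      moreover have "closed (?S \<inter> (\<lambda>p. fst p - F E (snd p)) -` {0..})"
        by (rule continuous_closed_preimage[OF cont S closed_atLeast])
      ultimately have "R \<subseteq> ?S \<inter> (\<lambda>p. fst p - F E (snd p)) -` {0..}"
        unfolding W(3) by (rule closure_minimal)
      then show ?thesis by auto
    qed
  qed
  have interior_free: "(F E h, h) \<notin> interior R" if E: "full E" for E h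
  proof
    assume "(F E h, h) \<in> interior R"
    then obtain e where "0 < e" "(F E h + e, h) \<in> R" "(F E h - e, h) \<in> R"
      using shift_in[of "(F E h, h)" R] by auto
    then show False using side[OF E] by force
  qed
  \<comment> \<open>A common inner vertex would pinch the region: \<open>W\<close> would avoid its
    height and stay above or below it, yet the closure of \<open>W\<close> contains both
    \<open>pos m\<close> and \<open>pos M\<close>.\<close>
  have disj: "\<not> lt z M" if z: "z \<in> C" "z \<in> K" "lt m z" for z
  proof
    assume zM: "lt z M"
    have Hz: "H m < H z" "H z < H M" using H_lt z zM by auto
    have "F C (H z) = F K (H z)" using F_pos C(1) K(1) z by metis
    then have ne: "snd p - H z \<noteq> 0" if "p \<in> W" for p using WU[OF that] by force
    have sgn: "(\<forall>p\<in>W. snd p - H z < 0) \<or> (\<forall>p\<in>W. 0 < snd p - H z)"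
      by (rule connected_nonzero_sign[OF Wc(1) _ ne]) (intro continuous_intros)
    have "pos m \<in> frontier R" "pos M \<in> frontier R" using C(3,4) fr by (auto simp: drawn_def)
    then have mR: "pos m \<in> closure W" "pos M \<in> closure W" using W(3) by (auto simp: frontier_def)
    have cl: "closed {p::real \<times> real. snd p \<le> H z}" "closed {p::real \<times> real. H z \<le> snd p}"
      by (intro closed_Collect_le continuous_intros)+
    from sgn show False
    proof
      assume "\<forall>p\<in>W. snd p - H z < 0"
      then have "W \<subseteq> {p. snd p \<le> H z}" by force
      from subsetD[OF closure_minimal[OF this cl(1)] mR(2)] show False using Hz by simp
    next
      assume "\<forall>p\<in>W. 0 < snd p - H z"
      then have "W \<subseteq> {p. H z \<le> snd p}" by force
      from subsetD[OF closure_minimal[OF this cl(2)] mR(1)] show False using Hz by simp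
    qed
  qed
  have ncov: "\<not> covers lt m M" using inner[of l] l by (auto simp: covers_def)
  have ne: "F C h \<noteq> F K h" if "H m < h" "h < H M" for h
    by (rule disjoint_inside[OF C(1) subsetD[OF C(2) C(3)] subsetD[OF C(2) C(4)]
          K(1) subsetD[OF K(2) K(3)] subsetD[OF K(2) K(4)] disj ncov that])
  interpret band: band "H m" "H M" "F C" "F K"
  proof
    show "F C h < F K h" if "H m < h" "h < H M" for h using ne[OF that] le'[of h] that by auto
  qed (use HmM F_cont C(1) K(1) rng ends in auto)
  have "W \<subseteq> band.U" using WU by (auto simp: band.U_def)
  then have meets: "band.U \<inter> R \<noteq> {}" using Wc(2) WR by blast
  have off: "band.U \<inter> frontier R = {}"
    unfolding fr C(6) K(6) by (auto simp: band.U_def)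
  \<comment> \<open>The open band is connected, meets \<open>R\<close> and avoids the frontier of
    \<open>R\<close>.\<close>
  have "band.U - R = {}"
  proof (rule ccontr)
    assume "band.U - R \<noteq> {}"
    from connected_Int_frontier[OF band.connected_U meets this] off show False by blast
  qed
  then have UR: "band.U \<subseteq> interior R" by (intro interior_maximal[OF _ band.open_U]) simp
  \<comment> \<open>No vertex is inside the band, so every element of the open interval is on or
    left of \<open>C\<close>, or on or right of \<open>K\<close>.\<close>
  define A where "A = {z. lt m z \<and> lt z M \<and> X z \<le> F C (H z)}"
  define B where "B = {z. lt m z \<and> lt z M \<and> F K (H z) \<le> X z}"
  have "z \<in> A \<union> B" if z: "lt m z" "lt z M" for z
  proof (rule ccontr)
    assume "z \<notin> A \<union> B"
    then have "pos z \<in> band.U" using z H_lt by (auto simp: A_def B_def band.U_def)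
    moreover obtain E where E: "full E" "z \<in> E" using full_through1 carrier[OF z(1)] by blast
    ultimately show False using interior_free[OF E(1), of "H z"] UR F_pos[OF E] by auto
  qed
  then have I: "{z. lt m z \<and> lt z M} = A \<union> B" by (auto simp: A_def B_def)
  have separated: "\<not> (full E \<and> u \<in> E \<and> v \<in> E)" if u: "u \<in> A" and v: "v \<in> B" for u v E
  proof
    assume E: "full E \<and> u \<in> E \<and> v \<in> E"
    have Hu: "H m < H u" "H u < H M" and Hv: "H m < H v" "H v < H M"
      using u v H_lt by (auto simp: A_def B_def)
    let ?S = "{min (H u) (H v)..max (H u) (H v)}"
    have sub: "?S \<subseteq> {H m..H M}" using Hu Hv by auto
    \<comment> \<open>A chain containing elements of both parts would cross the midline of the band,
      which is interior to \<open>R\<close>.\<close>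
    have "continuous_on ?S (\<lambda>h. F E h - (F C h + F K h) / 2)"
      using continuous_on_subset[OF F_cont[OF _ rng] sub] E C(1) K(1) by (intro continuous_intros) auto
    moreover have "F E h - (F C h + F K h) / 2 \<noteq> 0" if h: "h \<in> ?S" for h
    proof
      assume "F E h - (F C h + F K h) / 2 = 0"
      moreover have hh: "H m < h" "h < H M" using h Hu Hv by auto
      moreover note band.lt_inside[OF hh]
      ultimately have "(F E h, h) \<in> band.U" by (auto simp: band.U_def)
      then show False using interior_free E UR by blast
    qed
    ultimately have "(\<forall>h\<in>?S. F E h - (F C h + F K h) / 2 < 0) \<or> (\<forall>h\<in>?S. 0 < F E h - (F C h + F K h) / 2)"
      by (intro connected_nonzero_sign) auto
    moreover have "H u \<in> ?S" "H v \<in> ?S" by auto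
    moreover have "F E (H u) - (F C (H u) + F K (H u)) / 2 < 0"
      using F_pos[of E u] E u band.lt_inside[OF Hu] by (auto simp: A_def)
    moreover have "0 < F E (H v) - (F C (H v) + F K (H v)) / 2"
      using F_pos[of E v] E v band.lt_inside[OF Hv] by (auto simp: B_def)
    ultimately show False by (meson less_asym)
  qed
  have AB: "incomp lt u v" if uv: "u \<in> A" "v \<in> B" for u v
  proof (rule ccontr)
    assume "\<not> incomp lt u v"
    moreover have un: "u \<in> {1..n}" "v \<in> {1..n}" using uv carrier unfolding A_def B_def by blast+
    ultimately have "(u, v) \<in> P \<or> (v, u) \<in> P" using P_iff by (auto simp: incomp_def)
    then obtain E where "full E" "u \<in> E" "v \<in> E" using full_through by metis
    then show False using separated[OF uv] by blast
  qed
  have lA: "l \<in> A" using inner[of l] l F_pos[OF C(1), of l] C(2) by (auto simp: A_def)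
  have qB: "q \<in> B" using inner[of q] q F_pos[OF K(1), of q] K(2) by (auto simp: B_def)
  have "F C (H q) < F K (H q)"
    using band.lt_inside[of "H q"] qB H_lt by (auto simp: B_def)
  then have "lies_left l q"
    unfolding lies_left_def using AB[OF lA qB] C(1,2) K(1,2) l q by blast
  from natural_split[OF I AB lA qB this] show ?thesis using lA qB by (auto simp: A_def B_def)
qed

section \<open>A drawn region for every split interval\<close>

lemma inner_chain_maximal:
  assumes L: "L \<subseteq> {z. lt m z \<and> lt z M}" and mM: "lt m M"
    and chain: "\<And>u v. u \<in> L \<Longrightarrow> v \<in> L \<Longrightarrow> \<not> incomp lt u v"
    and max: "\<And>z. lt m z \<Longrightarrow> lt z M \<Longrightarrow> z \<notin> L \<Longrightarrow> \<exists>u\<in>L. incomp lt u z"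
  shows "L \<union> {m, M} \<in> maximal_chains_in P (closed_interval P m M)"
proof -
  have in_n: "m \<in> {1..n}" "M \<in> {1..n}" using carrier[OF mM] by auto
  have L_n: "L \<subseteq> {1..n}" using L carrier by blast
  have "L \<union> {m, M} \<in> Chains P"
    unfolding Chains_def
  proof (intro CollectI ballI)
    fix u v assume uv: "u \<in> L \<union> {m, M}" "v \<in> L \<union> {m, M}"
    then have uv_n: "u \<in> {1..n}" "v \<in> {1..n}" using L_n in_n by blast+
    have "\<not> incomp lt u v"
    proof (cases "u \<in> L \<and> v \<in> L")
      case False
      then show ?thesis using uv L mM by (auto simp: incomp_def)
    qed (use chain in blast)
    then show "(u, v) \<in> P \<or> (v, u) \<in> P" using P_iff uv_n by (auto simp: incomp_def)
  qed
  moreover have "L \<union> {m, M} \<subseteq> closed_interval P m M"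
    using L mM P_refl[OF in_n(1)] P_refl[OF in_n(2)] by (auto simp: closed_interval_def less_in_def)
  moreover have "D = L \<union> {m, M}"
    if D: "D \<in> Chains P" "L \<union> {m, M} \<subseteq> D" "D \<subseteq> closed_interval P m M" for D
  proof
    show "D \<subseteq> L \<union> {m, M}"
    proof (rule subsetI, rule ccontr)
      fix z assume z: "z \<in> D" "z \<notin> L \<union> {m, M}"
      then have "(m, z) \<in> P" "(z, M) \<in> P" using D(3) by (auto simp: closed_interval_def)
      then have "lt m z" "lt z M" using z by (auto simp: less_in_def)
      then obtain u where u: "u \<in> L" "incomp lt u z" using max z by blast
      then have "(u, z) \<in> P \<or> (z, u) \<in> P" using D(1,2) z(1) unfolding Chains_def by blast
      then show False using u(2) by (auto simp: incomp_def less_in_def)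
    qed
  qed (use D in blast)
  ultimately show ?thesis unfolding maximal_chains_in_def by blast
qed

text \<open>The largest element of \<open>A\<close> is on the boundary. From an element
  \<open>z\<close> off the boundary, the largest element to its right is on the boundary, since by
  transitivity anything further right is also to the right of \<open>z\<close>.\<close>

lemma right_boundary_maximal_chain:
  assumes s: "split_interval lt m M A B"
  shows "right_boundary lt A \<union> {m, M} \<in> maximal_chains_in P (closed_interval P m M)"
    "right_boundary lt A \<noteq> {}"
    "\<And>z. z \<in> A \<Longrightarrow> z \<notin> right_boundary lt A \<Longrightarrow> \<exists>u\<in>right_boundary lt A. lies_left z u"
proof -
  let ?L = "right_boundary lt A"
  have I: "{z. lt m z \<and> lt z M} = A \<union> B" and ne: "A \<noteq> {}"
    and AB: "\<And>u v. u \<in> A \<Longrightarrow> v \<in> B \<Longrightarrow> incomp lt u v"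
    using s unfolding split_interval_def by blast+
  have An: "lt m u" "lt u M" "u \<in> {1..n}" if "u \<in> A" for u
  proof -
    show "lt m u" "lt u M" using that I by blast+
    then show "u \<in> {1..n}" using carrier by blast
  qed
  have fin: "finite A" by (rule finite_subset[of _ "{1..n}"]) (use An(3) in blast, simp)
  have mM: "lt m M" using ne An(1,2) trans by blast
  have LA: "?L \<subseteq> A" by (auto simp: right_boundary_def)
  have "\<not> Max A < u" if "u \<in> A" for u using Max_ge[OF fin that] by simp
  then have "Max A \<in> ?L" using Max_in[OF fin ne] unfolding right_boundary_def by blast
  then show nL: "?L \<noteq> {}" by blast
  have dom: "\<exists>u\<in>?L. incomp lt z u \<and> z < u" if z: "z \<in> A" "z \<notin> ?L" for z
  proof -
    let ?S = "{u \<in> A. incomp lt z u \<and> z < u}"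
    have S: "finite ?S" "?S \<noteq> {}" using fin z by (auto simp: right_boundary_def)
    define u where "u = Max ?S"
    have u: "u \<in> A" "incomp lt z u" "z < u" using Max_in[OF S] by (auto simp: u_def)
    have "\<not> (incomp lt u w \<and> u < w)" if w: "w \<in> A" for w
    proof
      assume uw: "incomp lt u w \<and> u < w"
      then have "incomp lt z w"
        using order.incomp_trans[OF An(3)[OF z(1)] An(3)[OF u(1)] An(3)[OF w] u(2) _ u(3)] by blast
      then have "w \<in> ?S" using w uw u by auto
      then have "w \<le> u" unfolding u_def by (rule Max_ge[OF S(1)])
      then show False using uw by simp
    qed
    then have "u \<in> ?L" using u by (auto simp: right_boundary_def)
    then show ?thesis using u by blast
  qed
  show "\<exists>u\<in>?L. lies_left z u" if "z \<in> A" "z \<notin> ?L" for z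
    using dom[OF that] lies_left_if_less[OF An(3)[OF that(1)] An(3)] LA by blast
  show "?L \<union> {m, M} \<in> maximal_chains_in P (closed_interval P m M)"
  proof (rule inner_chain_maximal[OF _ mM])
    show "?L \<subseteq> {z. lt m z \<and> lt z M}" using LA An(1,2) by blast
    show "\<not> incomp lt u v" if "u \<in> ?L" "v \<in> ?L" for u v
    proof
      assume i: "incomp lt u v"
      then have "incomp lt v u" "u < v \<or> v < u" using incomp_sym[of lt u v] by (auto simp: incomp_def)
      then show False using that i unfolding right_boundary_def by blast
    qed
    show "\<exists>u\<in>?L. incomp lt u z" if z: "lt m z" "lt z M" "z \<notin> ?L" for z
    proof (cases "z \<in> A")
      case True
      then show ?thesis using dom[OF True z(3)] incomp_sym[of lt z] by blast
    next
      case False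
      then show ?thesis using z I AB nL LA by blast
    qed
  qed
qed

lemma left_boundary_maximal_chain:
  assumes s: "split_interval lt m M A B"
  shows "left_boundary lt B \<union> {m, M} \<in> maximal_chains_in P (closed_interval P m M)"
    "left_boundary lt B \<noteq> {}"
    "\<And>z. z \<in> B \<Longrightarrow> z \<notin> left_boundary lt B \<Longrightarrow> \<exists>u\<in>left_boundary lt B. lies_left u z"
proof -
  let ?L = "left_boundary lt B"
  have I: "{z. lt m z \<and> lt z M} = A \<union> B" and ne: "B \<noteq> {}"
    and AB: "\<And>u v. u \<in> A \<Longrightarrow> v \<in> B \<Longrightarrow> incomp lt v u"
    using s incomp_sym[of lt] unfolding split_interval_def by blast+
  have Bn: "lt m u" "lt u M" "u \<in> {1..n}" if "u \<in> B" for u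
  proof -
    show "lt m u" "lt u M" using that I by blast+
    then show "u \<in> {1..n}" using carrier by blast
  qed
  have fin: "finite B" by (rule finite_subset[of _ "{1..n}"]) (use Bn(3) in blast, simp)
  have mM: "lt m M" using ne Bn(1,2) trans by blast
  have LB: "?L \<subseteq> B" by (auto simp: left_boundary_def)
  have "\<not> u < Min B" if "u \<in> B" for u using Min_le[OF fin that] by simp
  then have "Min B \<in> ?L" using Min_in[OF fin ne] unfolding left_boundary_def by blast
  then show nL: "?L \<noteq> {}" by blast
  have dom: "\<exists>u\<in>?L. incomp lt u z \<and> u < z" if z: "z \<in> B" "z \<notin> ?L" for z
  proof -
    let ?S = "{u \<in> B. incomp lt u z \<and> u < z}"
    have S: "finite ?S" "?S \<noteq> {}" using fin z incomp_sym[of lt z] by (auto simp: left_boundary_def)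
    define u where "u = Min ?S"
    have u: "u \<in> B" "incomp lt u z" "u < z" using Min_in[OF S] by (auto simp: u_def)
    have "\<not> (incomp lt u w \<and> w < u)" if w: "w \<in> B" for w
    proof
      assume uw: "incomp lt u w \<and> w < u"
      then have "incomp lt w z"
        using order.incomp_trans[OF Bn(3)[OF w] Bn(3)[OF u(1)] Bn(3)[OF z(1)] _ u(2) _ u(3)] incomp_sym[of lt u w] by blast
      then have "w \<in> ?S" using w uw u by auto
      then have "u \<le> w" unfolding u_def by (rule Min_le[OF S(1)])
      then show False using uw by simp
    qed
    then have "u \<in> ?L" using u by (auto simp: left_boundary_def)
    then show ?thesis using u by blast
  qed
  show "\<exists>u\<in>?L. lies_left u z" if "z \<in> B" "z \<notin> ?L" for z
    using dom[OF that] lies_left_if_less[OF Bn(3) Bn(3)[OF that(1)]] LB by blast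
  show "?L \<union> {m, M} \<in> maximal_chains_in P (closed_interval P m M)"
  proof (rule inner_chain_maximal[OF _ mM])
    show "?L \<subseteq> {z. lt m z \<and> lt z M}" using LB Bn(1,2) by blast
    show "\<not> incomp lt u v" if "u \<in> ?L" "v \<in> ?L" for u v
    proof
      assume i: "incomp lt u v"
      then have "incomp lt v u" "u < v \<or> v < u" using incomp_sym[of lt u v] by (auto simp: incomp_def)
      then show False using that i unfolding left_boundary_def by blast
    qed
    show "\<exists>u\<in>?L. incomp lt u z" if z: "lt m z" "lt z M" "z \<notin> ?L" for z
    proof (cases "z \<in> B")
      case True
      then show ?thesis using dom[OF True z(3)] by blast
    next
      case False
      then show ?thesis using z I AB nL LB by blast
    qed
  qed
qed

text \<open>From the order back to the drawing: the band between the two boundary chains is a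
  region. The main point is that no edge runs through the open band.\<close>

lemma region_exists:
  assumes s: "split_interval lt m M A B"
  shows "\<exists>R\<in>regions n P pos.
    region_boundary P pos R m M (right_boundary lt A \<union> {m, M}) (left_boundary lt B \<union> {m, M})"
proof -
  define D where "D = drawn P pos {1..n}"
  define L where "L = right_boundary lt A"
  define Q where "Q = left_boundary lt B"
  note rb = right_boundary_maximal_chain[OF s, folded L_def]
  note lb = left_boundary_maximal_chain[OF s, folded Q_def]
  have I: "{z. lt m z \<and> lt z M} = A \<union> B"
    and AB: "\<And>u v. u \<in> A \<Longrightarrow> v \<in> B \<Longrightarrow> incomp lt u v \<and> u < v"
    using s unfolding split_interval_def by blast+
  have LA: "L \<subseteq> A" and QB: "Q \<subseteq> B"
    by (auto simp: L_def Q_def right_boundary_def left_boundary_def)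
  obtain l0 q0 where l0: "l0 \<in> L" and q0: "q0 \<in> Q" using rb(2) lb(2) by blast
  have lq0: "lt m l0" "lt l0 M" "lt m q0" "lt q0 M" using l0 q0 LA QB I by blast+
  have mM: "lt m M" using trans[OF lq0(1,2)] .
  have ncov: "\<not> covers lt m M" using lq0 by (auto simp: covers_def)
  have in_n: "m \<in> {1..n}" "M \<in> {1..n}" using carrier[OF mM] by auto
  have rng: "{H m..H M} \<subseteq> {H b..H t}" using H_range in_n by auto
  have HmM: "H m < H M" using H_lt mM by blast
  obtain C where C': "full C" "L \<union> {m, M} \<subseteq> C" "m \<in> L \<union> {m, M}" "M \<in> L \<union> {m, M}"
    "\<And>z. z \<in> C \<Longrightarrow> H m \<le> H z \<Longrightarrow> H z \<le> H M \<Longrightarrow> z \<in> L \<union> {m, M}"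
    "drawn P pos (L \<union> {m, M}) = (\<lambda>h. (F C h, h)) ` {H m..H M}"
    using maximal_chain_full[OF rb(1) mM] by blast
  note C = C'(1,2,5,6)
  obtain K where K': "full K" "Q \<union> {m, M} \<subseteq> K" "m \<in> Q \<union> {m, M}" "M \<in> Q \<union> {m, M}"
    "\<And>z. z \<in> K \<Longrightarrow> H m \<le> H z \<Longrightarrow> H z \<le> H M \<Longrightarrow> z \<in> Q \<union> {m, M}"
    "drawn P pos (Q \<union> {m, M}) = (\<lambda>h. (F K h, h)) ` {H m..H M}"
    using maximal_chain_full[OF lb(1) mM] by blast
  note K = K'(1,2,5,6)
  have inCK: "m \<in> C" "M \<in> C" "m \<in> K" "M \<in> K" "L \<subseteq> C" "Q \<subseteq> K" "l0 \<in> C" "q0 \<in> K"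
    using C(2) K(2) l0 q0 by auto
  have C_inner: "z \<in> L" if "z \<in> C" "lt m z" "lt z M" for z
  proof -
    have "z \<in> L \<union> {m, M}" using C(3)[OF that(1)] H_lt[OF that(2)] H_lt[OF that(3)] by simp
    then show ?thesis using that(2,3) irrefl by blast
  qed
  have K_inner: "z \<in> Q" if "z \<in> K" "lt m z" "lt z M" for z
  proof -
    have "z \<in> Q \<union> {m, M}" using K(3)[OF that(1)] H_lt[OF that(2)] H_lt[OF that(3)] by simp
    then show ?thesis using that(2,3) irrefl by blast
  qed
  have disj: "\<not> lt z M" if "z \<in> C" "z \<in> K" "lt m z" for z
  proof
    assume "lt z M"
    then have "z \<in> A" "z \<in> B" using C_inner K_inner that LA QB by blast+
    then show False using AB[of z z] by simp
  qed
  have ne: "F C h \<noteq> F K h" if "H m < h" "h < H M" for h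
    by (rule disjoint_inside[OF C(1) inCK(1,2) K(1) inCK(3,4) disj ncov that])
  \<comment> \<open>One comparison settles the sides: the chains do not meet between their ends, so
    what is left at the height of \<open>l0\<close> is left throughout.\<close>
  have lq: "lies_left l0 q0"
    using AB[of l0 q0] l0 q0 LA QB lies_left_if_less carrier[OF lq0(1)] carrier[OF lq0(3)] by blast
  have at_l0: "F C (H l0) < F K (H l0)"
    by (rule lies_leftD[OF lq C(1) K(1) inCK(7,8) ends_between(1)])
  have ends: "F C (H m) = F K (H m)" "F C (H M) = F K (H M)"
    using F_pos[OF C(1)] F_pos[OF K(1)] inCK by auto
  interpret band: band "H m" "H M" "F C" "F K"
  proof
    show "F C h < F K h" if h: "H m < h" "h < H M" for h
    proof (rule ccontr)
      assume n: "\<not> F C h < F K h"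
      have l: "H m < H l0" "H l0 < H M" using H_lt lq0 by auto
      have r: "H b \<le> h" "h \<le> H t" "H b \<le> H l0" "H l0 \<le> H t"
        using h l rng HmM by (auto simp: subset_iff)
      show False
      proof (cases "h \<le> H l0")
        case True
        then obtain h' where "h \<le> h'" "h' \<le> H l0" "F K h' = F C h'"
          using full_cross[OF K(1) C(1) r(1) True r(4)] n at_l0 by auto
        then show False using ne[of h'] h l by auto
      next
        case False
        then obtain h' where "H l0 \<le> h'" "h' \<le> h" "F C h' = F K h'"
          using full_cross[OF C(1) K(1) r(3) _ r(2)] n at_l0 by auto
        then show False using ne[of h'] h l by auto
      qed
    qed
  qed (use HmM F_cont[OF C(1) rng] F_cont[OF K(1) rng] ends in auto)
  have fr: "frontier (closure band.U) = drawn P pos (L \<union> {m, M}) \<union> drawn P pos (Q \<union> {m, M})"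
    unfolding band.closure_U band.frontier_V C(4) K(4) ..
  have "drawn P pos (L \<union> {m, M}) \<union> drawn P pos (Q \<union> {m, M}) \<subseteq> D"
    using F_drawn[OF C(1)] F_drawn[OF K(1)] rng unfolding C(4) K(4) D_def by auto
  \<comment> \<open>Taking the closure adds no interior points to the band, so no frontier point is
    lost.\<close>
  moreover have "frontier band.U \<subseteq> frontier (closure band.U)"
    using closure_subset[of band.V] band.open_U band.interior_V
    by (auto simp: frontier_def band.closure_U interior_open)
  ultimately have frD: "frontier band.U \<subseteq> D" unfolding fr by blast
  \<comment> \<open>An element strictly inside the band would be comparable to \<open>m\<close> and
    \<open>M\<close>, hence in \<open>A\<close> or \<open>B\<close>. If it is off the boundary, it
    is left of an element of \<open>L\<close> or right of one of \<open>Q\<close>, which puts it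
    outside the band.\<close>
  have vertex: "v \<in> L \<union> Q \<union> {m, M}" if v: "v \<in> {1..n}" "H m \<le> H v" "H v \<le> H M"
    "F C (H v) \<le> X v" "X v \<le> F K (H v)" for v
  proof -
    obtain E where E: "full E" "v \<in> E" using full_through1[OF v(1)] by blast
    have X: "X v = F E (H v)" using F_pos[OF E] by simp
    consider "F C (H v) = X v" | "F K (H v) = X v" | "F C (H v) < X v" "X v < F K (H v)" using v by linarith
    then show ?thesis
    proof cases
      case 1
      then show ?thesis using C(3)[OF vertex_on_full[OF v(1) C(1)] v(2,3)] by blast
    next
      case 2
      then show ?thesis using K(3)[OF vertex_on_full[OF v(1) K(1)] v(2,3)] by blast
    next
      case 3
      have not_left: "\<not> lies_left v u" if "u \<in> C" for u
        using lies_leftD[OF _ E(1) C(1) E(2) that ends_between(1)] 3(1) X by fastforce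
      have not_right: "\<not> lies_left u v" if "u \<in> K" for u
        using lies_leftD[OF _ K(1) E(1) that E(2) ends_between(2)] 3(2) X by fastforce
      have "H v \<noteq> H m" "H v \<noteq> H M" using 3 ends by auto
      then have Hv: "H m < H v" "H v < H M" using v by auto
      have "\<not> incomp lt v m" "\<not> incomp lt v M"
        using lies_left_tot[OF v(1) in_n(1)] lies_left_tot[OF v(1) in_n(2)] not_left not_right inCK(1-4)
          by blast+
      then have "lt m v" "lt v M" using Hv H_lt[of v m] H_lt[of M v] by (auto simp: incomp_def)
      then have "v \<in> A \<union> B" using I by blast
      moreover have "v \<in> L" if "v \<in> A" using rb(3)[OF that] not_left inCK(5) by blast
      moreover have "v \<in> Q" if "v \<in> B" using lb(3)[OF that] not_right inCK(6) by blast
      ultimately show ?thesis by blast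
    qed
  qed
  have UD: "band.U \<inter> D = {}"
  proof (rule ccontr)
    assume "band.U \<inter> D \<noteq> {}"
    then obtain p where p: "p \<in> band.U" "p \<in> D" by blast
    obtain E c d where E: "full E" and cd: "c \<in> E" "d \<in> E" "covers lt c d" "p \<in> closed_segment (pos c) (pos d)"
      and pE: "p = (F E (snd p), snd p)"
      using drawn_full_edge[OF p(2)[unfolded D_def]] by metis
    define h where "h = snd p"
    have h: "H m < h" "h < H M" "F C h < F E h" "F E h < F K h"
      using p(1) pE unfolding band.U_def h_def by (metis (no_types, lifting) fst_conv mem_Collect_eq)+
    have cdh: "H c \<le> h" "h \<le> H d" using segment_height[OF cd(3,4)] by (auto simp: h_def)
    have cd_n: "c \<in> {1..n}" "d \<in> {1..n}" using full_carrier[OF E] cd by auto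
    have no_common: "\<not> (c \<in> G \<and> d \<in> G)" if G: "full G" "F G h \<noteq> F E h" for G
    proof
      assume "c \<in> G \<and> d \<in> G"
      then have "(F G h, h) \<in> closed_segment (pos c) (pos d)" "(F E h, h) \<in> closed_segment (pos c) (pos d)"
        using full_edge_F[OF G(1) _ _ cd(3) cdh] full_edge_F[OF E cd(1,2,3) cdh] by auto
      then show False using segment_unique[OF cd(3)] G(2) by blast
    qed
    \<comment> \<open>By planarity, meeting the edge at one of its inner heights means containing
      the whole edge, which \<open>no_common\<close> excludes.\<close>
    have apart: "F E h' \<noteq> F G h'"
      if G: "full G" "F G h \<noteq> F E h" and h': "H c < h'" "h' < H d" for G h'
    proof
      assume eq: "F E h' = F G h'"
      have "h' \<in> {H b..H t}" using h' H_range[OF cd_n(1)] H_range[OF cd_n(2)] by auto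
      then obtain z z' where z: "z \<in> E \<inter> G" "z' \<in> E \<inter> G" "z = z' \<or> covers lt z z'" "H z \<le> h'" "h' \<le> H z'"
        using full_meet[OF E G(1) _ eq] by blast
      have "c = z \<or> lt c z" "d = z' \<or> lt z' d"
        using full_below_meet(1)[OF E G(1) z, of c] full_below_meet(3)[OF E G(1) z, of d] cd h' by auto
      moreover have "z \<noteq> d" "z' \<noteq> c" using z(4,5) h' by auto
      ultimately have "z = c" "z' = d"
        using z(3) cd(3) trans[of z z' d] trans[of c z z'] covers_lt[of z z'] unfolding covers_def by blast+
      then show False using no_common[OF G] z(1,2) by blast
    qed
    have NE: "F C h \<noteq> F E h" "F K h \<noteq> F E h" using h by auto
    define J where "J = {max (H c) (H m)..min (H d) (H M)}"
    have J_rng: "J \<subseteq> {H b..H t}" using rng by (auto simp: J_def subset_iff)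
    have hJ: "h \<in> J" using h cdh by (auto simp: J_def)
    \<comment> \<open>To leave the band the edge would have to cross \<open>C\<close> or
      \<open>K\<close> at one of its inner heights. \<open>crossing\<close> treats both chains and
      both vertical directions at once.\<close>
    have within: "F C h' \<le> F E h' \<and> F E h' \<le> F K h'" if h': "h' \<in> J" for h'
    proof (rule ccontr)
      assume n: "\<not> ?thesis"
      have r: "H b \<le> h'" "h' \<le> H t" "H b \<le> h" "h \<le> H t" using h' hJ J_rng by auto
      have strict: "H c < x \<and> x < H d" if "h < x \<and> x < h' \<or> h' < x \<and> x < h" for x
        using that h' hJ by (auto simp: J_def)
      have crossing: False
        if G1: "full G1" and G2: "full G2" and at_h: "F G1 h < F G2 h" and at_h': "F G2 h' < F G1 h'"
          and G: "G1 = E \<and> F G2 h \<noteq> F E h \<or> G2 = E \<and> F G1 h \<noteq> F E h" for G1 G2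
      proof -
        have "\<exists>x. (h \<le> x \<and> x \<le> h' \<or> h' \<le> x \<and> x \<le> h) \<and> F G1 x = F G2 x"
        proof (cases "h \<le> h'")
          case True
          obtain x where "h \<le> x" "x \<le> h'" "F G1 x = F G2 x"
            by (rule full_cross[OF G1 G2 r(3) True r(2) less_imp_le[OF at_h] less_imp_le[OF at_h']])
          then show ?thesis by blast
        next
          case False
          then have le: "h' \<le> h" by simp
          obtain x where "h' \<le> x" "x \<le> h" "F G2 x = F G1 x"
            by (rule full_cross[OF G2 G1 r(1) le r(4) less_imp_le[OF at_h'] less_imp_le[OF at_h]])
          then show ?thesis by (intro exI[of _ x]) simp
        qed
        then obtain x where x: "h \<le> x \<and> x \<le> h' \<or> h' \<le> x \<and> x \<le> h" "F G1 x = F G2 x" by blast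
        then have "x \<noteq> h" "x \<noteq> h'" using at_h at_h' by auto
        then have "H c < x" "x < H d" using strict[of x] x(1) by auto
        then show False using apart[OF G1, of x] apart[OF G2, of x] G x(2) by metis
      qed
      show False
      proof (cases "F C h' \<le> F E h'")
        case True
        then show ?thesis using crossing[OF E K(1) h(4)] n NE by auto
      next
        case False
        then show ?thesis using crossing[OF C(1) E h(3)] NE by auto
      qed
    qed
    have no_vertex: "\<not> (H c < H v \<and> H v < H d \<and> F E (H v) = X v)" if v: "v \<in> {1..n}" for v
    proof
      assume a: "H c < H v \<and> H v < H d \<and> F E (H v) = X v"
      then have "pos v \<in> closed_segment (pos c) (pos d)"
        using full_edge_F[OF E cd(1-3), of "H v"] by simp
      then show False using vertex_on_edge[OF v cd(3)] a by auto
    qed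
    \<comment> \<open>An edge starting below \<open>m\<close> would pass through the lower tip of
      the band, that is, through the vertex \<open>m\<close>. The same holds for \<open>M\<close> at
      the upper tip.\<close>
    have Hc: "H m \<le> H c"
    proof (rule ccontr)
      assume "\<not> H m \<le> H c"
      then have "H m \<in> J" "H c < H m" "H m < H d" using h cdh by (auto simp: J_def)
      then show False using within[of "H m"] ends no_vertex[OF in_n(1)] F_pos[OF C(1) inCK(1)] by auto
    qed
    have Hd: "H d \<le> H M"
    proof (rule ccontr)
      assume "\<not> H d \<le> H M"
      then have "H M \<in> J" "H M < H d" "H c < H M" using h cdh by (auto simp: J_def)
      then show False using within[of "H M"] ends no_vertex[OF in_n(2)] F_pos[OF C(1) inCK(2)] by auto
    qed
    have "H c \<in> J" "H d \<in> J" using Hc Hd h cdh H_cov[OF cd(3)] by (auto simp: J_def)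
    then have "c \<in> L \<union> Q \<union> {m, M}" "d \<in> L \<union> Q \<union> {m, M}"
      using vertex[OF cd_n(1)] vertex[OF cd_n(2)] within F_pos[OF E] cd Hc Hd H_cov[OF cd(3)] by force+
    \<comment> \<open>Opposite sides are incomparable, so both ends of the edge are on the same
      boundary chain, contrary to \<open>no_common\<close>.\<close>
    moreover have "\<not> (c \<in> L \<and> d \<in> Q)" "\<not> (c \<in> Q \<and> d \<in> L)"
      using AB LA QB covers_lt[OF cd(3)] by (meson incomp_def subsetD)+
    ultimately have "c \<in> C \<and> d \<in> C \<or> c \<in> K \<and> d \<in> K" using inCK by blast
    then show False using no_common[OF C(1) NE(1)] no_common[OF K(1) NE(2)] by blast
  qed
  have "band.U \<in> components (- D)"
    by (rule component_if_frontier_disjoint[OF band.U_ne band.open_U band.connected_U UD frD])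
  moreover have "bounded band.U"
    using band.U_V band.compact_V bounded_subset compact_imp_bounded by blast
  ultimately have "closure band.U \<in> regions n P pos" unfolding regions_def D_def by blast
  moreover have "fst p \<le> fst q"
    if "p \<in> drawn P pos (L \<union> {m, M})" "q \<in> drawn P pos (Q \<union> {m, M})" "snd p = snd q" for p q
    using that band.le_inside unfolding C(4) K(4) by auto
  ultimately show ?thesis
    unfolding region_boundary_def L_def[symmetric] Q_def[symmetric] using mM rb(1) lb(1) fr by blast
qed

end

section \<open>One-line notation\<close>

lemma before_nth: "before xs x y \<longleftrightarrow> (\<exists>i j. i < j \<and> j < length xs \<and> xs ! i = x \<and> xs ! j = y)"
proof
  assume "before xs x y"
  then obtain us vs ws where xs: "xs = us @ x # vs @ y # ws" using before_decomp by metis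
  show "\<exists>i j. i < j \<and> j < length xs \<and> xs ! i = x \<and> xs ! j = y"
    by (rule exI[of _ "length us"], rule exI[of _ "Suc (length us + length vs)"])
      (simp add: xs nth_append)
next
  assume "\<exists>i j. i < j \<and> j < length xs \<and> xs ! i = x \<and> xs ! j = y"
  then obtain i j where ij: "i < j" "j < length xs" "xs ! i = x" "xs ! j = y" by blast
  have "x \<in> set (take j xs)" "y \<in> set (drop j xs)"
    using ij by (auto simp: in_set_conv_nth intro: exI[of _ i] exI[of _ "0::nat"])
  then show "before xs x y" using before_append[of "take j xs" "drop j xs" x y] by simp
qed

definition word :: "nat \<Rightarrow> (nat \<Rightarrow> nat) \<Rightarrow> nat list" where
  "word n \<sigma> = map \<sigma> [1..<Suc n]"

lemma length_word [simp]: "length (word n \<sigma>) = n"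
  by (simp add: word_def)

lemma nth_word: "i < n \<Longrightarrow> word n \<sigma> ! i = \<sigma> (Suc i)"
  by (simp add: word_def del: upt_Suc)

lemma word_permutes:
  assumes "\<sigma> permutes {1..n}"
  shows "distinct (word n \<sigma>)" "set (word n \<sigma>) = {1..n}"
proof -
  show "distinct (word n \<sigma>)"
    using permutes_inj_on[OF assms] by (auto simp: word_def distinct_map)
  show "set (word n \<sigma>) = {1..n}"
    using permutes_image[OF assms] by (simp add: word_def atLeastLessThanSuc_atLeastAtMost del: upt_Suc)
qed

lemma before_word:
  assumes \<sigma>: "\<sigma> permutes {1..n}"
  shows "before (word n \<sigma>) x y \<longleftrightarrow> x \<in> {1..n} \<and> y \<in> {1..n} \<and> precedes \<sigma> x y"
proof
  assume "before (word n \<sigma>) x y"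
  then obtain i j where ij: "i < j" "j < n" "word n \<sigma> ! i = x" "word n \<sigma> ! j = y"
    unfolding before_nth by auto
  then have "x = \<sigma> (Suc i)" "y = \<sigma> (Suc j)" by (auto simp: nth_word)
  then have "inv \<sigma> x = Suc i" "inv \<sigma> y = Suc j" "x \<in> {1..n}" "y \<in> {1..n}"
    using permutes_inverses(2)[OF \<sigma>] permutes_in_image[OF \<sigma>] ij by auto
  then show "x \<in> {1..n} \<and> y \<in> {1..n} \<and> precedes \<sigma> x y"
    using ij by (simp add: precedes_def)
next
  assume a: "x \<in> {1..n} \<and> y \<in> {1..n} \<and> precedes \<sigma> x y"
  have "inv \<sigma> x \<in> {1..n}" "inv \<sigma> y \<in> {1..n}"
    using permutes_in_image[OF permutes_inv[OF \<sigma>]] a by blast+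
  then have "inv \<sigma> x - 1 < inv \<sigma> y - 1" "inv \<sigma> y - 1 < n" "inv \<sigma> x - 1 < n"
    "word n \<sigma> ! (inv \<sigma> x - 1) = x" "word n \<sigma> ! (inv \<sigma> y - 1) = y"
    using a permutes_inverses(1)[OF \<sigma>] by (auto simp: precedes_def nth_word)
  then show "before (word n \<sigma>) x y" unfolding before_nth by auto
qed

lemma linear_extension_word:
  assumes "\<And>x y. less_in P x y \<Longrightarrow> x \<in> {1..n} \<and> y \<in> {1..n}"
  shows "linear_extension n P \<sigma> \<longleftrightarrow> \<sigma> permutes {1..n} \<and> extension n (less_in P) (word n \<sigma>)"
  using assms before_word[of \<sigma> n] word_permutes[of \<sigma> n]
  unfolding linear_extension_def extension_def by blast

lemma baxter_permutation_word:
  "baxter_permutation n \<sigma> \<longleftrightarrow> \<sigma> permutes {1..n} \<and> baxter_word (word n \<sigma>)"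
proof (intro iffI conjI)
  assume b: "baxter_permutation n \<sigma>"
  then show "\<sigma> permutes {1..n}" by (simp add: baxter_permutation_def)
  show "baxter_word (word n \<sigma>)"
    unfolding baxter_word_def
  proof (intro allI impI ballI)
    fix us x y vs p q
    assume eq: "word n \<sigma> = us @ x # y # vs" and p: "p \<in> set us" and q: "q \<in> set vs"
    obtain i where i: "i < length us" "p = us ! i" using p by (metis in_set_conv_nth)
    obtain k where k: "k < length vs" "q = vs ! k" using q by (metis in_set_conv_nth)
    define j where "j = length us"
    have len: "n = j + 2 + length vs" using arg_cong[OF eq, of length] by (simp add: j_def)
    have "word n \<sigma> ! i = p" "word n \<sigma> ! j = x" "word n \<sigma> ! Suc j = y" "word n \<sigma> ! (j + 2 + k) = q"
      unfolding eq using i k by (auto simp: nth_append j_def)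
    then have "\<sigma> (Suc i) = p" "\<sigma> (Suc j) = x" "\<sigma> (Suc j + 1) = y" "\<sigma> (j + 3 + k) = q"
      using i k len by (auto simp: nth_word j_def eval_nat_numeral)
    moreover have "1 \<le> Suc i" "Suc i < Suc j" "Suc j + 1 < j + 3 + k" "j + 3 + k \<le> n"
      using i k len by (auto simp: j_def)
    ultimately show "\<not> (y < p \<and> p < q \<and> q < x) \<and> \<not> (x < q \<and> q < p \<and> p < y)"
      using b unfolding baxter_permutation_def by blast
  qed
next
  assume a: "\<sigma> permutes {1..n} \<and> baxter_word (word n \<sigma>)"
  have "\<not> (\<sigma> (j + 1) < \<sigma> i \<and> \<sigma> i < \<sigma> k \<and> \<sigma> k < \<sigma> j \<or> \<sigma> j < \<sigma> k \<and> \<sigma> k < \<sigma> i \<and> \<sigma> i < \<sigma> (j + 1))"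
    if ijk: "1 \<le> i" "i < j" "j + 1 < k" "k \<le> n" for i j k
  proof -
    let ?w = "word n \<sigma>"
    have "?w = take (j - 1) ?w @ ?w ! (j - 1) # ?w ! j # drop (j + 1) ?w"
      using ijk id_take_nth_drop[of "j - 1" ?w] Cons_nth_drop_Suc[of j ?w] by simp
    moreover have "?w ! (j - 1) = \<sigma> j" "?w ! j = \<sigma> (j + 1)" using ijk by (auto simp: nth_word)
    moreover have "\<sigma> i \<in> set (take (j - 1) ?w)"
      unfolding in_set_conv_nth using ijk by (intro exI[of _ "i - 1"]) (auto simp: nth_word)
    \<comment> \<open>\<open>\<sigma> k\<close> has list index \<open>k - 1\<close>, which becomes
      \<open>k - j - 2\<close> after dropping \<open>j + 1\<close> entries.\<close>
    moreover have "Suc (Suc (k - 2)) = k" using ijk by arith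
    then have "\<sigma> k \<in> set (drop (j + 1) ?w)"
      unfolding in_set_conv_nth using ijk by (intro exI[of _ "k - j - 2"]) (auto simp: nth_word)
    ultimately show ?thesis using a unfolding baxter_word_def by metis
  qed
  then show "baxter_permutation n \<sigma>" using a unfolding baxter_permutation_def by blast
qed

lemma word_inj:
  assumes "\<sigma> permutes {1..n}" "\<tau> permutes {1..n}" "word n \<sigma> = word n \<tau>"
  shows "\<sigma> = \<tau>"
proof
  fix x
  show "\<sigma> x = \<tau> x"
  proof (cases "x \<in> {1..n}")
    case True
    then show ?thesis
      using nth_word[of "x - 1" n] assms(3) by (metis Suc_pred' atLeastAtMost_iff le_simps(3) zero_less_Suc less_le_trans Suc_le_eq One_nat_def)
  next
    case False
    then show ?thesis using permutes_not_in assms by metis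
  qed
qed

lemma word_surj:
  assumes "distinct xs" "set xs = {1..n}"
  obtains \<sigma> where "\<sigma> permutes {1..n}" "word n \<sigma> = xs"
proof -
  \<comment> \<open>List indices start at 0, and \<open>permutes\<close> demands the identity
    outside \<open>{1..n}\<close>.\<close>
  define \<sigma> where "\<sigma> = (\<lambda>i. if i \<in> {1..n} then xs ! (i - 1) else i)"
  have len: "length xs = n" using distinct_card[OF assms(1)] assms(2) by simp
  have "word n \<sigma> = xs"
    by (rule nth_equalityI) (auto simp: len nth_word \<sigma>_def)
  moreover have "\<sigma> permutes {1..n}"
  proof (rule bij_imp_permutes)
    have "inj_on \<sigma> {1..n}"
      using assms(1) len by (auto simp: inj_on_def \<sigma>_def nth_eq_iff_index_eq)
    moreover have "\<sigma> ` {1..n} \<subseteq> {1..n}"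
      using assms(2) len nth_mem[of _ xs] by (auto simp: \<sigma>_def)
    ultimately show "bij_betw \<sigma> {1..n} {1..n}"
      by (simp add: bij_betw_def endo_inj_surj)
  qed (auto simp: \<sigma>_def)
  ultimately show thesis using that by blast
qed

section \<open>Transfer from the drawing to permutations\<close>

lemma baxter_poset_regions:
  assumes bp: "baxter_poset n P" and nat: "natural_embedding n P pos"
  shows "baxter_order n (less_in P)"
    and "\<And>R m M L Q l q. R \<in> regions n P pos \<Longrightarrow> region_boundary P pos R m M L Q \<Longrightarrow>
      l \<in> L - {m, M} \<Longrightarrow> q \<in> Q - {m, M} \<Longrightarrow>
      less_in P m l \<and> less_in P l M \<and> less_in P m q \<and> less_in P q M \<and> (M = Suc m \<or> m = Suc M) \<and> l < m \<and> m < q"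
    and "\<And>m M A B. split_interval (less_in P) m M A B \<Longrightarrow> \<exists>R\<in>regions n P pos.
      region_boundary P pos R m M (right_boundary (less_in P) A \<union> {m, M}) (left_boundary (less_in P) B \<union> {m, M})"
proof -
  have po: "partial_order_on {1..n} P" and bd: "bounded_poset n P"
    using bp unfolding baxter_poset_def by blast+
  obtain b t where b: "b \<in> {1..n}" "\<And>x. x \<in> {1..n} \<Longrightarrow> (b, x) \<in> P"
    and t: "t \<in> {1..n}" "\<And>x. x \<in> {1..n} \<Longrightarrow> (x, t) \<in> P"
    using bd unfolding bounded_poset_def by blast
  have "baxter_order n (less_in P) \<and>
    (\<forall>R m M L Q l q. R \<in> regions n P pos \<longrightarrow> region_boundary P pos R m M L Q \<longrightarrow>
      l \<in> L - {m, M} \<longrightarrow> q \<in> Q - {m, M} \<longrightarrow>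
      less_in P m l \<and> less_in P l M \<and> less_in P m q \<and> less_in P q M \<and> (M = Suc m \<or> m = Suc M) \<and> l < m \<and> m < q) \<and>
    (\<forall>m M A B. split_interval (less_in P) m M A B \<longrightarrow> (\<exists>R\<in>regions n P pos.
      region_boundary P pos R m M (right_boundary (less_in P) A \<union> {m, M}) (left_boundary (less_in P) B \<union> {m, M})))"
  \<comment> \<open>In a one-element poset there are no strict relations, so no boundary data and no
    cells exist. The drawing locale covers the remaining case.\<close>
  proof (cases "b = t")
    case True
    have "x = b" if "x \<in> {1..n}" for x
      using b(2)[OF that] t(2)[OF that] True po unfolding partial_order_on_def antisym_def by blast
    moreover have "x \<in> {1..n} \<and> y \<in> {1..n}" if "(x, y) \<in> P" for x y
      using po that by (auto simp: partial_order_on_def preorder_on_def)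
    ultimately have none: "\<not> less_in P x y" for x y unfolding less_in_def by metis
    have "baxter_order n (less_in P)"
    proof (unfold_locales, goal_cases)
      case (4 x y z) then show ?case
        using \<open>\<And>x. x \<in> {1..n} \<Longrightarrow> x = b\<close>[of x] \<open>\<And>x. x \<in> {1..n} \<Longrightarrow> x = b\<close>[of y] by simp
    next
      case (5 x y) then show ?case
        using \<open>\<And>x. x \<in> {1..n} \<Longrightarrow> x = b\<close>[of x] \<open>\<And>x. x \<in> {1..n} \<Longrightarrow> x = b\<close>[of y] by simp
    next
      case (6 x y) then show ?case
        using \<open>\<And>x. x \<in> {1..n} \<Longrightarrow> x = b\<close>[of x] \<open>\<And>x. x \<in> {1..n} \<Longrightarrow> x = b\<close>[of y] by simp
    qed (auto simp: none split_interval_def covers_def)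
    then show ?thesis by (auto simp: none region_boundary_def split_interval_def)
  next
    case False
    interpret natural_drawing n P pos b t
    proof (unfold_locales, goal_cases)
      case 1 show ?case by (rule po)
    next
      case 2 show ?case using nat unfolding natural_embedding_def by (rule conjunct1)
    next
      case 3 show ?case by (rule b(1))
    next
      case 4 show ?case by (rule t(1))
    next
      case 5 then show ?case by (rule b(2))
    next
      case 6 then show ?case by (rule t(2))
    next
      case 7 show ?case by (rule False)
    next
      case 8 show ?case by (rule nat)
    next
      case (9 x y) then show ?case using bp unfolding baxter_poset_def by blast
    next
      case (10 x) then show ?case using bp unfolding baxter_poset_def by blast
    qed (use bp in \<open>unfold baxter_poset_def, blast\<close>)+
    show ?thesis
    proof (intro conjI allI impI)
      show "baxter_order n lt" by (rule order.baxter_order_axioms)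
      fix R m M L Q l q
      assume a: "R \<in> regions n P pos" "region_boundary P pos R m M L Q" "l \<in> L - {m, M}" "q \<in> Q - {m, M}"
      from region_sides[OF this] show "lt m l" "lt l M" "lt m q" "lt q M" "M = Suc m \<or> m = Suc M" "l < m" "m < q"
        by blast+
    next
      fix m M A B assume "split_interval lt m M A B"
      from region_exists[OF this] show "\<exists>R\<in>regions n P pos.
        region_boundary P pos R m M (right_boundary lt A \<union> {m, M}) (left_boundary lt B \<union> {m, M})" .
    qed
  qed
  note c = this
  show "baxter_order n (less_in P)" using c by blast
  show "\<And>R m M L Q l q. R \<in> regions n P pos \<Longrightarrow> region_boundary P pos R m M L Q \<Longrightarrow>
      l \<in> L - {m, M} \<Longrightarrow> q \<in> Q - {m, M} \<Longrightarrow>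
      less_in P m l \<and> less_in P l M \<and> less_in P m q \<and> less_in P q M \<and> (M = Suc m \<or> m = Suc M) \<and> l < m \<and> m < q"
    using c[THEN conjunct2, THEN conjunct1] by metis
  show "\<And>m M A B. split_interval (less_in P) m M A B \<Longrightarrow> \<exists>R\<in>regions n P pos.
      region_boundary P pos R m M (right_boundary (less_in P) A \<union> {m, M}) (left_boundary (less_in P) B \<union> {m, M})"
    using c[THEN conjunct2, THEN conjunct2] by metis
qed

theorem theorem1p4:
  fixes n :: nat and P :: "nat rel" and pos :: "nat \<Rightarrow> real \<times> real"
  assumes "baxter_poset n P"
    and "natural_embedding n P pos"
  shows "(\<exists>!\<sigma>. baxter_permutation n \<sigma> \<and> linear_extension n P \<sigma>) \<and>
         (\<exists>!\<sigma>. linear_extension n P \<sigma> \<and> respects_arrows n P pos \<sigma>) \<and>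
         (\<forall>\<sigma> \<tau>. baxter_permutation n \<sigma> \<and> linear_extension n P \<sigma> \<and>
                linear_extension n P \<tau> \<and> respects_arrows n P pos \<tau> \<longrightarrow> \<sigma> = \<tau>)"
proof -
  note regions = baxter_poset_regions[OF assms]
  interpret baxter_order n "less_in P" by (rule regions(1))
  have lin: "linear_extension n P \<sigma> \<longleftrightarrow> \<sigma> permutes {1..n} \<and> extension n (less_in P) (word n \<sigma>)" for \<sigma>
    using linear_extension_word[of P n \<sigma>] carrier by blast
  obtain xs where xs: "extension n (less_in P) xs" "baxter_word xs"
    "\<And>ys. extension n (less_in P) ys \<Longrightarrow> respecting (less_in P) ys \<Longrightarrow> ys = xs"
    using baxter_order_outcome[OF regions(1)] unfolding outcome_def by blast
  obtain \<rho> where \<rho>: "\<rho> permutes {1..n}" "word n \<rho> = xs"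
    using word_surj[of xs n] xs(1) unfolding extension_def by blast
  have \<rho>_ext: "baxter_permutation n \<rho>" "linear_extension n P \<rho>"
    using \<rho> xs baxter_permutation_word lin by auto
  \<comment> \<open>\<open>regions(2)\<close> extracts from a drawn region exactly the numerical
    data that \<open>baxter_word_split\<close> asks for.\<close>
  have respects: "respects_arrows n P pos \<sigma>"
    if \<sigma>: "baxter_permutation n \<sigma>" "linear_extension n P \<sigma>" for \<sigma>
    unfolding respects_arrows_def
  proof (intro ballI allI impI)
    fix R m M L Q l q
    assume a: "R \<in> regions n P pos" "region_boundary P pos R m M L Q" "l \<in> L - {m, M}" "q \<in> Q - {m, M}"
    have w: "\<sigma> permutes {1..n}" "baxter_word (word n \<sigma>)" "extension n (less_in P) (word n \<sigma>)"
      using \<sigma> baxter_permutation_word lin by auto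
    note s = regions(2)[OF a]
    then have "l \<noteq> q" by auto
    then have "if m < M then before (word n \<sigma>) l q else before (word n \<sigma>) q l"
      using baxter_word_split[OF w(2,3), of l q m M] s by blast
    then show "if m < M then precedes \<sigma> l q else precedes \<sigma> q l"
      using before_word[OF w(1)] by (auto split: if_splits)
  qed
  \<comment> \<open>Every cell of the order is realised by a drawn region, so obeying all drawn
    arrows implies \<open>respecting\<close>, where uniqueness is known.\<close>
  have unique: "\<sigma> = \<rho>" if \<sigma>: "linear_extension n P \<sigma>" "respects_arrows n P pos \<sigma>" for \<sigma>
  proof -
    have w: "\<sigma> permutes {1..n}" "extension n (less_in P) (word n \<sigma>)"
      using \<sigma> lin by auto
    have "respecting (less_in P) (word n \<sigma>)"
      unfolding respecting_def
    proof (intro allI impI ballI)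
      fix m M A B l q
      assume s: "split_interval (less_in P) m M A B" and l: "l \<in> right_boundary (less_in P) A"
        and q: "q \<in> left_boundary (less_in P) B"
      obtain R where R: "R \<in> regions n P pos" "region_boundary P pos R m M
          (right_boundary (less_in P) A \<union> {m, M}) (left_boundary (less_in P) B \<union> {m, M})"
        using regions(3)[OF s] by blast
      have in_n: "less_in P m l" "less_in P l M" "less_in P m q" "less_in P q M"
        using s l q unfolding split_interval_def right_boundary_def left_boundary_def by blast+
      then have "l \<notin> {m, M}" "q \<notin> {m, M}" using irrefl by auto
      then have "if m < M then precedes \<sigma> l q else precedes \<sigma> q l"
        using \<sigma>(2) R l q unfolding respects_arrows_def by blast
      then show "if m < M then before (word n \<sigma>) l q else before (word n \<sigma>) q l"
        using before_word[OF w(1)] carrier[OF in_n(1)] carrier[OF in_n(3)] by (auto split: if_splits)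
    qed
    then have "word n \<sigma> = xs" using xs(3) w by blast
    then show ?thesis using word_inj w(1) \<rho> by metis
  qed
  \<comment> \<open>A Baxter extension respects the arrows and therefore equals
    \<open>\<rho>\<close> by \<open>unique\<close>; this yields both uniqueness claims and the
    coincidence.\<close>
  show ?thesis using \<rho>_ext respects unique by blast
qed

end
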